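(* For every integer $m$ with $2\le m\le 15$ and every integer $d\ge 1$, the Kazhdan–Lusztig polynomial $P_{U_{m,d}}(t)$ of the uniform matroid $U_{m,d}$ (rank $d$ on $m+d$ elements) has only negative (real) zeros.
   Context: For a loopless matroid $M$ with lattice of flats $L(M)$, characteristic polynomial $\chi_M(t)$ and rank $\operatorname{rk} M$, the Kazhdan–Lusztig polynomial $P_M(t)\in\mathbb{Z}[t]$ is the unique assignment such that: $P_M(t)=1$ if $\operatorname{rk}M=0$; $\deg P_M(t)<\frac12\operatorname{rk}M$ if $\operatorname{rk}M>0$; and $t^{\operatorname{rk}M}P_M(t^{-1})=\sum_{F\in L(M)}\chi_{M_F}(t)P_{M^F}(t)$, where $M_F$ is the restriction of $M$ to the flat $F$ and $M^F$ is the contraction of $M$ by $F$. *)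

theory Defs
  imports Complex_Main "HOL-Computational_Algebra.Polynomial"
begin

section \<open>Matroids\<close>

record 'a indep_system =
  ground :: "'a set"
  indep :: "'a set set"

locale matroid =
  fixes M :: "'a indep_system"
  assumes finite_ground: "finite (ground M)"
    and indep_ground: "I \<in> indep M \<Longrightarrow> I \<subseteq> ground M"
    and indep_empty: "{} \<in> indep M"
    and indep_mono: "I \<in> indep M \<Longrightarrow> J \<subseteq> I \<Longrightarrow> J \<in> indep M"
    and augment: "I \<in> indep M \<Longrightarrow> J \<in> indep M \<Longrightarrow> card I < card J \<Longrightarrow>
                    \<exists>x\<in>J - I. insert x I \<in> indep M"

definition loopless :: "'a indep_system \<Rightarrow> bool" where
  "loopless M \<longleftrightarrow> (\<forall>e\<in>ground M. {e} \<in> indep M)"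

definition rank_of :: "'a indep_system \<Rightarrow> 'a set \<Rightarrow> nat" where
  "rank_of M X = Max (card ` {I \<in> indep M. I \<subseteq> X})"

abbreviation rk :: "'a indep_system \<Rightarrow> nat" where
  "rk M \<equiv> rank_of M (ground M)"

definition basis_of :: "'a indep_system \<Rightarrow> 'a set \<Rightarrow> 'a set \<Rightarrow> bool" where
  "basis_of M X B \<longleftrightarrow>
     B \<in> indep M \<and> B \<subseteq> X \<and> (\<forall>B'\<in>indep M. B \<subseteq> B' \<longrightarrow> B' \<subseteq> X \<longrightarrow> B' = B)"

definition flats :: "'a indep_system \<Rightarrow> 'a set set" where
  "flats M = {F. F \<subseteq> ground M \<and> (\<forall>e\<in>ground M - F. rank_of M F < rank_of M (insert e F))}"

definition restriction :: "'a indep_system \<Rightarrow> 'a set \<Rightarrow> 'a indep_system" where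
  "restriction M F = \<lparr>ground = F, indep = {I \<in> indep M. I \<subseteq> F}\<rparr>"

definition contraction :: "'a indep_system \<Rightarrow> 'a set \<Rightarrow> 'a indep_system" where
  "contraction M F = \<lparr>ground = ground M - F,
     indep = {I. I \<subseteq> ground M - F \<and> (\<exists>B. basis_of M F B \<and> I \<union> B \<in> indep M)}\<rparr>"

definition uniform_on :: "'a set \<Rightarrow> nat \<Rightarrow> 'a indep_system" where
  "uniform_on E k = \<lparr>ground = E, indep = {I. I \<subseteq> E \<and> card I \<le> k}\<rparr>"

definition uniform_matroid :: "nat \<Rightarrow> nat \<Rightarrow> nat indep_system" where
  "uniform_matroid m d = uniform_on {..<m + d} d"


section \<open>Characteristic polynomial\<close>

text \<open>The Moebius function of a family of finite sets ordered by inclusion; the finiteness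
  test only serves termination.\<close>

function moebius :: "'a set set \<Rightarrow> 'a set \<Rightarrow> 'a set \<Rightarrow> int" where
  "moebius L F G =
     (if F = G then 1
      else if F \<subset> G \<and> finite G then - (\<Sum>H\<in>{H\<in>L. F \<subseteq> H \<and> H \<subset> G}. moebius L F H)
      else 0)"
  by auto
termination
  by (relation "measure (\<lambda>(L, F, G). card G)") (auto intro: psubset_card_mono)

declare moebius.simps [simp del]

text \<open>Used for loopless matroids only, whose least flat is the empty set.\<close>

definition char_poly :: "'a indep_system \<Rightarrow> int poly" where
  "char_poly M = (\<Sum>F\<in>flats M. monom (moebius (flats M) {} F) (rk M - rank_of M F))"


section \<open>Kazhdan--Lusztig polynomials\<close>

text \<open>\<open>rev_poly n p\<close> is $t^n p(t^{-1})$, for \<open>degree p \<le> n\<close>.\<close>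

definition rev_poly :: "nat \<Rightarrow> int poly \<Rightarrow> int poly" where
  "rev_poly n p = monom 1 (n - degree p) * reflect_poly p"

definition kl_assignment :: "('a indep_system \<Rightarrow> int poly) \<Rightarrow> bool" where
  "kl_assignment P \<longleftrightarrow> (\<forall>M. matroid M \<longrightarrow> loopless M \<longrightarrow>
     (rk M = 0 \<longrightarrow> P M = 1) \<and>
     (rk M > 0 \<longrightarrow> 2 * degree (P M) < rk M) \<and>
     rev_poly (rk M) (P M) =
       (\<Sum>F\<in>flats M. char_poly (restriction M F) * P (contraction M F)))"

text \<open>An assignment is determined on loopless matroids only, so the description operator
  is applied pointwise. That an assignment exists and that its values on loopless matroids
  are unique is proved below.\<close>

definition kl_poly :: "'a indep_system \<Rightarrow> int poly" where
  "kl_poly M = (THE p. \<exists>P. kl_assignment P \<and> p = P M)"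


section \<open>Existence and uniqueness\<close>

lemma coeff_rev_poly:
  assumes "degree p \<le> n"
  shows "coeff (rev_poly n p) i = (if i \<le> n then coeff p (n - i) else 0)"
  using assms
  by (auto simp: rev_poly_def coeff_monom_mult coeff_reflect_poly coeff_eq_0
           intro!: arg_cong[of _ _ "coeff p"])

lemma rev_poly_mult:
  assumes "degree p \<le> a" "degree q \<le> b"
  shows "rev_poly (a + b) (p * q) = rev_poly a p * rev_poly b q"
proof (cases "p = 0 \<or> q = 0")
  case True then show ?thesis by (auto simp: rev_poly_def)
next
  case False
  then have "a + b - degree (p * q) = (a - degree p) + (b - degree q)"
    using assms by (simp add: degree_mult_eq)
  then have "monom (1::int) (a + b - degree (p * q)) = monom 1 (a - degree p) * monom 1 (b - degree q)"
    by (simp add: mult_monom)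
  then show ?thesis by (simp add: rev_poly_def reflect_poly_mult mult_ac)
qed

lemma rev_poly_sum:
  assumes "\<And>x. x \<in> A \<Longrightarrow> degree (f x) \<le> n" "finite A"
  shows "rev_poly n (sum f A) = (\<Sum>x\<in>A. rev_poly n (f x))"
proof (rule poly_eqI)
  have "degree (sum f A) \<le> n" using assms by (simp add: degree_sum_le)
  then show "coeff (rev_poly n (sum f A)) i = coeff (\<Sum>x\<in>A. rev_poly n (f x)) i" for i
    using assms by (auto simp: coeff_rev_poly coeff_sum)
qed

lemma degree_rev_poly: "degree p \<le> n \<Longrightarrow> degree (rev_poly n p) \<le> n"
  by (rule degree_le) (auto simp: coeff_rev_poly)

lemma rev_poly_monom: "k \<le> n \<Longrightarrow> rev_poly n (monom c k) = monom c (n - k)"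
proof -
  assume k: "k \<le> n"
  have "degree (monom c k) \<le> n" using k degree_monom_le[of c k] by linarith
  then show ?thesis using k by (auto simp: poly_eq_iff coeff_rev_poly)
qed

context matroid
begin

lemma finite_indep: "I \<in> indep M \<Longrightarrow> finite I"
  using finite_ground indep_ground finite_subset by blast

lemma finite_indeps: "finite {I \<in> indep M. I \<subseteq> X}"
  by (rule finite_subset[of _ "Pow (ground M)"]) (use indep_ground finite_ground in auto)

lemma card_le_rank: "I \<in> indep M \<Longrightarrow> I \<subseteq> X \<Longrightarrow> card I \<le> rank_of M X"
  unfolding rank_of_def using finite_indeps by (auto intro!: Max_ge)

lemma ex_rank: obtains I where "I \<in> indep M" "I \<subseteq> X" "card I = rank_of M X"
proof -
  have "rank_of M X \<in> card ` {I \<in> indep M. I \<subseteq> X}"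
    unfolding rank_of_def using finite_indeps indep_empty by (intro Max_in) auto
  then show thesis using that by auto
qed

lemma extend:
  assumes "I \<in> indep M" "I \<subseteq> X"
  obtains J where "J \<in> indep M" "I \<subseteq> J" "J \<subseteq> X" "card J = rank_of M X"
proof -
  have "\<exists>J\<in>indep M. I \<subseteq> J \<and> J \<subseteq> X \<and> card J = rank_of M X"
    using assms
  proof (induction "rank_of M X - card I" arbitrary: I)
    case 0
    then show ?case using card_le_rank[of I X] by (intro bexI[of _ I]) auto
  next
    case (Suc n)
    obtain K where K: "K \<in> indep M" "K \<subseteq> X" "card K = rank_of M X" by (rule ex_rank)
    have "card I < card K" using Suc.hyps(2) K by linarith
    then obtain x where x: "x \<in> K - I" "insert x I \<in> indep M"
      using augment[OF Suc.prems(1) K(1)] by blast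
    have "card (insert x I) = Suc (card I)" using x finite_indep[OF Suc.prems(1)] by simp
    then have "\<exists>J\<in>indep M. insert x I \<subseteq> J \<and> J \<subseteq> X \<and> card J = rank_of M X"
      using Suc.hyps(2) Suc.prems(2) x K by (intro Suc.hyps(1)) auto
    then show ?case by blast
  qed
  then show thesis using that by blast
qed

lemma rank_mono: "X \<subseteq> Y \<Longrightarrow> rank_of M X \<le> rank_of M Y"
  by (metis ex_rank card_le_rank subset_trans)

lemma rank_le_card: "finite X \<Longrightarrow> rank_of M X \<le> card X"
  by (metis ex_rank card_mono)

lemma indep_iff: "X \<subseteq> ground M \<Longrightarrow> X \<in> indep M \<longleftrightarrow> rank_of M X = card X"
  by (metis ex_rank card_le_rank rank_le_card card_subset_eq finite_ground finite_subset
      order_antisym order_refl)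

lemma rank_empty: "rank_of M {} = 0"
  using rank_le_card[of "{}"] by simp

lemma basis_iff: "basis_of M X B \<longleftrightarrow> B \<in> indep M \<and> B \<subseteq> X \<and> card B = rank_of M X"
proof
  assume B: "basis_of M X B"
  then obtain J where "J \<in> indep M" "B \<subseteq> J" "J \<subseteq> X" "card J = rank_of M X"
    unfolding basis_of_def using extend by metis
  with B show "B \<in> indep M \<and> B \<subseteq> X \<and> card B = rank_of M X"
    unfolding basis_of_def by metis
next
  assume B: "B \<in> indep M \<and> B \<subseteq> X \<and> card B = rank_of M X"
  then show "basis_of M X B"
    unfolding basis_of_def by (metis card_le_rank card_seteq finite_indep)
qed

lemma ex_basis: obtains B where "basis_of M X B"
  using ex_rank basis_iff by metis

lemma rank_Un_le: 
  assumes "finite I" shows "rank_of M (I \<union> F) \<le> card I + rank_of M F"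
proof -
  obtain J where J: "J \<in> indep M" "J \<subseteq> I \<union> F" "card J = rank_of M (I \<union> F)" by (rule ex_rank)
  have "card J \<le> card (J \<inter> I) + card (J \<inter> F)"
    using J by (metis card_Un_le inf.absorb_iff1 inf_sup_distrib1)
  moreover have "card (J \<inter> I) \<le> card I" using assms by (simp add: card_mono)
  moreover have "card (J \<inter> F) \<le> rank_of M F"
    using J by (intro card_le_rank) (auto intro: indep_mono)
  ultimately show ?thesis using J by linarith
qed

lemma contraction_indep_rank:
  assumes "I \<subseteq> ground M - F" "basis_of M F B"
  shows "I \<union> B \<in> indep M \<longleftrightarrow> rank_of M (I \<union> F) = card I + rank_of M F"
proof
  have fin: "finite I" using assms finite_ground finite_subset by blast
  have B: "B \<in> indep M" "B \<subseteq> F" "card B = rank_of M F" using assms basis_iff by auto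
  have dis: "card (I \<union> B) = card I + card B"
    using assms B fin finite_indep by (intro card_Un_disjoint) auto
  {
    assume "I \<union> B \<in> indep M"
    then have "card (I \<union> B) \<le> rank_of M (I \<union> F)" using B by (intro card_le_rank) auto
    then show "rank_of M (I \<union> F) = card I + rank_of M F"
      using dis B rank_Un_le[OF fin, of F] by linarith
  }
  {
    assume r: "rank_of M (I \<union> F) = card I + rank_of M F"
    obtain J where J: "J \<in> indep M" "B \<subseteq> J" "J \<subseteq> I \<union> F" "card J = rank_of M (I \<union> F)"
      using extend[of B "I \<union> F"] B by blast
    have "card (J \<inter> F) \<le> rank_of M F"
      using J by (intro card_le_rank) (auto intro: indep_mono)
    then have "B = J \<inter> F"
      using B J finite_indep by (intro card_seteq) auto
    then have sub: "J \<subseteq> I \<union> B" using J by auto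
    have "J = I \<union> B"
      by (rule card_subset_eq) (use sub fin B finite_indep J dis r in auto)
    then show "I \<union> B \<in> indep M" using J by simp
  }
qed

lemma contraction_indep:
  assumes "basis_of M F B"
  shows "I \<in> indep (contraction M F) \<longleftrightarrow> I \<subseteq> ground M - F \<and> I \<union> B \<in> indep M"
  unfolding contraction_def using assms contraction_indep_rank by auto

lemma matroid_restriction:
  assumes "F \<subseteq> ground M" shows "matroid (restriction M F)"
proof
  show "finite (ground (restriction M F))"
    using assms finite_ground finite_subset by (auto simp: restriction_def)
  fix I J assume I: "I \<in> indep (restriction M F)"
  show "I \<subseteq> ground (restriction M F)" using I by (simp add: restriction_def)
  show "J \<subseteq> I \<Longrightarrow> J \<in> indep (restriction M F)"
    using I indep_mono by (auto simp: restriction_def)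
  assume J: "J \<in> indep (restriction M F)" "card I < card J"
  show "\<exists>x\<in>J - I. insert x I \<in> indep (restriction M F)"
    using I J augment[of I J] by (auto simp: restriction_def)
qed (simp add: restriction_def indep_empty)

lemma rank_restriction: "X \<subseteq> F \<Longrightarrow> rank_of (restriction M F) X = rank_of M X"
  unfolding rank_of_def restriction_def
  by (intro arg_cong[of _ _ Max] image_cong) auto

lemma matroid_contraction: "matroid (contraction M F)"
proof -
  obtain B where B: "basis_of M F B" by (rule ex_basis)
  note ci = contraction_indep[OF B]
  show ?thesis
  proof
    show "finite (ground (contraction M F))" using finite_ground by (simp add: contraction_def)
    show "{} \<in> indep (contraction M F)" using ci B basis_iff by auto
    fix I J assume I: "I \<in> indep (contraction M F)"
    show "I \<subseteq> ground (contraction M F)" using I ci by (simp add: contraction_def)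
    show "J \<subseteq> I \<Longrightarrow> J \<in> indep (contraction M F)"
      using I ci indep_mono[of "I \<union> B" "J \<union> B"] by auto
    assume J: "J \<in> indep (contraction M F)" "card I < card J"
    have fB: "finite B" "B \<subseteq> F" using B basis_iff finite_indep by auto
    have fin: "finite I" "finite J" using I J ci finite_indep by auto
    have "card (I \<union> B) = card I + card B" "card (J \<union> B) = card J + card B"
      using fB fin I J ci by (auto intro!: card_Un_disjoint)
    then obtain x where x: "x \<in> (J \<union> B) - (I \<union> B)" "insert x (I \<union> B) \<in> indep M"
      using augment[of "I \<union> B" "J \<union> B"] I J ci by auto
    then show "\<exists>x\<in>J - I. insert x I \<in> indep (contraction M F)"
      using I J ci by (intro bexI[of _ x]) auto
  qed
qed

lemma rank_contraction:
  assumes "X \<subseteq> ground M - F"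
  shows "rank_of (contraction M F) X + rank_of M F = rank_of M (X \<union> F)"
proof -
  interpret C: matroid "contraction M F" by (rule matroid_contraction)
  obtain B where B: "basis_of M F B" by (rule ex_basis)
  note ci = contraction_indep[OF B]
  have B': "B \<in> indep M" "B \<subseteq> F" "card B = rank_of M F" using B basis_iff by auto
  obtain I where I: "I \<in> indep (contraction M F)" "I \<subseteq> X" 
      "card I = rank_of (contraction M F) X" by (rule C.ex_rank)
  have 1: "card (I \<union> B) \<le> rank_of M (X \<union> F)" using I B' ci by (intro card_le_rank) auto
  have 2: "card (I \<union> B) = card I + card B"
    using I B' ci finite_indep C.finite_indep by (intro card_Un_disjoint) auto
  obtain J where J: "J \<in> indep M" "B \<subseteq> J" "J \<subseteq> X \<union> F" "card J = rank_of M (X \<union> F)"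
    using extend[of B "X \<union> F"] B' by blast
  have "card (J \<inter> F) \<le> rank_of M F"
    using J by (intro card_le_rank) (auto intro: indep_mono)
  then have BJ: "B = J \<inter> F"
    using B' J finite_indep by (intro card_seteq) auto
  have "J - B \<in> indep (contraction M F)"
    using J BJ assms ci by (auto simp: Un_absorb2)
  then have 3: "card (J - B) \<le> rank_of (contraction M F) X"
    using J BJ by (intro C.card_le_rank) auto
  have 4: "card J = card (J - B) + card B"
    using card_mono[OF finite_indep[OF J(1)] J(2)] card_Diff_subset[OF finite_indep[OF B'(1)] J(2)]
    by linarith
  show ?thesis using 1 2 3 4 I(3) J(4) B'(3) by linarith
qed

lemma flat_ground: "ground M \<in> flats M" by (simp add: flats_def)

lemma finite_flats: "finite (flats M)"
  by (rule finite_subset[of _ "Pow (ground M)"]) (use finite_ground in \<open>auto simp: flats_def\<close>)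

lemma flat_finite: "F \<in> flats M \<Longrightarrow> finite F"
  using finite_ground finite_subset by (auto simp: flats_def)

lemma rank_insert_mono:
  assumes "G \<subseteq> F" "rank_of M F < rank_of M (insert e F)"
  shows "rank_of M G < rank_of M (insert e G)"
proof -
  obtain B where B: "B \<in> indep M" "B \<subseteq> G" "card B = rank_of M G" by (rule ex_rank)
  obtain B' where B': "B' \<in> indep M" "B \<subseteq> B'" "B' \<subseteq> F" "card B' = rank_of M F"
    using extend[of B F] B assms by blast
  obtain C where C: "C \<in> indep M" "B' \<subseteq> C" "C \<subseteq> insert e F" "card C = rank_of M (insert e F)"
    using extend[of B' "insert e F"] B' by blast
  have e: "e \<in> C"
  proof (rule ccontr)
    assume "e \<notin> C"
    then have "card C \<le> rank_of M F" using C by (intro card_le_rank) auto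
    then show False using C(4) assms(2) by linarith
  qed
  have "e \<notin> F" using assms(2) by (metis insert_absorb less_irrefl)
  have "insert e B \<in> indep M" using indep_mono[OF C(1), of "insert e B"] C(2) e B'(2) by blast
  then have "card (insert e B) \<le> rank_of M (insert e G)" using B by (intro card_le_rank) auto
  moreover have "card (insert e B) = Suc (card B)"
    using B(2) assms(1) \<open>e \<notin> F\<close> finite_indep[OF B(1)] by (intro card_insert_disjoint) auto
  ultimately show ?thesis using B by linarith
qed

lemma flats_restriction:
  assumes "F \<in> flats M" shows "flats (restriction M F) = {G \<in> flats M. G \<subseteq> F}"
proof -
  have F: "F \<subseteq> ground M" using assms by (simp add: flats_def)
  have [simp]: "ground (restriction M F) = F" by (simp add: restriction_def)
  have "G \<in> flats (restriction M F) \<longleftrightarrow> G \<in> flats M" if "G \<subseteq> F" for G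
  proof -
    have "rank_of M G < rank_of M (insert e G)" if "e \<in> ground M - F" for e
      using that assms \<open>G \<subseteq> F\<close> by (intro rank_insert_mono[of G F]) (auto simp: flats_def)
    moreover have "rank_of (restriction M F) (insert e G) = rank_of M (insert e G)" if "e \<in> F" for e
      using that \<open>G \<subseteq> F\<close> by (intro rank_restriction) auto
    ultimately show ?thesis
      using that F by (auto simp: flats_def rank_restriction)
  qed
  moreover have "G \<subseteq> F" if "G \<in> flats (restriction M F)" for G
    using that by (simp add: flats_def)
  ultimately show ?thesis by blast
qed

lemma flats_contraction:
  assumes "F \<subseteq> ground M"
  shows "H \<in> flats (contraction M F) \<longleftrightarrow> H \<inter> F = {} \<and> H \<union> F \<in> flats M"
proof (cases "H \<subseteq> ground M - F")
  case True
  have [simp]: "ground (contraction M F) = ground M - F" by (simp add: contraction_def)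
  have "rank_of (contraction M F) H < rank_of (contraction M F) (insert e H) \<longleftrightarrow>
        rank_of M (H \<union> F) < rank_of M (insert e (H \<union> F))" if "e \<in> ground M - F" for e
  proof -
    have "insert e H \<subseteq> ground M - F" using True that by blast
    then have "rank_of (contraction M F) (insert e H) + rank_of M F = rank_of M (insert e (H \<union> F))"
      using rank_contraction[of "insert e H" F] by simp
    then show ?thesis using rank_contraction[OF True] by linarith
  qed
  then show ?thesis using True assms by (auto simp: flats_def)
next
  case False
  then show ?thesis by (auto simp: flats_def contraction_def)
qed

lemma flats_contraction_image:
  assumes "F \<subseteq> ground M"
  shows "flats (contraction M F) = (\<lambda>G. G - F) ` {G \<in> flats M. F \<subseteq> G}"
proof (intro set_eqI iffI)
  fix H assume "H \<in> flats (contraction M F)"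
  then have "H \<inter> F = {}" "H \<union> F \<in> flats M" using flats_contraction[OF assms] by auto
  then show "H \<in> (\<lambda>G. G - F) ` {G \<in> flats M. F \<subseteq> G}"
    by (intro image_eqI[of _ _ "H \<union> F"]) auto
qed (auto simp: flats_contraction[OF assms] Un_absorb2)

lemma loopless_restriction: "loopless M \<Longrightarrow> F \<subseteq> ground M \<Longrightarrow> loopless (restriction M F)"
  by (auto simp: loopless_def restriction_def)

lemma loopless_contraction:
  assumes "F \<in> flats M" shows "loopless (contraction M F)"
  unfolding loopless_def
proof
  interpret C: matroid "contraction M F" by (rule matroid_contraction)
  fix e assume e: "e \<in> ground (contraction M F)"
  then have e': "e \<in> ground M - F" by (simp add: contraction_def)
  then have "rank_of M F < rank_of M (insert e F)" using assms by (auto simp: flats_def)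
  moreover have "rank_of (contraction M F) {e} + rank_of M F = rank_of M (insert e F)"
    using rank_contraction[of "{e}" F] e' by auto
  ultimately have "rank_of (contraction M F) {e} = card {e}"
    using C.rank_le_card[of "{e}"] by simp
  then show "{e} \<in> indep (contraction M F)"
    using e by (subst C.indep_iff) auto
qed

lemma flat_empty:
  assumes "loopless M" shows "{} \<in> flats M"
proof -
  have "rank_of M {e} > 0" if "e \<in> ground M" for e
    using card_le_rank[of "{e}" "{e}"] assms that by (auto simp: loopless_def)
  then show ?thesis by (auto simp: flats_def rank_empty)
qed

lemma rank_flat_pos:
  assumes "loopless M" "F \<subseteq> ground M" "F \<noteq> {}" shows "rank_of M F > 0"
proof -
  obtain e where "e \<in> F" using assms by auto
  then show ?thesis using card_le_rank[of "{e}" F] assms by (auto simp: loopless_def)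
qed

lemma degree_char_poly: "degree (char_poly M) \<le> rk M"
  unfolding char_poly_def
  by (intro degree_sum_le finite_flats order_trans[OF degree_monom_le]) auto

end

lemma matroid_eqI:
  fixes M N :: "'a indep_system"
  assumes "matroid M" "matroid N" "ground M = ground N"
    and "\<And>X. X \<subseteq> ground M \<Longrightarrow> rank_of M X = rank_of N X"
  shows "M = N"
proof -
  interpret M: matroid M by fact
  interpret N: matroid N by fact
  have "I \<in> indep M \<longleftrightarrow> I \<in> indep N" for I
    using assms M.indep_iff N.indep_iff M.indep_ground N.indep_ground by metis
  then show ?thesis using assms by (cases M, cases N) auto
qed

context matroid
begin

lemma contraction_contraction:
  assumes "F \<subseteq> G" "G \<subseteq> ground M"
  shows "contraction (contraction M F) (G - F) = contraction M G"
proof -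
  interpret C: matroid "contraction M F" by (rule matroid_contraction)
  show ?thesis
  proof (rule matroid_eqI[OF C.matroid_contraction matroid_contraction])
    show "ground (contraction (contraction M F) (G - F)) = ground (contraction M G)"
      using assms by (auto simp: contraction_def)
    fix X assume "X \<subseteq> ground (contraction (contraction M F) (G - F))"
    then have X: "X \<subseteq> ground M - G" using assms by (auto simp: contraction_def)
    have g: "ground (contraction M F) = ground M - F" by (simp add: contraction_def)
    have eqs: "X \<union> (G - F) \<union> F = X \<union> G" "G - F \<union> F = G" using assms by auto
    have "X \<subseteq> ground (contraction M F) - (G - F)" "G - F \<subseteq> ground M - F" 
      "X \<union> (G - F) \<subseteq> ground M - F" using X assms g by auto
    then show "rank_of (contraction (contraction M F) (G - F)) X = rank_of (contraction M G) X"
      using C.rank_contraction[of X "G - F"] rank_contraction[OF X]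
        rank_contraction[of "G - F" F] rank_contraction[of "X \<union> (G - F)" F]
      unfolding eqs by linarith
  qed
qed

lemma restriction_contraction:
  assumes "F \<subseteq> G" "G \<subseteq> ground M"
  shows "restriction (contraction M F) (G - F) = contraction (restriction M G) F"
proof -
  interpret C: matroid "contraction M F" by (rule matroid_contraction)
  interpret R: matroid "restriction M G" by (rule matroid_restriction) fact
  have g: "ground (contraction M F) = ground M - F" by (simp add: contraction_def)
  show ?thesis
  proof (rule matroid_eqI[OF C.matroid_restriction R.matroid_contraction])
    show "G - F \<subseteq> ground (contraction M F)" using assms g by auto
    show "ground (restriction (contraction M F) (G - F)) = ground (contraction (restriction M G) F)"
      using assms by (auto simp: contraction_def restriction_def)
    fix X assume "X \<subseteq> ground (restriction (contraction M F) (G - F))"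
    then have X: "X \<subseteq> G - F" by (auto simp: restriction_def)
    have "rank_of (restriction M G) (X \<union> F) = rank_of M (X \<union> F)"
         "rank_of (restriction M G) F = rank_of M F"
      using X assms by (auto intro!: rank_restriction)
    moreover have "X \<subseteq> ground (restriction M G) - F" using X by (simp add: restriction_def)
    moreover have "X \<subseteq> ground M - F" using X assms by auto
    ultimately show "rank_of (restriction (contraction M F) (G - F)) X =
        rank_of (contraction (restriction M G) F) X"
      using C.rank_restriction[OF X] rank_contraction[of X F] R.rank_contraction[of X F] by simp
  qed
qed

lemma contraction_empty: "contraction M {} = M"
  by (rule matroid_eqI[OF matroid_contraction matroid_axioms])
     (use rank_contraction[of _ "{}"] in \<open>auto simp: contraction_def rank_empty\<close>)

lemma restriction_ground: "restriction M (ground M) = M"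
  using indep_ground by (cases M) (auto simp: restriction_def)

end

subsection \<open>Moebius inversion\<close>

lemma moebius_refl: "moebius L F F = 1" by (simp add: moebius.simps)

lemma moebius_sum:
  assumes "finite L" "F \<in> L" "G \<in> L" "F \<subseteq> G" "finite G"
  shows "(\<Sum>H\<in>{H\<in>L. F \<subseteq> H \<and> H \<subseteq> G}. moebius L F H) = (if F = G then 1 else 0)"
proof (cases "F = G")
  case True
  then have "{H\<in>L. F \<subseteq> H \<and> H \<subseteq> G} = {F}" using assms by auto
  then show ?thesis using True by (simp add: moebius_refl)
next
  case False
  have "{H\<in>L. F \<subseteq> H \<and> H \<subseteq> G} = insert G {H\<in>L. F \<subseteq> H \<and> H \<subset> G}" using assms by auto
  then show ?thesis using False assms by (simp add: moebius.simps[of L F G] psubset_eq)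
qed

lemma moebius_sum_dual:
  assumes "finite L" "\<And>G. G \<in> L \<Longrightarrow> finite G" "H \<in> L" "K \<in> L" "H \<subseteq> K"
  shows "(\<Sum>F\<in>{F\<in>L. H \<subseteq> F \<and> F \<subseteq> K}. moebius L F K) = (if H = K then 1 else 0)"
proof -
  have "finite K" using assms by auto
  then show ?thesis using assms(4,5)
  proof (induction K rule: finite_psubset_induct)
    case (psubset K)
    let ?I = "\<lambda>A B. {F\<in>L. A \<subseteq> F \<and> F \<subseteq> B}"
    define s where "s K = (\<Sum>F\<in>?I H K. moebius L F K)" for K
    have "(\<Sum>K'\<in>?I H K. s K') = (\<Sum>K'\<in>?I H K. \<Sum>F\<in>{F\<in>?I H K. F \<subseteq> K'}. moebius L F K')"
      unfolding s_def by (intro sum.cong) auto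
    also have "\<dots> = (\<Sum>F\<in>?I H K. \<Sum>K'\<in>{K'\<in>?I H K. F \<subseteq> K'}. moebius L F K')"
      using assms(1) by (intro sum.swap_restrict) auto
    also have "\<dots> = (\<Sum>F\<in>?I H K. \<Sum>K'\<in>?I F K. moebius L F K')"
      by (intro sum.cong) auto
    also have "\<dots> = (\<Sum>F\<in>?I H K. if F = K then 1 else 0)"
      using assms psubset by (intro sum.cong refl moebius_sum) auto
    also have "\<dots> = 1" using assms(1) psubset by simp
    finally have tot: "(\<Sum>K'\<in>?I H K. s K') = 1" .
    have "(\<Sum>K'\<in>?I H K. s K') = s K + (\<Sum>K'\<in>?I H K - {K}. s K')"
      using assms(1) psubset by (intro sum.remove) auto
    also have "(\<Sum>K'\<in>?I H K - {K}. s K') = (\<Sum>K'\<in>?I H K - {K}. if H = K' then 1 else 0)"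
      unfolding s_def by (intro sum.cong refl psubset.IH) auto
    also have "\<dots> = (if H = K then 0 else 1)"
      using assms psubset by auto
    finally show ?case using tot unfolding s_def by (simp split: if_splits)
  qed
qed

lemma moebius_shift:
  assumes "finite G" "F \<subseteq> G"
  shows "moebius ((\<lambda>G. G - F) ` {G\<in>L. F \<subseteq> G}) {} (G - F) = moebius L F G"
  using assms
proof (induction G rule: finite_psubset_induct)
  case (psubset G)
  let ?L = "(\<lambda>G. G - F) ` {G\<in>L. F \<subseteq> G}"
  show ?case
  proof (cases "F = G")
    case True then show ?thesis by (simp add: moebius_refl)
  next
    case False
    have "{H\<in>?L. {} \<subseteq> H \<and> H \<subset> G - F} = (\<lambda>G. G - F) ` {H\<in>L. F \<subseteq> H \<and> H \<subset> G}"
    proof (intro equalityI subsetI)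
      fix x assume "x \<in> {H\<in>?L. {} \<subseteq> H \<and> H \<subset> G - F}"
      then obtain H where H: "H \<in> L" "F \<subseteq> H" "x = H - F" "H - F \<subset> G - F" by blast
      then have "H \<subset> G" using psubset.prems by blast
      then show "x \<in> (\<lambda>G. G - F) ` {H\<in>L. F \<subseteq> H \<and> H \<subset> G}" using H by blast
    next
      fix x assume "x \<in> (\<lambda>G. G - F) ` {H\<in>L. F \<subseteq> H \<and> H \<subset> G}"
      then obtain H where H: "H \<in> L" "F \<subseteq> H" "x = H - F" "H \<subset> G" by blast
      then have "x \<subset> G - F" by blast
      then show "x \<in> {H\<in>?L. {} \<subseteq> H \<and> H \<subset> G - F}" using H by blast
    qed
    moreover have "inj_on (\<lambda>G. G - F) {H\<in>L. F \<subseteq> H \<and> H \<subset> G}"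
      by (auto simp: inj_on_def)
    ultimately have "(\<Sum>H\<in>{H\<in>?L. {} \<subseteq> H \<and> H \<subset> G - F}. moebius ?L {} H)
        = (\<Sum>H\<in>{H\<in>L. F \<subseteq> H \<and> H \<subset> G}. moebius ?L {} (H - F))"
      by (simp add: sum.reindex)
    also have "\<dots> = (\<Sum>H\<in>{H\<in>L. F \<subseteq> H \<and> H \<subset> G}. moebius L F H)"
      by (intro sum.cong refl psubset.IH) auto
    finally show ?thesis
      using False psubset by (subst (1 2) moebius.simps) auto
  qed
qed

lemma moebius_below:
  assumes "finite G" "G \<subseteq> U"
  shows "moebius {H\<in>L. H \<subseteq> U} F G = moebius L F G"
  using assms
proof (induction G rule: finite_psubset_induct)
  case (psubset G)
  have "(\<Sum>H\<in>{H\<in>{H\<in>L. H \<subseteq> U}. F \<subseteq> H \<and> H \<subset> G}. moebius {H\<in>L. H \<subseteq> U} F H)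
     = (\<Sum>H\<in>{H\<in>L. F \<subseteq> H \<and> H \<subset> G}. moebius L F H)"
    using psubset by (intro sum.cong psubset.IH) auto
  then show ?case by (subst (1 2) moebius.simps) auto
qed

context matroid
begin

lemma char_poly_interval:
  assumes "F \<in> flats M" "G \<in> flats M" "F \<subseteq> G"
  shows "char_poly (contraction (restriction M G) F) =
    (\<Sum>H\<in>{H\<in>flats M. F \<subseteq> H \<and> H \<subseteq> G}. monom (moebius (flats M) F H) (rank_of M G - rank_of M H))"
proof -
  have G: "G \<subseteq> ground M" using assms by (simp add: flats_def)
  interpret R: matroid "restriction M G" by (rule matroid_restriction) fact
  let ?N = "contraction (restriction M G) F"
  have g: "ground (restriction M G) = G" "ground ?N = G - F"
    by (simp_all add: restriction_def contraction_def)
  have fl: "flats ?N = (\<lambda>G. G - F) ` {H \<in> {H\<in>flats M. H \<subseteq> G}. F \<subseteq> H}"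
    using R.flats_contraction_image[of F] assms g flats_restriction by simp
  have rk: "rank_of ?N (H - F) + rank_of M F = rank_of M H" if "F \<subseteq> H" "H \<subseteq> G" for H
  proof -
    have "rank_of ?N (H - F) + rank_of (restriction M G) F = rank_of (restriction M G) (H - F \<union> F)"
      using that g by (intro R.rank_contraction) auto
    moreover have "H - F \<union> F = H" using that by auto
    ultimately show ?thesis using that rank_restriction[of F G] rank_restriction[of H G] by auto
  qed
  have mo: "moebius (flats ?N) {} (H - F) = moebius (flats M) F H" 
    if "H \<in> flats M" "F \<subseteq> H" "H \<subseteq> G" for H
    unfolding fl using moebius_shift[OF flat_finite[OF that(1)] that(2), of "{H\<in>flats M. H \<subseteq> G}"]
      moebius_below[OF flat_finite[OF that(1)] that(3), of "flats M" F] by (rule trans)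
  have "char_poly ?N = (\<Sum>H\<in>{H \<in> {H\<in>flats M. H \<subseteq> G}. F \<subseteq> H}.
      monom (moebius (flats ?N) {} (H - F)) (rk ?N - rank_of ?N (H - F)))"
    unfolding char_poly_def
    by (subst (1) fl, subst sum.reindex) (auto simp: inj_on_def)
  also have "\<dots> = (\<Sum>H\<in>{H\<in>flats M. F \<subseteq> H \<and> H \<subseteq> G}.
      monom (moebius (flats M) F H) (rank_of M G - rank_of M H))"
  proof (intro sum.cong)
    fix H assume H: "H \<in> {H\<in>flats M. F \<subseteq> H \<and> H \<subseteq> G}"
    have "rk ?N - rank_of ?N (H - F) = rank_of M G - rank_of M H"
      using rk[of H] rk[of G] H assms g by simp
    then show "monom (moebius (flats ?N) {} (H - F)) (rk ?N - rank_of ?N (H - F)) =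
      monom (moebius (flats M) F H) (rank_of M G - rank_of M H)"
      using mo H by simp
  qed auto
  finally show ?thesis .
qed

lemma char_poly_restriction:
  assumes "loopless M" "G \<in> flats M"
  shows "char_poly (restriction M G) =
    (\<Sum>H\<in>{H\<in>flats M. H \<subseteq> G}. monom (moebius (flats M) {} H) (rank_of M G - rank_of M H))"
proof -
  interpret R: matroid "restriction M G" 
    using assms by (intro matroid_restriction) (simp add: flats_def)
  show ?thesis
    using char_poly_interval[OF flat_empty[OF assms(1)] assms(2)] R.contraction_empty by simp
qed

lemma rev_char_poly_restriction:
  assumes "loopless M" "G \<in> flats M"
  shows "rev_poly (rank_of M G) (char_poly (restriction M G)) =
    (\<Sum>H\<in>{H\<in>flats M. H \<subseteq> G}. monom (moebius (flats M) {} H) (rank_of M H))"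
proof -
  have "rev_poly (rank_of M G) (char_poly (restriction M G)) = (\<Sum>H\<in>{H\<in>flats M. H \<subseteq> G}. 
      rev_poly (rank_of M G) (monom (moebius (flats M) {} H) (rank_of M G - rank_of M H)))"
    unfolding char_poly_restriction[OF assms] using finite_flats
    by (intro rev_poly_sum order_trans[OF degree_monom_le]) auto
  also have "\<dots> = (\<Sum>H\<in>{H\<in>flats M. H \<subseteq> G}. monom (moebius (flats M) {} H) (rank_of M H))"
    by (intro sum.cong) (auto simp: rev_poly_monom rank_mono)
  finally show ?thesis .
qed

lemma char_poly_kernel:
  assumes "loopless M" "G \<in> flats M" "G \<noteq> {}"
  shows "(\<Sum>F\<in>{F\<in>flats M. F \<subseteq> G}. rev_poly (rank_of M F) (char_poly (restriction M F)) *
            char_poly (contraction (restriction M G) F)) = 0"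
proof -
  let ?L = "flats M" and ?m = "moebius (flats M)" and ?r = "rank_of M"
  let ?D = "{F\<in>flats M. F \<subseteq> G}"
  let ?f = "\<lambda>H F K. monom (?m {} H) (?r H) * monom (?m F K) (?r G - ?r K)"
  have fD: "finite ?D" using finite_flats by simp
  have "(\<Sum>F\<in>?D. rev_poly (?r F) (char_poly (restriction M F)) *
            char_poly (contraction (restriction M G) F))
     = (\<Sum>F\<in>?D. (\<Sum>H\<in>{H\<in>?D. H \<subseteq> F}. monom (?m {} H) (?r H)) *
                 (\<Sum>K\<in>{K\<in>?D. F \<subseteq> K}. monom (?m F K) (?r G - ?r K)))"
  proof (intro sum.cong refl)
    fix F assume F: "F \<in> ?D"
    have "{H\<in>?L. H \<subseteq> F} = {H\<in>?D. H \<subseteq> F}" "{H\<in>?L. F \<subseteq> H \<and> H \<subseteq> G} = {K\<in>?D. F \<subseteq> K}"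
      using F by auto
    then show "rev_poly (?r F) (char_poly (restriction M F)) *
            char_poly (contraction (restriction M G) F) = 
         (\<Sum>H\<in>{H\<in>?D. H \<subseteq> F}. monom (?m {} H) (?r H)) *
                 (\<Sum>K\<in>{K\<in>?D. F \<subseteq> K}. monom (?m F K) (?r G - ?r K))"
      using rev_char_poly_restriction[OF assms(1), of F] char_poly_interval[of F G] F assms
      by simp
  qed
  also have "\<dots> = (\<Sum>F\<in>?D. \<Sum>H\<in>{H\<in>?D. H \<subseteq> F}. \<Sum>K\<in>{K\<in>?D. F \<subseteq> K}. ?f H F K)"
    by (simp only: sum_product)
  also have "\<dots> = (\<Sum>H\<in>?D. \<Sum>F\<in>{F\<in>?D. H \<subseteq> F}. \<Sum>K\<in>{K\<in>?D. F \<subseteq> K}. ?f H F K)"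
    by (rule sum.swap_restrict[OF fD fD])
  also have "\<dots> = (\<Sum>H\<in>?D. monom (?m {} H) (?r G))"
  proof (intro sum.cong refl)
    fix H assume H: "H \<in> ?D"
    let ?E = "{F\<in>?D. H \<subseteq> F}"
    have fE: "finite ?E" using finite_flats by simp
    have "(\<Sum>F\<in>?E. \<Sum>K\<in>{K\<in>?D. F \<subseteq> K}. ?f H F K) = (\<Sum>F\<in>?E. \<Sum>K\<in>{K\<in>?E. F \<subseteq> K}. ?f H F K)"
      by (intro sum.cong) auto
    also have "\<dots> = (\<Sum>K\<in>?E. \<Sum>F\<in>{F\<in>?E. F \<subseteq> K}. ?f H F K)"
      by (rule sum.swap_restrict[OF fE fE])
    also have "\<dots> = (\<Sum>K\<in>?E. monom (?m {} H * (\<Sum>F\<in>{F\<in>?L. H \<subseteq> F \<and> F \<subseteq> K}. ?m F K)) (?r H + (?r G - ?r K)))"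
    proof (intro sum.cong refl)
      fix K assume K: "K \<in> ?E"
      have "{F\<in>?E. F \<subseteq> K} = {F\<in>?L. H \<subseteq> F \<and> F \<subseteq> K}" using K by auto
      then show "(\<Sum>F\<in>{F\<in>?E. F \<subseteq> K}. ?f H F K) = 
         monom (?m {} H * (\<Sum>F\<in>{F\<in>?L. H \<subseteq> F \<and> F \<subseteq> K}. ?m F K)) (?r H + (?r G - ?r K))"
        by (simp add: mult_monom sum_distrib_left monom_sum)
    qed
    also have "\<dots> = (\<Sum>K\<in>?E. if H = K then monom (?m {} H) (?r G) else 0)"
    proof (intro sum.cong refl)
      fix K assume K: "K \<in> ?E"
      have "(\<Sum>F\<in>{F\<in>?L. H \<subseteq> F \<and> F \<subseteq> K}. ?m F K) = (if H = K then 1 else 0)"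
        using finite_flats flat_finite H K by (intro moebius_sum_dual) auto
      then show "monom (?m {} H * (\<Sum>F\<in>{F\<in>?L. H \<subseteq> F \<and> F \<subseteq> K}. ?m F K)) (?r H + (?r G - ?r K))
          = (if H = K then monom (?m {} H) (?r G) else 0)"
        using K rank_mono[of K G] by auto
    qed
    also have "\<dots> = monom (?m {} H) (?r G)" using fE H by simp
    finally show "(\<Sum>F\<in>?E. \<Sum>K\<in>{K\<in>?D. F \<subseteq> K}. ?f H F K) = monom (?m {} H) (?r G)" .
  qed
  also have "\<dots> = monom (\<Sum>H\<in>?D. ?m {} H) (?r G)" by (simp add: monom_sum)
  also have "(\<Sum>H\<in>?D. ?m {} H) = 0"
    using moebius_sum[OF finite_flats flat_empty[OF assms(1)] assms(2)] flat_finite assms by simp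
  finally show ?thesis by simp
qed

end

subsection \<open>The recursive construction\<close>

definition trunc_half :: "nat \<Rightarrow> int poly \<Rightarrow> int poly" where
  "trunc_half n p = (\<Sum>i\<in>{i. 2 * i < n}. monom (coeff p i) i)"

lemma coeff_trunc_half: "coeff (trunc_half n p) i = (if 2 * i < n then coeff p i else 0)"
proof -
  have "finite {i. 2 * i < n}" by (rule finite_subset[of _ "{..n}"]) auto
  then show ?thesis by (simp add: trunc_half_def coeff_sum)
qed

function kl_rec :: "'a indep_system \<Rightarrow> int poly" where
  "kl_rec M = (if \<not> finite (ground M) then 0 else if rk M = 0 then 1 else
     - trunc_half (rk M)
         (\<Sum>F\<in>{F \<in> flats M. F \<noteq> {}}. char_poly (restriction M F) * kl_rec (contraction M F)))"
  by auto
termination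
  by (relation "measure (\<lambda>M. card (ground M))")
     (auto simp: flats_def contraction_def intro!: psubset_card_mono)

declare kl_rec.simps [simp del]

lemma (in matroid) char_poly_rank0:
  assumes "loopless M" "rk M = 0" shows "flats M = {{}}" "char_poly M = 1" "ground M = {}"
proof -
  show g: "ground M = {}" using rank_flat_pos[OF assms(1), of "ground M"] assms by auto
  then show fl: "flats M = {{}}" by (auto simp: flats_def)
  show "char_poly M = 1" by (simp add: char_poly_def fl g moebius_refl rank_empty monom_eq_1)
qed

lemma (in matroid) char_poly_restriction_empty:
  assumes "loopless M" shows "char_poly (restriction M {}) = 1"
proof -
  interpret Z: matroid "restriction M {}" by (rule matroid_restriction) simp
  have "ground (restriction M {}) = {}" by (simp add: restriction_def)
  then show ?thesis
    using Z.char_poly_rank0(2)[OF loopless_restriction[OF assms]] Z.rank_empty by simp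
qed

lemma kl_rec_props:
  assumes "matroid M" "loopless M"
  shows "(rk M = 0 \<longrightarrow> kl_rec M = 1) \<and> (rk M > 0 \<longrightarrow> 2 * degree (kl_rec M) < rk M) \<and>
     rev_poly (rk M) (kl_rec M) =
       (\<Sum>F\<in>flats M. char_poly (restriction M F) * kl_rec (contraction M F))"
  using assms
proof (induction "card (ground M)" arbitrary: M rule: less_induct)
  case less
  interpret matroid M by fact
  have ll: "loopless M" by fact
  show ?case
  proof (cases "rk M = 0")
    case True
    have "restriction M {} = M" using restriction_ground char_poly_rank0[OF ll True] by simp
    moreover have "kl_rec M = 1" using True finite_ground by (subst kl_rec.simps) simp
    ultimately show ?thesis
      using char_poly_rank0[OF ll True] True contraction_empty by (simp add: rev_poly_def)
  next
    case False
    let ?n = "rk M" and ?L = "flats M"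
    let ?L' = "{F\<in>flats M. F \<noteq> {}}"
    let ?c = "\<lambda>F. char_poly (restriction M F)" and ?P = "\<lambda>F. kl_rec (contraction M F)"
    define R where "R = (\<Sum>F\<in>?L'. ?c F * ?P F)"
    have fL: "finite ?L'" using finite_flats by simp
    have sub: "F \<subseteq> ground M" if "F \<in> ?L" for F using that by (simp add: flats_def)
    have rkF: "rk (contraction M F) + rank_of M F = ?n" if "F \<in> ?L" for F
      using rank_contraction[of "ground M - F" F] sub[OF that]
      by (simp add: contraction_def Un_absorb2)
    have P: "kl_rec M = - trunc_half ?n R"
      using False finite_ground unfolding R_def by (subst kl_rec.simps) simp
    have IH: "(rk (contraction M F) = 0 \<longrightarrow> ?P F = 1) \<and>
          (rk (contraction M F) > 0 \<longrightarrow> 2 * degree (?P F) < rk (contraction M F)) \<and>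
          rev_poly (rk (contraction M F)) (?P F) =
       (\<Sum>G\<in>flats (contraction M F). char_poly (restriction (contraction M F) G) *
           kl_rec (contraction (contraction M F) G))" if "F \<in> ?L'" for F
    proof (rule less.hyps)
      show "card (ground (contraction M F)) < card (ground M)"
        using that finite_ground by (auto simp: contraction_def flats_def intro!: psubset_card_mono)
    qed (use that matroid_contraction loopless_contraction in auto)
    have degP: "degree (?P F) \<le> rk (contraction M F)" if "F \<in> ?L'" for F
      using IH[OF that] by (cases "rk (contraction M F) = 0") auto
    have degc: "degree (?c F) \<le> rank_of M F" if "F \<in> ?L" for F
    proof -
      interpret Q: matroid "restriction M F" using sub[OF that] by (rule matroid_restriction)
      show ?thesis using Q.degree_char_poly rank_restriction[of F F] by (simp add: restriction_def)
    qed
    have degcP: "degree (?c F * ?P F) \<le> ?n" if "F \<in> ?L'" for F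
      using degP[OF that] degc[of F] rkF[of F] that degree_mult_le[of "?c F" "?P F"] by auto
    have degR: "degree R \<le> ?n"
      unfolding R_def using fL degcP by (intro degree_sum_le) auto
    have IH2: "rev_poly (rk (contraction M F)) (?P F) = (\<Sum>G\<in>{G\<in>?L'. F \<subseteq> G}. 
           char_poly (contraction (restriction M G) F) * ?P G)" if "F \<in> ?L'" for F
    proof -
      have F: "F \<subseteq> ground M" using that sub by auto
      have "rev_poly (rk (contraction M F)) (?P F) = (\<Sum>G\<in>(\<lambda>G. G - F) ` {G \<in> ?L. F \<subseteq> G}. 
          char_poly (restriction (contraction M F) G) *
           kl_rec (contraction (contraction M F) G))"
        using IH[OF that] flats_contraction_image[OF F] by simp
      also have "\<dots> = (\<Sum>G\<in>{G \<in> ?L. F \<subseteq> G}. 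
          char_poly (restriction (contraction M F) (G - F)) *
           kl_rec (contraction (contraction M F) (G - F)))"
        by (subst sum.reindex) (auto simp: inj_on_def)
      also have "\<dots> = (\<Sum>G\<in>{G\<in>?L'. F \<subseteq> G}. char_poly (contraction (restriction M G) F) * ?P G)"
        using that sub
        by (intro sum.cong) (auto simp: contraction_contraction restriction_contraction)
      finally show ?thesis .
    qed
    have "rev_poly ?n R = (\<Sum>F\<in>?L'. rev_poly ?n (?c F * ?P F))"
      unfolding R_def using fL degcP by (intro rev_poly_sum) auto
    also have "\<dots> = (\<Sum>F\<in>?L'. rev_poly (rank_of M F) (?c F) * rev_poly (rk (contraction M F)) (?P F))"
    proof (intro sum.cong refl)
      fix F assume F: "F \<in> ?L'"
      then have "?n = rank_of M F + rk (contraction M F)" using rkF by fastforce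
      then show "rev_poly ?n (?c F * ?P F) =
          rev_poly (rank_of M F) (?c F) * rev_poly (rk (contraction M F)) (?P F)"
        using F degc degP by (simp add: rev_poly_mult)
    qed
    also have "\<dots> = (\<Sum>F\<in>?L'. \<Sum>G\<in>{G\<in>?L'. F \<subseteq> G}. rev_poly (rank_of M F) (?c F) *
         char_poly (contraction (restriction M G) F) * ?P G)"
      by (intro sum.cong) (simp_all add: IH2 sum_distrib_left mult.assoc)
    also have "\<dots> = (\<Sum>G\<in>?L'. \<Sum>F\<in>{F\<in>?L'. F \<subseteq> G}. rev_poly (rank_of M F) (?c F) *
         char_poly (contraction (restriction M G) F) * ?P G)"
      by (rule sum.swap_restrict[OF fL fL])
    also have "\<dots> = (\<Sum>G\<in>?L'. - (?c G * ?P G))"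
    proof (intro sum.cong refl)
      fix G assume G: "G \<in> ?L'"
      let ?g = "\<lambda>F. rev_poly (rank_of M F) (?c F) * char_poly (contraction (restriction M G) F)"
      interpret Q: matroid "restriction M G" using sub[of G] G by (intro matroid_restriction) auto
      have "char_poly (restriction M {}) = 1"
        by (rule char_poly_restriction_empty[OF ll])
      then have g0: "?g {} = ?c G" by (simp add: Q.contraction_empty rank_empty rev_poly_def)
      have "{F\<in>?L. F \<subseteq> G} = insert {} {F\<in>?L'. F \<subseteq> G}" using flat_empty[OF ll] by auto
      then have "0 = ?g {} + (\<Sum>F\<in>{F\<in>?L'. F \<subseteq> G}. ?g F)"
        using char_poly_kernel[OF ll, of G] G finite_flats by simp
      then have "(\<Sum>F\<in>{F\<in>?L'. F \<subseteq> G}. ?g F) = - ?c G" using g0 by (simp add: eq_neg_iff_add_eq_0 add.commute)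
      then show "(\<Sum>F\<in>{F\<in>?L'. F \<subseteq> G}. ?g F * ?P G) = - (?c G * ?P G)"
        by (simp flip: sum_distrib_right)
    qed
    also have "\<dots> = - R" by (simp add: R_def sum_negf)
    finally have anti: "rev_poly ?n R = - R" .
    have antic: "coeff R (?n - i) = - coeff R i" if "i \<le> ?n" for i
      using arg_cong[OF anti, of "\<lambda>p. coeff p i"] that degR by (simp add: coeff_rev_poly)
    have deg: "2 * degree (kl_rec M) < ?n"
    proof (cases "kl_rec M = 0")
      case False
      then have "coeff (kl_rec M) (degree (kl_rec M)) \<noteq> 0" by simp
      then show ?thesis unfolding P by (auto simp: coeff_trunc_half split: if_splits)
    qed (use False in simp)
    have "rev_poly ?n (kl_rec M) = kl_rec M + R"
    proof (rule poly_eqI)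
      fix i
      have d: "degree (kl_rec M) \<le> ?n" using deg by simp
      note rc = coeff_rev_poly[OF d, of i]
      have pc: "coeff (kl_rec M) j = (if 2 * j < ?n then - coeff R j else 0)" for j
        unfolding P by (simp add: coeff_trunc_half)
      consider "i > ?n" | "i \<le> ?n" "2 * i < ?n" | "i \<le> ?n" "2 * i > ?n" | "2 * i = ?n" by linarith
      then show "coeff (rev_poly ?n (kl_rec M)) i = coeff (kl_rec M + R) i"
      proof cases
        case 1
        then have "coeff R i = 0" using degR by (intro coeff_eq_0) simp
        with 1 show ?thesis unfolding coeff_add rc pc by simp
      next
        case 2
        then show ?thesis unfolding coeff_add rc pc by simp
      next
        case 3
        then show ?thesis using antic[of i] unfolding coeff_add rc pc by simp
      next
        case 4
        then have "?n - i = i" "i \<le> ?n" by linarith+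
        then have "coeff R i = 0" using antic[of i] by simp
        with 4 show ?thesis unfolding coeff_add rc pc by simp
      qed
    qed
    moreover have "(\<Sum>F\<in>?L. ?c F * ?P F) = kl_rec M + R"
    proof -
      have "char_poly (restriction M {}) = 1"
        by (rule char_poly_restriction_empty[OF ll])
      moreover have "?L = insert {} ?L'" using flat_empty[OF ll] by auto
      then have "(\<Sum>F\<in>?L. ?c F * ?P F) = (\<Sum>F\<in>insert {} ?L'. ?c F * ?P F)" by simp
      ultimately show ?thesis using fL contraction_empty by (simp add: R_def)
    qed
    ultimately show ?thesis using deg False by simp
  qed
qed

theorem kl_assignment_exists: "\<exists>P. kl_assignment (P :: 'a indep_system \<Rightarrow> int poly)"
  using kl_rec_props unfolding kl_assignment_def by (intro exI[of _ kl_rec]) blast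

theorem kl_assignment_unique:
  assumes "kl_assignment P" "kl_assignment Q" "matroid M" "loopless M"
  shows "P M = Q M"
  using assms(3,4)
proof (induction "card (ground M)" arbitrary: M rule: less_induct)
  case less
  interpret matroid M by fact
  have ll: "loopless M" by fact
  show ?case
  proof (cases "rk M = 0")
    case True
    then show ?thesis using assms(1,2) less.prems unfolding kl_assignment_def by metis
  next
    case False
    let ?n = "rk M" and ?L' = "{F\<in>flats M. F \<noteq> {}}"
    define R where "R = (\<Sum>F\<in>?L'. char_poly (restriction M F) * P (contraction M F))"
    have RQ: "R = (\<Sum>F\<in>?L'. char_poly (restriction M F) * Q (contraction M F))"
      unfolding R_def
    proof (intro sum.cong refl)
      fix F assume F: "F \<in> ?L'"
      have "P (contraction M F) = Q (contraction M F)"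
      proof (rule less.hyps)
        show "card (ground (contraction M F)) < card (ground M)"
          using F finite_ground by (auto simp: contraction_def flats_def intro!: psubset_card_mono)
      qed (use F matroid_contraction loopless_contraction in auto)
      then show "char_poly (restriction M F) * P (contraction M F) =
          char_poly (restriction M F) * Q (contraction M F)" by simp
    qed
    have c0: "char_poly (restriction M {}) = 1"
      by (rule char_poly_restriction_empty[OF ll])
    have fL: "finite ?L'" using finite_flats by simp
    have L: "flats M = insert {} ?L'" using flat_empty[OF ll] by auto
    have split: "(\<Sum>F\<in>flats M. char_poly (restriction M F) * S (contraction M F)) =
        S M + (\<Sum>F\<in>?L'. char_poly (restriction M F) * S (contraction M F))" for S :: "'a indep_system \<Rightarrow> int poly"
      by (subst L) (use fL c0 contraction_empty in simp)
    have main: "S M = - trunc_half ?n R"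
      if "kl_assignment S" "R = (\<Sum>F\<in>?L'. char_poly (restriction M F) * S (contraction M F))"
      for S :: "'a indep_system \<Rightarrow> int poly"
    proof -
      have d: "2 * degree (S M) < ?n" and e: "rev_poly ?n (S M) = S M + R"
        using that less.prems False split[of S] unfolding kl_assignment_def by auto
      show ?thesis
      proof (rule poly_eqI)
        fix i
        show "coeff (S M) i = coeff (- trunc_half ?n R) i"
        proof (cases "2 * i < ?n")
          case True
          then have "coeff (S M) (?n - i) = 0" using d by (intro coeff_eq_0) simp
          then show ?thesis
            using arg_cong[OF e, of "\<lambda>p. coeff p i"] True d
            by (simp add: coeff_rev_poly coeff_trunc_half)
        next
          case False
          then have "coeff (S M) i = 0" using d by (intro coeff_eq_0) simp
          then show ?thesis using False by (simp add: coeff_trunc_half)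
        qed
      qed
    qed
    show ?thesis using main[OF assms(1) R_def] main[OF assms(2) RQ] by simp
  qed
qed

theorem kl_poly_eq:
  assumes "kl_assignment P" "matroid M" "loopless M"
  shows "kl_poly M = P M"
  unfolding kl_poly_def using assms kl_assignment_unique by (intro the_equality) blast+

theorem kl_assignment_kl_poly: "kl_assignment (kl_poly :: 'a indep_system \<Rightarrow> int poly)"
proof -
  obtain P :: "'a indep_system \<Rightarrow> int poly" where P: "kl_assignment P"
    using kl_assignment_exists by auto
  have "kl_poly (contraction M F) = P (contraction M F)" 
    if "matroid M" "loopless M" "F \<in> flats M" for M :: "'a indep_system" and F
    using that P matroid.matroid_contraction matroid.loopless_contraction
    by (intro kl_poly_eq) auto
  then show ?thesis
    using P kl_poly_eq[OF P] unfolding kl_assignment_def by (simp cong: sum.cong)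
qed

lemma matroid_uniform_on:
  assumes "finite E" shows "matroid (uniform_on E k)"
proof
  fix I J assume I: "I \<in> indep (uniform_on E k)"
  then have fI: "finite I" using assms finite_subset by (auto simp: uniform_on_def)
  show "I \<subseteq> ground (uniform_on E k)" using I by (simp add: uniform_on_def)
  show "J \<subseteq> I \<Longrightarrow> J \<in> indep (uniform_on E k)"
    using I fI card_mono[of I J] by (auto simp: uniform_on_def)
  assume J: "J \<in> indep (uniform_on E k)" "card I < card J"
  then have "\<not> J \<subseteq> I" using fI card_mono[of I J] by auto
  then show "\<exists>x\<in>J - I. insert x I \<in> indep (uniform_on E k)"
    using I J fI by (auto simp: uniform_on_def card_insert_if)
qed (use assms in \<open>auto simp: uniform_on_def\<close>)

lemma matroid_uniform: "matroid (uniform_matroid m d)"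
  by (simp add: uniform_matroid_def matroid_uniform_on)

lemma loopless_uniform: "d \<ge> 1 \<Longrightarrow> loopless (uniform_matroid m d)"
  by (auto simp: uniform_matroid_def uniform_on_def loopless_def)

lemma rk_uniform: "rk (uniform_matroid m d) = d"
proof -
  interpret matroid "uniform_matroid m d" by (rule matroid_uniform)
  have "card {..<d} \<le> rk (uniform_matroid m d)"
    by (rule card_le_rank) (auto simp: uniform_matroid_def uniform_on_def)
  moreover obtain I where "I \<in> indep (uniform_matroid m d)" "card I = rk (uniform_matroid m d)"
    using ex_rank by metis
  ultimately show ?thesis by (auto simp: uniform_matroid_def uniform_on_def)
qed

end

theory Submission
  imports "HOL-Complex_Analysis.Complex_Analysis" "HOL-Computational_Algebra.Computational_Algebra" Defs
begin

text \<open>The defining recursion of the polynomials of \<open>U\<^sub>m\<^sub>,\<^sub>d\<close>, for fixed \<open>m\<close>, is solved by a binomial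
  transform in \<open>d\<close>. With \<open>M = m - 1\<close> the coefficient of \<open>t\<^sup>i\<close> is
  \<open>(d + m)! / ((d + m - i)! (i + m)!)\<close> times \<open>d - 1 - i choose i\<close> times \<open>Q i\<close>, for a polynomial \<open>Q\<close> of
  degree \<open>2 * M\<close>. The polynomial with coefficients \<open>d - 1 - i choose i\<close> is a Fibonacci polynomial and has
  only negative roots, and the factors \<open>1 / (d + m - i)!\<close> and \<open>1 / (i + m)!\<close> are multiplier sequences.
  Multiplication by \<open>Q i\<close> is \<open>Q\<close> applied to the Euler operator, so it suffices to treat the linear and the
  real quadratic factors of \<open>Q\<close>. These are harmless if every root of \<open>Q\<close> is negative or lies to the
  right of \<open>d - 2\<close> with small imaginary part, which holds for \<open>d \<ge> max 18 (3 * m - 1)\<close>: sign changes at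
  \<open>0, -1, ..., -M\<close> give \<open>M\<close> roots, and Rouche's theorem on a circle to the right of \<open>d - 2\<close> gives the
  others. For the finitely many remaining pairs \<open>(m, d)\<close>, enough sign changes of the polynomial with
  coefficients \<open>(d - 1 - i choose i) * Q i\<close> are exhibited.\<close>

section \<open>Kazhdan--Lusztig polynomials of uniform matroids\<close>

text \<open>The right-hand roots of \<open>Q\<close> are only localised, not shown to be real, so
  multiplication by \<open>Q i\<close> cannot be split into real linear factors alone. A conjugate
  pair \<open>a + b * \<i>\<close>, \<open>a - b * \<i>\<close> is harmless on polynomials of degree
  at most \<open>n\<close> once \<open>a \<ge> 2 * n - 1\<close> and \<open>b ^ 2 \<le> a\<close>.
  The Fibonacci polynomial has degree at most \<open>n = (d - 1) div 2\<close>, so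
  \<open>a \<ge> d - 2\<close> suffices for the first condition; this is why the circle starts at
  \<open>d - 2\<close>. The roots inside it satisfy \<open>\<bar>b\<bar> < 4\<close>, and
  \<open>16 \<le> d - 2\<close> is the bound \<open>18 \<le> d\<close>. The bound
  \<open>3 * m - 1 = 3 * M + 2 \<le> d\<close> says that the circle lies in the half plane of real
  part at least \<open>3 * M\<close>, where \<open>Q\<close> is dominated by an explicit product
  with known roots. For \<open>m \<le> 15\<close> the pairs left over have
  \<open>d \<le> 43\<close>.\<close>

lemma ground_uniform_on [simp]: "ground (uniform_on E k) = E"
  by (simp add: uniform_on_def)

lemma rank_uniform_on:
  assumes "finite E" "X \<subseteq> E"
  shows "rank_of (uniform_on E k) X = min (card X) k"
proof -
  interpret matroid "uniform_on E k" using assms(1) by (rule matroid_uniform_on)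
  have fX: "finite X" using assms finite_subset by blast
  obtain I where I: "I \<in> indep (uniform_on E k)" "I \<subseteq> X" "card I = rank_of (uniform_on E k) X"
    by (rule ex_rank)
  obtain J where "J \<subseteq> X" "card J = min (card X) k"
    using obtain_subset_with_card_n[of "min (card X) k" X] by auto
  then have "card J \<le> rank_of (uniform_on E k) X"
    using assms by (intro card_le_rank) (auto simp: uniform_on_def)
  moreover have "card I \<le> k" using I by (simp add: uniform_on_def)
  moreover have "card I \<le> card X" using card_mono[OF fX I(2)] .
  ultimately show ?thesis using I(3) \<open>card J = _\<close> by linarith
qed

lemma flats_uniform_on:
  assumes "finite E" "k < card E"
  shows "flats (uniform_on E k) = insert E {F. F \<subseteq> E \<and> card F < k}"
proof -
  have "F \<in> flats (uniform_on E k) \<longleftrightarrow> F = E \<or> card F < k" if F: "F \<subseteq> E" for F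
  proof -
    have fF: "finite F" using F assms finite_subset by blast
    have "F \<in> flats (uniform_on E k) \<longleftrightarrow> (\<forall>e\<in>E - F. min (card F) k < min (card (insert e F)) k)"
      using F assms(1) by (auto simp: flats_def rank_uniform_on)
    also have "\<dots> \<longleftrightarrow> (\<forall>e\<in>E - F. card F < k)" using fF by (intro ball_cong) auto
    also have "\<dots> \<longleftrightarrow> F = E \<or> card F < k" using F by blast
    finally show ?thesis .
  qed
  moreover have "F \<subseteq> E" if "F \<in> flats (uniform_on E k)" for F using that by (simp add: flats_def)
  ultimately show ?thesis by blast
qed

lemma contraction_uniform_on:
  assumes "finite E" "F \<subseteq> E" "card F \<le> k"
  shows "contraction (uniform_on E k) F = uniform_on (E - F) (k - card F)"
proof -
  interpret matroid "uniform_on E k" using assms(1) by (rule matroid_uniform_on)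
  show ?thesis
  proof (rule matroid_eqI[OF matroid_contraction matroid_uniform_on])
    show "ground (contraction (uniform_on E k) F) = ground (uniform_on (E - F) (k - card F))"
      by (simp add: contraction_def)
    fix X assume "X \<subseteq> ground (contraction (uniform_on E k) F)"
    then have X: "X \<subseteq> E - F" by (simp add: contraction_def)
    then have "finite X" "finite F" using assms finite_subset by blast+
    then have c: "card (X \<union> F) = card X + card F" using X by (intro card_Un_disjoint) auto
    have "rank_of (contraction (uniform_on E k) F) X + min (card F) k = min (card (X \<union> F)) k"
      using rank_contraction[of X F] X assms by (simp add: rank_uniform_on le_supI subset_iff)
    moreover have "rank_of (uniform_on (E - F) (k - card F)) X = min (card X) (k - card F)"
      using X assms(1) by (simp add: rank_uniform_on)
    ultimately show "rank_of (contraction (uniform_on E k) F) X = rank_of (uniform_on (E - F) (k - card F)) X"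
      using c assms(3) by linarith
  qed (use assms in auto)
qed

lemma sum_subsets_by_card:
  fixes f :: "nat \<Rightarrow> 'b::comm_semiring_1"
  assumes "finite E"
  shows "(\<Sum>F | F \<subseteq> E \<and> card F < k. f (card F)) = (\<Sum>j<k. of_nat (card E choose j) * f j)"
proof -
  have fin: "finite {F. F \<subseteq> E \<and> card F < k}"
    by (rule finite_subset[of _ "Pow E"]) (use assms in auto)
  have "(\<Sum>F | F \<subseteq> E \<and> card F < k. f (card F)) =
      (\<Sum>j<k. \<Sum>F\<in>{F \<in> {F. F \<subseteq> E \<and> card F < k}. card F = j}. f (card F))"
    by (rule sum.group[symmetric]) (use fin in auto)
  also have "\<dots> = (\<Sum>j<k. of_nat (card E choose j) * f j)"
  proof (rule sum.cong[OF refl])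
    fix j assume j: "j \<in> {..<k}"
    have "(\<Sum>F\<in>{F \<in> {F. F \<subseteq> E \<and> card F < k}. card F = j}. f (card F)) = (\<Sum>F\<in>{F. F \<subseteq> E \<and> card F = j}. f j)"
      using j by (intro sum.cong) auto
    also have "\<dots> = of_nat (card E choose j) * f j" using n_subsets[OF assms, of j] by simp
    finally show "(\<Sum>F\<in>{F \<in> {F. F \<subseteq> E \<and> card F < k}. card F = j}. f (card F)) = of_nat (card E choose j) * f j" .
  qed
  finally show ?thesis .
qed

text \<open>Below a flat of fewer than \<open>k\<close> elements the lattice of flats is Boolean,
  and the induction step is the vanishing of an alternating row sum of binomial
  coefficients.\<close>

lemma moebius_flats_uniform_on:
  assumes "finite E" "k < card E" "F \<subseteq> E" "card F < k"
  shows "moebius (flats (uniform_on E k)) {} F = (-1) ^ card F"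
proof -
  have "finite F" using assms finite_subset by blast
  then show ?thesis using assms(3,4)
  proof (induction F rule: finite_psubset_induct)
    case (psubset F)
    let ?L = "flats (uniform_on E k)"
    show ?case
    proof (cases "F = {}")
      case False
      have sub: "{H \<in> ?L. {} \<subseteq> H \<and> H \<subset> F} = {H. H \<subseteq> F \<and> card H < card F}"
      proof (intro set_eqI iffI)
        fix H assume "H \<in> {H \<in> ?L. {} \<subseteq> H \<and> H \<subset> F}"
        then show "H \<in> {H. H \<subseteq> F \<and> card H < card F}" using psubset.hyps(1) by (auto simp: psubset_card_mono)
      next
        fix H assume "H \<in> {H. H \<subseteq> F \<and> card H < card F}"
        then show "H \<in> {H \<in> ?L. {} \<subseteq> H \<and> H \<subset> F}"
          using psubset.prems assms by (auto simp: flats_uniform_on)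
      qed
      have "moebius ?L {} F = - (\<Sum>H\<in>{H\<in>?L. {} \<subseteq> H \<and> H \<subset> F}. moebius ?L {} H)"
        using False psubset.hyps(1) by (subst moebius.simps) auto
      also have "(\<Sum>H\<in>{H\<in>?L. {} \<subseteq> H \<and> H \<subset> F}. moebius ?L {} H) = (\<Sum>H | H \<subseteq> F \<and> card H < card F. (-1) ^ card H)"
        unfolding sub using psubset.prems by (intro sum.cong refl psubset.IH) auto
      also have "\<dots> = (\<Sum>j<card F. of_nat (card F choose j) * (-1) ^ j)"
        by (rule sum_subsets_by_card[OF psubset.hyps(1)])
      also have "\<dots> = (\<Sum>j\<le>card F. of_nat (card F choose j) * (-1) ^ j) - (-1) ^ card F"
        by (simp add: lessThan_Suc_atMost[symmetric])
      also have "(\<Sum>j\<le>card F. of_nat (card F choose j) * (-1) ^ j) = (0 :: int)"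
        using choose_alternating_sum[of "card F", where 'a = int] False psubset.hyps(1)
        by (simp add: mult.commute card_gt_0_iff)
      finally show ?thesis by simp
    qed (simp add: moebius_refl)
  qed
qed

text \<open>The \<open>- 1\<close> in each summand distributes the Moebius value of the ground set,
  which is minus the sum of the values of all other flats.\<close>

definition uniform_char_poly :: "nat \<Rightarrow> nat \<Rightarrow> int poly" where
  "uniform_char_poly m d = (\<Sum>j<d. of_nat (m + d choose j) * ((-1) ^ j * (monom 1 (d - j) - 1)))"

lemma char_poly_uniform_on:
  assumes "finite E" "card E = m + k" "m > 0" "k > 0"
  shows "char_poly (uniform_on E k) = uniform_char_poly m k"
proof -
  let ?L = "flats (uniform_on E k)" and ?B = "{F. F \<subseteq> E \<and> card F < k}"
  have kE: "k < card E" using assms by simp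
  have L: "?L = insert E ?B" by (rule flats_uniform_on[OF assms(1) kE])
  have EB: "E \<notin> ?B" using kE by simp
  have fB: "finite ?B" by (rule finite_subset[of _ "Pow E"]) (use assms in auto)
  have "E \<noteq> {}" using kE by auto
  moreover have "{H\<in>?L. {} \<subseteq> H \<and> H \<subset> E} = ?B" unfolding L using kE by auto
  ultimately have "moebius ?L {} E = - (\<Sum>H\<in>?B. moebius ?L {} H)"
    using assms(1) by (subst moebius.simps) auto
  also have "\<dots> = - (\<Sum>H\<in>?B. (-1) ^ card H)"
    using moebius_flats_uniform_on[OF assms(1) kE]
    by (intro arg_cong[of _ _ uminus] sum.cong) auto
  finally have muE: "moebius ?L {} E = - (\<Sum>H\<in>?B. (-1) ^ card H)" .
  have rkE: "rank_of (uniform_on E k) E = k" using rank_uniform_on[OF assms(1)] kE by simp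
  have "char_poly (uniform_on E k) = monom (moebius ?L {} E) 0 +
      (\<Sum>F\<in>?B. monom (moebius ?L {} F) (k - rank_of (uniform_on E k) F))"
    unfolding char_poly_def L using EB fB rkE by simp
  also have "(\<Sum>F\<in>?B. monom (moebius ?L {} F) (k - rank_of (uniform_on E k) F)) =
      (\<Sum>F\<in>?B. monom ((-1) ^ card F) (k - card F))"
    using moebius_flats_uniform_on[OF assms(1) kE] rank_uniform_on[OF assms(1)]
    by (intro sum.cong) auto
  also have "monom (moebius ?L {} E) 0 = - (\<Sum>F\<in>?B. (-1) ^ card F)"
  proof -
    have "monom x 0 = (of_int x :: int poly)" for x :: int by (simp add: of_int_poly monom_0)
    then show ?thesis unfolding muE by simp
  qed
  also have "- (\<Sum>F\<in>?B. (-1) ^ card F :: int poly) + (\<Sum>F\<in>?B. monom ((-1) ^ card F) (k - card F)) =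
     (\<Sum>F\<in>?B. (-1) ^ card F * (monom 1 (k - card F) - 1))"
  proof -
    have "monom ((-1) ^ j) n = (-1) ^ j * (monom 1 n :: int poly)" for j n
      by (cases "even j") (auto simp: minus_monom)
    then have "(\<Sum>F\<in>?B. monom ((-1) ^ card F) (k - card F)) =
        (\<Sum>F\<in>?B. (-1) ^ card F * (monom 1 (k - card F) :: int poly))" by (intro sum.cong refl)
    moreover have "(\<Sum>F\<in>?B. (-1) ^ card F * (monom 1 (k - card F) - 1 :: int poly)) =
        (\<Sum>F\<in>?B. (-1) ^ card F * monom 1 (k - card F)) - (\<Sum>F\<in>?B. (-1) ^ card F)"
      by (simp only: right_diff_distrib mult_1_right sum_subtractf)
    ultimately show ?thesis by (simp only: uminus_add_conv_diff)
  qed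
  also have "\<dots> = uniform_char_poly m k"
    unfolding uniform_char_poly_def using sum_subsets_by_card[OF assms(1), where k = k and f = "\<lambda>j. (-1) ^ j * (monom 1 (k - j) - 1)"] assms(2)
    by simp
  finally show ?thesis .
qed

text \<open>The restriction to a proper flat is a free matroid.\<close>

lemma char_poly_restriction_uniform_on:
  assumes "finite E" "k < card E" "F \<subseteq> E" "card F < k"
  shows "char_poly (restriction (uniform_on E k) F) = [:-1, 1:] ^ card F"
proof -
  interpret matroid "uniform_on E k" using assms(1) by (rule matroid_uniform_on)
  have ll: "loopless (uniform_on E k)" using assms by (auto simp: loopless_def uniform_on_def)
  have FL: "F \<in> flats (uniform_on E k)" using assms by (simp add: flats_uniform_on)
  have fF: "finite F" using assms finite_subset by blast
  have sub: "{H \<in> flats (uniform_on E k). H \<subseteq> F} = {H. H \<subseteq> F \<and> card H < Suc (card F)}"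
  proof -
    have "card H \<le> card F" if "H \<subseteq> F" for H using that fF by (rule card_mono[rotated])
    then show ?thesis using assms by (auto simp: flats_uniform_on less_Suc_eq_le le_less_trans)
  qed
  have "char_poly (restriction (uniform_on E k) F) =
      (\<Sum>H | H \<subseteq> F \<and> card H < Suc (card F). monom ((-1) ^ card H) (card F - card H))"
    unfolding char_poly_restriction[OF ll FL] sub
  proof (rule sum.cong[OF refl])
    fix H assume H: "H \<in> {H. H \<subseteq> F \<and> card H < Suc (card F)}"
    then show "monom (moebius (flats (uniform_on E k)) {} H) (rank_of (uniform_on E k) F - rank_of (uniform_on E k) H)
       = monom ((-1) ^ card H) (card F - card H)"
      using assms moebius_flats_uniform_on[OF assms(1,2), of H] rank_uniform_on[OF assms(1)] by auto
  qed
  also have "\<dots> = (\<Sum>j<Suc (card F). of_nat (card F choose j) * monom ((-1) ^ j) (card F - j))"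
    by (rule sum_subsets_by_card[OF fF])
  also have "\<dots> = (\<Sum>j\<le>card F. of_nat (card F choose j) * (-1) ^ j * monom 1 1 ^ (card F - j))"
  proof -
    have "monom ((-1) ^ j) n = (-1) ^ j * (monom 1 1 ^ n :: int poly)" for j n
      by (cases "even j") (auto simp: minus_monom monom_power)
    then show ?thesis by (simp add: lessThan_Suc_atMost mult.assoc)
  qed
  also have "\<dots> = (- 1 + monom 1 1) ^ card F" by (rule binomial_ring[symmetric])
  also have "- 1 + monom 1 1 = ([:-1, 1:] :: int poly)" by (simp add: monom_altdef one_pCons)
  finally show ?thesis .
qed

section \<open>The Kazhdan-Lusztig recursion for fixed \<open>m\<close>\<close>

text \<open>Contracting a set of \<open>j < d\<close> elements keeps \<open>m\<close> and lowers the
  rank to \<open>d - j\<close>, so the defining recursion closes up for fixed \<open>m\<close>. The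
  summand \<open>uniform_char_poly m d\<close> belongs to the flat that is the whole ground set; the
  term \<open>j = 0\<close> belongs to the empty flat, so \<open>P d\<close> occurs on both
  sides.\<close>

definition kl_recursion :: "nat \<Rightarrow> (nat \<Rightarrow> int poly) \<Rightarrow> bool" where
  "kl_recursion m P \<longleftrightarrow> (\<forall>d>0. 2 * degree (P d) < d \<and>
     rev_poly d (P d) = uniform_char_poly m d + (\<Sum>j<d. of_nat (m + d choose j) * ([:-1, 1:] ^ j * P (d - j))))"

text \<open>By induction the terms of nonempty flats agree, so both candidates have the same
  difference between reversal and polynomial. For degree below \<open>d / 2\<close> the reversal
  lives strictly above the middle, hence this difference determines the polynomial. The ground set
  is arbitrary because contractions do not preserve an initial segment.\<close>

lemma kl_poly_uniform_on_eq:
  fixes E :: "'a set"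
  assumes P: "kl_recursion m P" and "m > 0"
    and "finite E" "card E = m + d" "d > 0"
  shows "kl_poly (uniform_on E d) = P d"
  using assms(3-)
proof (induction d arbitrary: E rule: less_induct)
  case (less d)
  let ?M = "uniform_on E d" and ?B = "{F. F \<subseteq> E \<and> card F < d}"
  interpret matroid ?M using less.prems(1) by (rule matroid_uniform_on)
  have dE: "d < card E" using less.prems assms(2) by simp
  have ll: "loopless ?M" using less.prems by (auto simp: loopless_def uniform_on_def)
  have rk: "rk ?M = d" using rank_uniform_on[OF less.prems(1)] dE by simp
  have L: "flats ?M = insert E ?B" by (rule flats_uniform_on[OF less.prems(1) dE])
  have EB: "E \<notin> ?B" using dE by simp
  have fB: "finite ?B" by (rule finite_subset[of _ "Pow E"]) (use less.prems in auto)
  have eq: "2 * degree (kl_poly ?M) < d"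
    "rev_poly d (kl_poly ?M) = (\<Sum>F\<in>flats ?M. char_poly (restriction ?M F) * kl_poly (contraction ?M F))"
    using kl_assignment_kl_poly[where 'a = 'a] matroid_axioms ll rk less.prems unfolding kl_assignment_def by auto
  have klE: "kl_poly (contraction ?M E) = 1"
  proof -
    interpret C: matroid "contraction ?M E" by (rule matroid_contraction)
    have "loopless (contraction ?M E)" using flat_ground by (intro loopless_contraction) simp
    moreover have "rk (contraction ?M E) = 0" using C.rank_empty by (simp add: contraction_def)
    ultimately show ?thesis
      using kl_assignment_kl_poly[where 'a = 'a] C.matroid_axioms unfolding kl_assignment_def by auto
  qed
  have chE: "char_poly (restriction ?M E) = uniform_char_poly m d"
    using restriction_ground char_poly_uniform_on[of E m d] less.prems assms(2) by simp
  define T where "T F = (if F = {} then kl_poly ?M else [:-1, 1:] ^ card F * P (d - card F))" for F :: "'a set"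
  have "rev_poly d (kl_poly ?M) = uniform_char_poly m d +
      (\<Sum>F\<in>?B. char_poly (restriction ?M F) * kl_poly (contraction ?M F))"
    unfolding eq(2) L using EB fB klE chE by simp
  also have "(\<Sum>F\<in>?B. char_poly (restriction ?M F) * kl_poly (contraction ?M F)) =
      (\<Sum>F\<in>?B. if F = {} then kl_poly ?M else [:-1, 1:] ^ card F * P (d - card F))"
  proof (rule sum.cong[OF refl])
    fix F assume F: "F \<in> ?B"
    then have fF: "finite F" using less.prems finite_subset by blast
    have ch: "char_poly (restriction ?M F) = [:-1, 1:] ^ card F"
      using char_poly_restriction_uniform_on[OF less.prems(1) dE] F by auto
    have co: "contraction ?M F = uniform_on (E - F) (d - card F)"
      using contraction_uniform_on[OF less.prems(1), of F d] F by auto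
    show "char_poly (restriction ?M F) * kl_poly (contraction ?M F) =
       (if F = {} then kl_poly ?M else [:-1, 1:] ^ card F * P (d - card F))"
    proof (cases "F = {}")
      case False
      have "card F > 0" using fF False by (simp add: card_gt_0_iff)
      moreover have "card (E - F) = m + (d - card F)"
        using F less.prems fF by (subst card_Diff_subset) auto
      ultimately have "kl_poly (uniform_on (E - F) (d - card F)) = P (d - card F)"
        using F less.prems by (intro less.IH) auto
      then show ?thesis using False ch co by simp
    qed (use ch co in simp)
  qed
  also have "\<dots> = kl_poly ?M + (\<Sum>F\<in>?B - {{}}. [:-1, 1:] ^ card F * P (d - card F))"
    using fB less.prems by (subst sum.remove[of _ "{}"]) auto
  finally have K: "rev_poly d (kl_poly ?M) - kl_poly ?M = uniform_char_poly m d +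
      (\<Sum>F\<in>?B - {{}}. [:-1, 1:] ^ card F * P (d - card F))" by simp
  have Pd: "2 * degree (P d) < d" "rev_poly d (P d) = uniform_char_poly m d +
      (\<Sum>j<d. of_nat (m + d choose j) * ([:-1, 1:] ^ j * P (d - j)))"
    using P less.prems unfolding kl_recursion_def by auto
  have "(\<Sum>j<d. of_nat (m + d choose j) * ([:-1, 1:] ^ j * P (d - j))) =
     (\<Sum>F\<in>?B. [:-1, 1:] ^ card F * P (d - card F))"
    using sum_subsets_by_card[OF less.prems(1), where k = d and f = "\<lambda>j. [:-1, 1:] ^ j * P (d - j)"] less.prems(2) by simp
  also have "\<dots> = P d + (\<Sum>F\<in>?B - {{}}. [:-1, 1:] ^ card F * P (d - card F))"
    using fB less.prems by (subst sum.remove[of _ "{}"]) auto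
  finally have eqn: "rev_poly d (kl_poly ?M) - kl_poly ?M = rev_poly d (P d) - P d" using K Pd(2) by simp
  show ?case
  proof (rule poly_eqI)
    fix i
    have c: "coeff (rev_poly d (kl_poly ?M)) i - coeff (kl_poly ?M) i =
        coeff (rev_poly d (P d)) i - coeff (P d) i" using arg_cong[OF eqn, of "\<lambda>p. coeff p i"] by simp
    show "coeff (kl_poly ?M) i = coeff (P d) i"
    proof (cases "2 * i < d")
      case True
      then have "coeff (kl_poly ?M) (d - i) = 0" "coeff (P d) (d - i) = 0"
        using eq(1) Pd(1) by (auto intro!: coeff_eq_0)
      then show ?thesis using c True eq(1) Pd(1) by (simp add: coeff_rev_poly)
    next
      case False
      then show ?thesis using eq(1) Pd(1) by (simp add: coeff_eq_0)
    qed
  qed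
qed

section \<open>Solution by binomial transforms\<close>

text \<open>In terms of exponential generating functions the transform with parameter
  \<open>a\<close> is multiplication by \<open>exp (a * x)\<close>; two of them compose by adding
  the parameters. The upper index is \<open>n = m + d\<close> while the summation stops at
  \<open>k = d\<close>, which is compatible with the composition.\<close>

lemma sum_choose_double:
  fixes a b :: "'a::comm_ring_1"
  assumes "k \<le> n"
  shows "(\<Sum>j<k. of_nat (n choose j) * (a ^ j * (\<Sum>l<k - j. of_nat (n - j choose l) * (b ^ l * g (k - j - l))))) =
    (\<Sum>s<k. of_nat (n choose s) * ((a + b) ^ s * g (k - s)))"
proof -
  let ?F = "\<lambda>j l. of_nat (n choose j) * (a ^ j * (of_nat (n - j choose l) * (b ^ l * g (k - j - l))))"
  have "(\<Sum>j<k. of_nat (n choose j) * (a ^ j * (\<Sum>l<k - j. of_nat (n - j choose l) * (b ^ l * g (k - j - l))))) =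
      (\<Sum>j<k. \<Sum>l<k - j. ?F j l)" by (simp add: sum_distrib_left)
  also have "\<dots> = (\<Sum>(j, l)\<in>(SIGMA j:{..<k}. {..<k - j}). ?F j l)" by (subst sum.Sigma) auto
  also have "(SIGMA j:{..<k}. {..<k - j}) = {(j, l). j + l < k}" by auto
  also have "(\<Sum>(j, l)\<in>{(j, l). j + l < k}. ?F j l) = (\<Sum>s<k. \<Sum>j\<le>s. ?F j (s - j))"
    by (rule sum.triangle_reindex)
  also have "\<dots> = (\<Sum>s<k. of_nat (n choose s) * ((a + b) ^ s * g (k - s)))"
  proof (rule sum.cong[OF refl])
    fix s assume s: "s \<in> {..<k}"
    have "?F j (s - j) = of_nat (n choose s) * (of_nat (s choose j) * a ^ j * b ^ (s - j)) * g (k - s)" if "j \<le> s" for j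
    proof -
      have "(n choose j) * (n - j choose (s - j)) = (n choose s) * (s choose j)"
        using choose_mult[of j s n] that s assms by simp
      then have "(of_nat (n choose j) * of_nat (n - j choose (s - j)) :: 'a) = of_nat (n choose s) * of_nat (s choose j)"
        by (metis of_nat_mult)
      moreover have "k - j - (s - j) = k - s" using that s by simp
      moreover have "?F j (s - j) = (of_nat (n choose j) * of_nat (n - j choose (s - j))) * (a ^ j * (b ^ (s - j) * g (k - j - (s - j))))"
        by (simp add: mult_ac)
      ultimately show ?thesis by (simp add: mult_ac)
    qed
    then have "(\<Sum>j\<le>s. ?F j (s - j)) = (\<Sum>j\<le>s. of_nat (n choose s) * (of_nat (s choose j) * a ^ j * b ^ (s - j)) * g (k - s))"
      by (intro sum.cong) auto
    also have "\<dots> = of_nat (n choose s) * ((a + b) ^ s * g (k - s))"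
      by (simp add: binomial_ring sum_distrib_left sum_distrib_right mult_ac)
    finally show "(\<Sum>j\<le>s. ?F j (s - j)) = of_nat (n choose s) * ((a + b) ^ s * g (k - s))" .
  qed
  finally show ?thesis .
qed

text \<open>Under the inverse binomial transform in \<open>d\<close> the recursion becomes
  \<open>rev_poly n \<psi> - \<psi> = asym_poly m n\<close>, which determines \<open>\<psi>\<close> outright since its degree is less than \<open>n / 2\<close>.\<close>

definition asym_poly :: "nat \<Rightarrow> nat \<Rightarrow> int poly" where
  "asym_poly m n = (\<Sum>l<n. of_nat (m + n choose l) * ((- [:1, 1:]) ^ l * (monom 1 (n - l) - 1)))"

definition kl_inverse_transform :: "nat \<Rightarrow> nat \<Rightarrow> int poly" where
  "kl_inverse_transform m n = - trunc_half n (asym_poly m n)"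

definition uniform_kl :: "nat \<Rightarrow> nat \<Rightarrow> int poly" where
  "uniform_kl m d = (\<Sum>j<d. of_nat (m + d choose j) * kl_inverse_transform m (d - j))"

lemma degree_of_nat_mult_le: "degree (of_nat c * (p :: int poly)) \<le> degree p"
  using degree_mult_le[of "of_nat c" p] by simp

lemma degree_monom_diff_one: "degree (monom 1 k - 1 :: int poly) \<le> k"
  by (intro degree_diff_le) (auto simp: degree_monom_eq)

lemma degree_neg_linear_power: "degree ((- [:1, 1:]) ^ l :: int poly) \<le> l"
  using degree_power_le[of "- [:1, 1:] :: int poly" l] by simp

lemma degree_asym_poly_term:
  assumes "l < n"
  shows "degree (of_nat c * ((- [:1, 1:]) ^ l * (monom 1 (n - l) - 1)) :: int poly) \<le> n"
  using degree_of_nat_mult_le[of c "(- [:1, 1:]) ^ l * (monom 1 (n - l) - 1)"]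
    degree_mult_le[of "(- [:1, 1:]) ^ l" "monom 1 (n - l) - 1 :: int poly"]
    degree_neg_linear_power[of l] degree_monom_diff_one[of "n - l"] assms by linarith

lemma degree_asym_poly: "degree (asym_poly m n) \<le> n"
  unfolding asym_poly_def by (intro degree_sum_le degree_asym_poly_term) auto

lemma rev_poly_of_nat: "rev_poly 0 (of_nat c) = of_nat c"
  by (simp add: rev_poly_def of_nat_poly)

lemma rev_poly_neg_linear_power: "rev_poly l ((- [:1, 1:]) ^ l) = (- [:1, 1:]) ^ l"
proof (induction l)
  case (Suc l)
  have "rev_poly 1 (- [:1, 1:]) = - [:1, 1 :: int:]"
    by (simp add: rev_poly_def reflect_poly_def)
  then show ?case using Suc rev_poly_mult[of "- [:1, 1:]" 1 "(- [:1, 1:]) ^ l" l] degree_neg_linear_power[of l]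
    by simp
qed (simp add: rev_poly_def)

lemma rev_poly_monom_diff_one: "rev_poly k (monom 1 k - 1) = - (monom 1 k - 1)"
proof (rule poly_eqI)
  fix i show "coeff (rev_poly k (monom 1 k - 1)) i = coeff (- (monom 1 k - 1)) i"
    using degree_monom_diff_one[of k] by (auto simp: coeff_rev_poly)
qed

text \<open>Termwise: \<open>1 + t\<close> is self-reciprocal, and reversing
  \<open>t ^ k - 1\<close> changes its sign.\<close>

lemma rev_asym_poly: "rev_poly n (asym_poly m n) = - asym_poly m n"
proof -
  have "rev_poly n (asym_poly m n) =
    (\<Sum>l<n. rev_poly n (of_nat (m + n choose l) * ((- [:1, 1:]) ^ l * (monom 1 (n - l) - 1))))"
    unfolding asym_poly_def by (intro rev_poly_sum degree_asym_poly_term) auto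
  also have "\<dots> = (\<Sum>l<n. - (of_nat (m + n choose l) * ((- [:1, 1:]) ^ l * (monom 1 (n - l) - 1))))"
  proof (rule sum.cong[OF refl])
    fix l assume l: "l \<in> {..<n}"
    have "rev_poly (l + (n - l)) ((- [:1, 1:]) ^ l * (monom 1 (n - l) - 1)) =
        (- [:1, 1:]) ^ l * - (monom 1 (n - l) - 1)"
      unfolding rev_poly_mult[OF degree_neg_linear_power degree_monom_diff_one]
        rev_poly_neg_linear_power rev_poly_monom_diff_one ..
    moreover have "degree ((- [:1, 1:]) ^ l * (monom 1 (n - l) - 1) :: int poly) \<le> n"
      using degree_asym_poly_term[of l n 1] l by simp
    then have "rev_poly (0 + n) (of_nat (m + n choose l) * ((- [:1, 1:]) ^ l * (monom 1 (n - l) - 1))) =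
        of_nat (m + n choose l) * rev_poly n ((- [:1, 1:]) ^ l * (monom 1 (n - l) - 1))"
      by (subst rev_poly_mult) (simp_all add: rev_poly_of_nat)
    ultimately show "rev_poly n (of_nat (m + n choose l) * ((- [:1, 1:]) ^ l * (monom 1 (n - l) - 1))) =
       - (of_nat (m + n choose l) * ((- [:1, 1:]) ^ l * (monom 1 (n - l) - 1)))"
      using l by (simp only: add_0 le_add_diff_inverse lessThan_iff less_imp_le mult_minus_right)
  qed
  also have "\<dots> = - asym_poly m n" by (simp add: asym_poly_def sum_negf)
  finally show ?thesis .
qed

lemma coeff_kl_inverse_transform:
  "coeff (kl_inverse_transform m n) i = (if 2 * i < n then - coeff (asym_poly m n) i else 0)"
  by (simp add: kl_inverse_transform_def coeff_trunc_half)

lemma degree_kl_inverse_transform: "n > 0 \<Longrightarrow> 2 * degree (kl_inverse_transform m n) < n"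
proof -
  assume n: "n > 0"
  have "degree (kl_inverse_transform m n) \<le> (n - 1) div 2"
    by (rule degree_le) (auto simp: coeff_kl_inverse_transform)
  then show ?thesis using n by linarith
qed

text \<open>Antisymmetry of \<open>asym_poly\<close> makes its upper half minus the reversal of its
  lower half and kills the middle coefficient.\<close>

lemma rev_kl_inverse_transform:
  assumes "n > 0"
  shows "rev_poly n (kl_inverse_transform m n) = kl_inverse_transform m n + asym_poly m n"
proof (rule poly_eqI)
  fix i
  have d: "degree (kl_inverse_transform m n) \<le> n" using degree_kl_inverse_transform[OF assms, of m] by simp
  have anti: "coeff (asym_poly m n) (n - i) = - coeff (asym_poly m n) i" if "i \<le> n"
    using arg_cong[OF rev_asym_poly[of n m], of "\<lambda>p. coeff p i"] that degree_asym_poly[of m n]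
    by (simp add: coeff_rev_poly)
  have 0: "coeff (asym_poly m n) i = 0" if "i > n" using degree_asym_poly[of m n] that by (intro coeff_eq_0) simp
  have mid: "coeff (asym_poly m n) i = 0" if "2 * i = n"
  proof -
    have "n - i = i" "i \<le> n" using that by linarith+
    then show ?thesis using anti by simp
  qed
  consider "i > n" | "i \<le> n" "2 * i < n" | "i \<le> n" "2 * i > n" | "2 * i = n" by linarith
  then show "coeff (rev_poly n (kl_inverse_transform m n)) i = coeff (kl_inverse_transform m n + asym_poly m n) i"
    by cases (use anti 0 mid in \<open>auto simp: coeff_rev_poly[OF d] coeff_kl_inverse_transform\<close>)
qed

text \<open>Reversal turns the transform with parameter 1 into the one with parameter
  \<open>t\<close>, applied to the reversed polynomials, that is to
  \<open>?\<psi> + asym_poly\<close>. In the second part the parameters \<open>t\<close> and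
  \<open>- (1 + t)\<close> add up to \<open>-1\<close> and give the characteristic polynomial; in
  the first, \<open>t = (t - 1) + 1\<close> gives back the sum over
  \<open>uniform_kl m (d - j)\<close>.\<close>

lemma kl_recursion_uniform_kl: "kl_recursion m (uniform_kl m)"
  unfolding kl_recursion_def
proof (intro allI impI conjI)
  fix d :: nat assume d: "d > 0"
  let ?\<psi> = "kl_inverse_transform m"
  have deg: "degree (of_nat (m + d choose j) * ?\<psi> (d - j)) \<le> (d - 1) div 2" if "j < d" for j
    using degree_of_nat_mult_le[of "m + d choose j" "?\<psi> (d - j)"] degree_kl_inverse_transform[of "d - j" m] that by linarith
  then have "degree (uniform_kl m d) \<le> (d - 1) div 2"
    unfolding uniform_kl_def by (intro degree_sum_le) auto
  then show "2 * degree (uniform_kl m d) < d" using d by linarith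
  have "rev_poly d (uniform_kl m d) = (\<Sum>j<d. rev_poly d (of_nat (m + d choose j) * ?\<psi> (d - j)))"
    unfolding uniform_kl_def
  proof (rule rev_poly_sum)
    fix j assume "j \<in> {..<d}"
    then show "degree (of_nat (m + d choose j) * ?\<psi> (d - j)) \<le> d" using deg[of j] by simp
  qed simp
  also have "\<dots> = (\<Sum>j<d. of_nat (m + d choose j) * (monom 1 1 ^ j * (?\<psi> (d - j) + asym_poly m (d - j))))"
  proof (rule sum.cong[OF refl])
    fix j assume j: "j \<in> {..<d}"
    have "rev_poly (j + (d - j)) (of_nat (m + d choose j) * ?\<psi> (d - j)) =
        rev_poly j (of_nat (m + d choose j)) * rev_poly (d - j) (?\<psi> (d - j))"
      using degree_kl_inverse_transform[of "d - j" m] j by (intro rev_poly_mult) auto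
    also have "rev_poly j (of_nat (m + d choose j)) = of_nat (m + d choose j) * monom 1 1 ^ j"
      using rev_poly_monom[of 0 j "int (m + d choose j)"]
      by (simp add: monom_0 of_nat_poly monom_power smult_monom)
    also have "rev_poly (d - j) (?\<psi> (d - j)) = ?\<psi> (d - j) + asym_poly m (d - j)"
      using j by (intro rev_kl_inverse_transform) simp
    finally show "rev_poly d (of_nat (m + d choose j) * ?\<psi> (d - j)) =
       of_nat (m + d choose j) * (monom 1 1 ^ j * (?\<psi> (d - j) + asym_poly m (d - j)))"
      using j by (simp add: mult.assoc)
  qed
  also have "\<dots> = (\<Sum>j<d. of_nat (m + d choose j) * (monom 1 1 ^ j * asym_poly m (d - j))) +
      (\<Sum>j<d. of_nat (m + d choose j) * (monom 1 1 ^ j * ?\<psi> (d - j)))"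
    by (simp add: distrib_left sum.distrib)
  also have "(\<Sum>j<d. of_nat (m + d choose j) * (monom 1 1 ^ j * asym_poly m (d - j))) =
      (\<Sum>j<d. of_nat (m + d choose j) * (monom 1 1 ^ j *
        (\<Sum>l<d - j. of_nat (m + d - j choose l) * ((- [:1, 1:]) ^ l * (\<lambda>n. monom 1 n - 1) (d - j - l)))))"
    unfolding asym_poly_def by (intro sum.cong refl) auto
  also have "\<dots> = (\<Sum>s<d. of_nat (m + d choose s) * ((monom 1 1 + - [:1, 1:]) ^ s * (\<lambda>n. monom 1 n - 1) (d - s)))"
    by (rule sum_choose_double) simp
  also have "monom 1 1 + - [:1, 1:] = (- 1 :: int poly)" by (simp add: monom_altdef one_pCons)
  also have "(\<Sum>s<d. of_nat (m + d choose s) * ((- 1) ^ s * (\<lambda>n. monom 1 n - 1) (d - s))) = uniform_char_poly m d"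
    by (simp add: uniform_char_poly_def)
  also have "(\<Sum>j<d. of_nat (m + d choose j) * (monom 1 1 ^ j * ?\<psi> (d - j))) =
      (\<Sum>j<d. of_nat (m + d choose j) * (([:-1, 1:] + 1) ^ j * ?\<psi> (d - j)))"
    by (simp add: monom_altdef one_pCons)
  also have "\<dots> = (\<Sum>j<d. of_nat (m + d choose j) * ([:-1, 1:] ^ j *
        (\<Sum>l<d - j. of_nat (m + d - j choose l) * (1 ^ l * ?\<psi> (d - j - l)))))"
    by (rule sum_choose_double[symmetric]) simp
  also have "\<dots> = (\<Sum>j<d. of_nat (m + d choose j) * ([:-1, 1:] ^ j * uniform_kl m (d - j)))"
    unfolding uniform_kl_def by (intro sum.cong refl) auto
  finally show "rev_poly d (uniform_kl m d) = uniform_char_poly m d +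
      (\<Sum>j<d. of_nat (m + d choose j) * ([:-1, 1:] ^ j * uniform_kl m (d - j)))" .
qed

lemma kl_poly_uniform_matroid:
  assumes "m > 0" "d > 0"
  shows "kl_poly (uniform_matroid m d) = uniform_kl m d"
  unfolding uniform_matroid_def
  by (rule kl_poly_uniform_on_eq[OF kl_recursion_uniform_kl assms(1)]) (use assms in auto)

section \<open>Coefficients of the inverse transform\<close>

text \<open>The product of binomials is \<open>m + n choose i\<close> times
  \<open>m + n - i choose (l - i)\<close>, so what remains is a partial alternating sum of one row
  of Pascal's triangle, which is a single binomial of the previous row.\<close>

lemma sum_alternating_choose_choose:
  assumes "i < n"
  shows "(\<Sum>l<n. (-1) ^ l * int (m + n choose l) * int (l choose i)) =
    (-1) ^ (n - 1) * int (m + n choose i) * int (m + n - i - 1 choose m)"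
proof -
  have "(\<Sum>l<n. (-1) ^ l * int (m + n choose l) * int (l choose i)) =
      (\<Sum>l\<in>{i..<n}. (-1) ^ l * int (m + n choose l) * int (l choose i))"
    by (intro sum.mono_neutral_right) (auto simp: binomial_eq_0)
  also have "\<dots> = (\<Sum>r\<le>n - 1 - i. (-1) ^ i * int (m + n choose i) * ((-1) ^ r * int (m + n - i choose r)))"
  proof (rule sum.reindex_bij_witness[of _ "\<lambda>r. r + i" "\<lambda>l. l - i"])
    fix l assume l: "l \<in> {i..<n}"
    have "(m + n choose l) * (l choose i) = (m + n choose i) * (m + n - i choose (l - i))"
      using choose_mult[of i l "m + n"] l by simp
    then have "int (m + n choose l) * int (l choose i) = int (m + n choose i) * int (m + n - i choose (l - i))"
      by (metis of_nat_mult)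
    moreover have "(-1) ^ l = (-1) ^ i * (-1 :: int) ^ (l - i)" using l by (simp flip: power_add)
    ultimately show "(-1) ^ i * int (m + n choose i) * ((-1) ^ (l - i) * int (m + n - i choose (l - i))) =
        (-1) ^ l * int (m + n choose l) * int (l choose i)" by simp
  qed (use assms in auto)
  also have "\<dots> = (-1) ^ i * int (m + n choose i) * (\<Sum>r\<le>n - 1 - i. (-1) ^ r * int (m + n - i choose r))"
    by (simp add: sum_distrib_left)
  also have "(\<Sum>r\<le>n - 1 - i. (-1) ^ r * int (m + n - i choose r)) = (-1) ^ (n - 1 - i) * int (m + n - i - 1 choose (n - 1 - i))"
  proof -
    have "(\<Sum>r\<le>K. (-1) ^ r * int (Suc L choose r)) = (-1) ^ K * int (L choose K)" for K L
      by (induction K) (auto simp: algebra_simps)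
    from this[of "m + n - i - 1" "n - 1 - i"] show ?thesis using assms by (simp add: Suc_diff_Suc)
  qed
  also have "m + n - i - 1 choose (n - 1 - i) = (m + n - i - 1 choose m)"
    using assms by (subst binomial_symmetric) auto
  also have "(-1) ^ i * int (m + n choose i) * ((-1) ^ (n - 1 - i) * int (m + n - i - 1 choose m)) =
      ((-1) ^ i * (-1) ^ (n - 1 - i)) * int (m + n choose i) * int (m + n - i - 1 choose m)" by simp
  also have "(-1) ^ i * (-1 :: int) ^ (n - 1 - i) = (-1) ^ (n - 1)" using assms by (simp flip: power_add)
  finally show ?thesis .
qed

lemma coeff_asym_poly:
  assumes "i < n" "m > 0"
  shows "coeff (asym_poly m n) i = (-1) ^ (n - 1) *
    (int (m + n choose (n - i)) * int (m + i - 1 choose m) - int (m + n choose i) * int (m + n - i - 1 choose m))"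
proof -
  have pw: "(- [:1, 1:]) ^ l = smult ((-1) ^ l) ([:1, 1 :: int:] ^ l)" for l
    using power_minus[of "[:1, 1 :: int:]" l] by (cases "even l") auto
  have c1: "coeff ([:1, 1 :: int:] ^ l) j = int (l choose j)" for l j
    by (cases "j \<le> l") (auto simp: coeff_linear_poly_power binomial_eq_0 intro!: coeff_eq_0 le_less_trans[OF degree_power_le])
  have "coeff (of_nat (m + n choose l) * ((- [:1, 1:]) ^ l * (monom 1 (n - l) - 1))) i =
     (-1) ^ l * int (m + n choose l) * int (l choose (n - i)) - (-1) ^ l * int (m + n choose l) * int (l choose i)"
    if l: "l < n" for l
  proof -
    have "coeff ([:1, 1 :: int:] ^ l * monom 1 (n - l)) i = int (l choose (n - i))"
    proof (cases "n - l \<le> i")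
      case True
      have "coeff ([:1, 1 :: int:] ^ l * monom 1 (n - l)) i = int (l choose (i - (n - l)))"
        using True by (subst mult.commute) (simp add: coeff_monom_mult c1)
      also have "l choose (i - (n - l)) = l choose (n - i)"
        using True l assms by (subst binomial_symmetric) auto
      finally show ?thesis .
    next
      case False
      then show ?thesis by (subst mult.commute) (auto simp: coeff_monom_mult binomial_eq_0)
    qed
    then have *: "coeff ((- [:1, 1:]) ^ l * (monom 1 (n - l) - 1)) i = (-1) ^ l * (int (l choose (n - i)) - int (l choose i))"
      unfolding pw by (simp add: right_diff_distrib c1)
    have cm: "coeff (of_nat c * p) i = int c * coeff p i" for c and p :: "int poly"
      by (simp add: of_nat_poly)
    show ?thesis unfolding cm * by (simp add: algebra_simps)
  qed
  then have "coeff (asym_poly m n) i = (\<Sum>l<n. (-1) ^ l * int (m + n choose l) * int (l choose (n - i))) -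
     (\<Sum>l<n. (-1) ^ l * int (m + n choose l) * int (l choose i))"
    unfolding asym_poly_def coeff_sum sum_subtractf[symmetric] by (intro sum.cong) auto
  also have "(\<Sum>l<n. (-1) ^ l * int (m + n choose l) * int (l choose (n - i))) =
      (-1) ^ (n - 1) * int (m + n choose (n - i)) * int (m + i - 1 choose m)"
  proof (cases "i = 0")
    case True
    then have "(\<Sum>l<n. (-1) ^ l * int (m + n choose l) * int (l choose (n - i))) = 0"
      by (intro sum.neutral) (auto simp: binomial_eq_0)
    then show ?thesis using True assms by (simp add: binomial_eq_0)
  next
    case False
    then show ?thesis using sum_alternating_choose_choose[of "n - i" n m] assms by simp
  qed
  also have "(\<Sum>l<n. (-1) ^ l * int (m + n choose l) * int (l choose i)) =
      (-1) ^ (n - 1) * int (m + n choose i) * int (m + n - i - 1 choose m)"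
    by (rule sum_alternating_choose_choose[OF assms(1)])
  finally show ?thesis by (simp add: algebra_simps)
qed

section \<open>The coefficients\<close>

text \<open>The series 2F1(\<open>N + 1\<close>, \<open>z\<close>; \<open>z + 2\<close>; 1)
  truncated after \<open>h = M\<close> and multiplied by \<open>pochhammer (z + 2) M\<close> to
  clear denominators. It is applied with \<open>N = d - z\<close>; \<open>N\<close> is a separate
  argument because the coefficients are evaluated by a recurrence in \<open>N\<close> at fixed
  \<open>z\<close>. The type is generic since the coefficients need real, the root location complex
  values.\<close>

definition kl_weight :: "nat \<Rightarrow> 'a::field_char_0 \<Rightarrow> 'a \<Rightarrow> 'a" where
  "kl_weight M N z = (\<Sum>h\<le>M. pochhammer (N + 1) h * pochhammer z h *
     pochhammer (z + of_nat h + 2) (M - h) / fact h)"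

lemma kl_weight_alt:
  assumes "\<And>j. z + 2 + of_nat j \<noteq> 0"
  shows "kl_weight M N z = pochhammer (z + 2) M *
    (\<Sum>h\<le>M. pochhammer (N + 1) h * pochhammer z h / (fact h * pochhammer (z + 2) h))"
  unfolding kl_weight_def sum_distrib_left
proof (rule sum.cong[OF refl])
  fix h assume "h \<in> {..M}"
  then have "pochhammer (z + 2) M = pochhammer (z + 2) h * pochhammer (z + of_nat h + 2) (M - h)"
    by (simp add: pochhammer_product[of h M] add_ac)
  moreover have "pochhammer (z + 2) h \<noteq> 0" using assms by (auto simp: pochhammer_eq_0_iff eq_neg_iff_add_eq_0)
  ultimately show "pochhammer (N + 1) h * pochhammer z h * pochhammer (z + of_nat h + 2) (M - h) / fact h =
    pochhammer (z + 2) M * (pochhammer (N + 1) h * pochhammer z h / (fact h * pochhammer (z + 2) h))"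
    by simp
qed

text \<open>The Chu-Vandermonde identity for 2F1(\<open>- M\<close>, \<open>b\<close>;
  \<open>c\<close>; 1), by Pascal's rule and the contiguous pair \<open>b + 1\<close>,
  \<open>c + 1\<close>.\<close>

lemma sum_choose_pochhammer:
  fixes b c :: "'a::field_char_0"
  assumes "\<And>j. c + of_nat j \<noteq> 0"
  shows "(\<Sum>j\<le>M. (-1) ^ j * of_nat (M choose j) * pochhammer b j / pochhammer c j) =
    pochhammer (c - b) M / pochhammer c M"
  using assms
proof (induction M arbitrary: b c)
  case (Suc M)
  have nz: "pochhammer c j \<noteq> 0" for j using Suc.prems by (auto simp: pochhammer_eq_0_iff eq_neg_iff_add_eq_0)
  have c0: "c \<noteq> 0" using Suc.prems[of 0] by simp
  have nz1: "c + 1 + of_nat j \<noteq> 0" for j using Suc.prems[of "Suc j"] by (simp add: add_ac)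
  have "(\<Sum>j\<le>Suc M. (-1) ^ j * of_nat (Suc M choose j) * pochhammer b j / pochhammer c j) =
     1 + (\<Sum>j\<le>M. (-1) ^ Suc j * of_nat (Suc M choose Suc j) * pochhammer b (Suc j) / pochhammer c (Suc j))"
    by (subst sum.atMost_Suc_shift) simp
  also have "(\<Sum>j\<le>M. (-1) ^ Suc j * of_nat (Suc M choose Suc j) * pochhammer b (Suc j) / pochhammer c (Suc j)) =
     (\<Sum>j\<le>M. (-1) ^ Suc j * of_nat (M choose Suc j) * pochhammer b (Suc j) / pochhammer c (Suc j)) -
     b / c * (\<Sum>j\<le>M. (-1) ^ j * of_nat (M choose j) * pochhammer (b + 1) j / pochhammer (c + 1) j)"
    unfolding sum_distrib_left sum_subtractf[symmetric]
    by (intro sum.cong refl) (simp add: pochhammer_rec add_divide_distrib[symmetric] diff_divide_distrib[symmetric] algebra_simps)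
  also have "1 + ((\<Sum>j\<le>M. (-1) ^ Suc j * of_nat (M choose Suc j) * pochhammer b (Suc j) / pochhammer c (Suc j)) -
     b / c * (\<Sum>j\<le>M. (-1) ^ j * of_nat (M choose j) * pochhammer (b + 1) j / pochhammer (c + 1) j)) =
     (\<Sum>j\<le>Suc M. (-1) ^ j * of_nat (M choose j) * pochhammer b j / pochhammer c j) -
     b / c * (\<Sum>j\<le>M. (-1) ^ j * of_nat (M choose j) * pochhammer (b + 1) j / pochhammer (c + 1) j)"
  proof -
    have "(\<Sum>j\<le>Suc M. (-1) ^ j * of_nat (M choose j) * pochhammer b j / pochhammer c j) =
      1 + (\<Sum>j\<le>M. (-1) ^ Suc j * of_nat (M choose Suc j) * pochhammer b (Suc j) / pochhammer c (Suc j))"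
      by (subst sum.atMost_Suc_shift) simp
    then show ?thesis by (simp only: add_diff_eq)
  qed
  also have "(\<Sum>j\<le>Suc M. (-1) ^ j * of_nat (M choose j) * pochhammer b j / pochhammer c j) =
     pochhammer (c - b) M / pochhammer c M" using Suc.IH[of c b] Suc.prems by simp
  also have "(\<Sum>j\<le>M. (-1) ^ j * of_nat (M choose j) * pochhammer (b + 1) j / pochhammer (c + 1) j) =
     pochhammer (c - b) M / pochhammer (c + 1) M" using Suc.IH[of "c + 1" "b + 1"] nz1 by simp
  also have "pochhammer (c - b) M / pochhammer c M - b / c * (pochhammer (c - b) M / pochhammer (c + 1) M) =
     pochhammer (c - b) (Suc M) / pochhammer c (Suc M)"
  proof -
    have "b / c * (pochhammer (c - b) M / pochhammer (c + 1) M) = b * pochhammer (c - b) M / pochhammer c (Suc M)"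
      by (simp add: pochhammer_rec)
    moreover have "pochhammer (c - b) M / pochhammer c M =
        (c + of_nat M) * pochhammer (c - b) M / pochhammer c (Suc M)"
      using Suc.prems[of M] by (simp add: pochhammer_rec')
    ultimately have "pochhammer (c - b) M / pochhammer c M - b / c * (pochhammer (c - b) M / pochhammer (c + 1) M) =
        ((c + of_nat M) * pochhammer (c - b) M - b * pochhammer (c - b) M) / pochhammer c (Suc M)"
      by (simp only: diff_divide_distrib)
    also have "(c + of_nat M) * pochhammer (c - b) M - b * pochhammer (c - b) M = pochhammer (c - b) (Suc M)"
      by (simp add: pochhammer_Suc algebra_simps)
    finally show ?thesis .
  qed
  finally show ?case .
qed simp

text \<open>A truncated 2F1 at 1, expanded into partial fractions in the parameter \<open>a\<close>.
  Passing from \<open>M\<close> to \<open>Suc M\<close> adds one term on the left; on the right the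
  increment is a full Chu-Vandermonde sum.\<close>

lemma partial_hypergeometric_sum:
  fixes a b c :: "'a::field_char_0"
  assumes "\<And>j. j \<le> M \<Longrightarrow> a + of_nat j \<noteq> 0" "\<And>j. c + of_nat j \<noteq> 0"
  shows "fact M * (\<Sum>h\<le>M. pochhammer a h * pochhammer b h / (fact h * pochhammer c h)) =
    pochhammer (a + 1) M * (\<Sum>j\<le>M. (-1) ^ j * of_nat (M choose j) * pochhammer (c - b) j / pochhammer c j *
      (a / (a + of_nat j)))"
  using assms(1)
proof (induction M)
  case 0
  then show ?case by simp
next
  case (Suc M)
  define t where "t j = (-1) ^ j * pochhammer (c - b) j / pochhammer c j" for j
  have IH: "fact M * (\<Sum>h\<le>M. pochhammer a h * pochhammer b h / (fact h * pochhammer c h)) =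
    pochhammer (a + 1) M * (\<Sum>j\<le>M. t j * of_nat (M choose j) * (a / (a + of_nat j)))"
    using Suc by (simp add: t_def mult_ac)
  have V: "(\<Sum>j\<le>Suc M. t j * of_nat (Suc M choose j)) = pochhammer b (Suc M) / pochhammer c (Suc M)"
    using sum_choose_pochhammer[OF assms(2), of "Suc M" "c - b"] by (simp add: t_def mult_ac del: sum.atMost_Suc)
  have step: "pochhammer (a + 1) (Suc M) * (of_nat (Suc M choose j) * (a / (a + of_nat j))) =
      of_nat (Suc M) * (pochhammer (a + 1) M * (of_nat (M choose j) * (a / (a + of_nat j)))) +
      pochhammer a (Suc M) * of_nat (Suc M choose j)" if "j \<le> Suc M" for j
  proof -
    have nz: "a + of_nat j \<noteq> 0" using Suc.prems that by simp
    have "Suc M * (M choose j) = (Suc M - j) * (Suc M choose j)"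
      using that binomial_absorb_comp[of "Suc M" j] by simp
    then have "of_nat (Suc M) * of_nat (M choose j) = (of_nat (Suc M) - of_nat j) * (of_nat (Suc M choose j) :: 'a)"
      using that by (metis of_nat_diff of_nat_mult)
    then have "(a + 1 + of_nat M) * of_nat (Suc M choose j) = of_nat (Suc M) * of_nat (M choose j) +
        (a + of_nat j) * of_nat (Suc M choose j)"
      by (simp add: algebra_simps)
    then have "pochhammer (a + 1) M * a / (a + of_nat j) * ((a + 1 + of_nat M) * of_nat (Suc M choose j)) =
       pochhammer (a + 1) M * a / (a + of_nat j) * (of_nat (Suc M) * of_nat (M choose j) +
        (a + of_nat j) * of_nat (Suc M choose j))" by simp
    also have "\<dots> = of_nat (Suc M) * (pochhammer (a + 1) M * (of_nat (M choose j) * (a / (a + of_nat j)))) +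
        pochhammer a (Suc M) * of_nat (Suc M choose j)"
      using nz by (simp add: pochhammer_rec[of a] distrib_left del: of_nat_Suc)
    finally show ?thesis by (simp add: pochhammer_Suc[of "a + 1"] mult_ac)
  qed
  have "pochhammer (a + 1) (Suc M) * (\<Sum>j\<le>Suc M. t j * of_nat (Suc M choose j) * (a / (a + of_nat j))) =
      (\<Sum>j\<le>Suc M. t j * (pochhammer (a + 1) (Suc M) * (of_nat (Suc M choose j) * (a / (a + of_nat j)))))"
    unfolding sum_distrib_left by (intro sum.cong) (simp_all add: mult_ac)
  also have "\<dots> = (\<Sum>j\<le>Suc M. of_nat (Suc M) * pochhammer (a + 1) M * (t j * of_nat (M choose j) * (a / (a + of_nat j))) +
      pochhammer a (Suc M) * (t j * of_nat (Suc M choose j)))"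
    by (intro sum.cong refl, subst step) (simp_all add: algebra_simps del: of_nat_Suc binomial_Suc_Suc)
  also have "\<dots> = of_nat (Suc M) * pochhammer (a + 1) M * (\<Sum>j\<le>Suc M. t j * of_nat (M choose j) * (a / (a + of_nat j))) +
      pochhammer a (Suc M) * (\<Sum>j\<le>Suc M. t j * of_nat (Suc M choose j))"
    unfolding sum.distrib sum_distrib_left ..
  also have "(\<Sum>j\<le>Suc M. t j * of_nat (M choose j) * (a / (a + of_nat j))) =
      (\<Sum>j\<le>M. t j * of_nat (M choose j) * (a / (a + of_nat j)))" by simp
  also have "of_nat (Suc M) * pochhammer (a + 1) M * (\<Sum>j\<le>M. t j * of_nat (M choose j) * (a / (a + of_nat j))) =
      of_nat (Suc M) * (fact M * (\<Sum>h\<le>M. pochhammer a h * pochhammer b h / (fact h * pochhammer c h)))"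
    unfolding IH by (simp only: mult.assoc)
  also have "pochhammer a (Suc M) * (\<Sum>j\<le>Suc M. t j * of_nat (Suc M choose j)) =
      fact (Suc M) * (pochhammer a (Suc M) * pochhammer b (Suc M) / (fact (Suc M) * pochhammer c (Suc M)))"
    unfolding V by (simp del: fact_Suc)
  also have "of_nat (Suc M) * (fact M * (\<Sum>h\<le>M. pochhammer a h * pochhammer b h / (fact h * pochhammer c h))) +
     fact (Suc M) * (pochhammer a (Suc M) * pochhammer b (Suc M) / (fact (Suc M) * pochhammer c (Suc M))) =
     fact (Suc M) * (\<Sum>h\<le>Suc M. pochhammer a h * pochhammer b h / (fact h * pochhammer c h))"
    by (simp add: algebra_simps)
  finally show ?case by (simp add: t_def mult_ac del: sum.atMost_Suc binomial_Suc_Suc)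
qed

text \<open>Separates an explicit product from a remainder, in preparation for Rouche's theorem:
  \<open>(N + 1) / (N + 1 + j)\<close> is split as \<open>1 - j / (N + 1 + j)\<close>, and the part
  from \<open>1\<close> is summed by Chu-Vandermonde. The term \<open>j = 0\<close> of the remainder
  vanishes.\<close>

lemma kl_weight_partial_fractions:
  fixes z N :: "'a::field_char_0"
  assumes "\<And>j. z + 2 + of_nat j \<noteq> 0" "\<And>j. j \<le> M \<Longrightarrow> N + 1 + of_nat j \<noteq> 0"
  shows "fact M * kl_weight M N z = pochhammer z M * pochhammer (N + 2) M -
    pochhammer (z + 2) M * pochhammer (N + 2) M *
      (\<Sum>j\<le>M. (-1) ^ j * of_nat (M choose j) * fact (Suc j) * of_nat j /
         (pochhammer (z + 2) j * (N + 1 + of_nat j)))"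
proof -
  have p2: "pochhammer 2 j = (fact (Suc j) :: 'a)" for j
    by (simp add: pochhammer_fact pochhammer_rec del: fact_Suc)
  have nz: "pochhammer (z + 2) M \<noteq> 0" using assms(1) by (auto simp: pochhammer_eq_0_iff eq_neg_iff_add_eq_0)
  have "fact M * kl_weight M N z = pochhammer (z + 2) M * (fact M *
    (\<Sum>h\<le>M. pochhammer (N + 1) h * pochhammer z h / (fact h * pochhammer (z + 2) h)))"
    by (subst kl_weight_alt[OF assms(1)]) (simp add: mult_ac)
  also have "\<dots> = pochhammer (z + 2) M * (pochhammer (N + 2) M *
     (\<Sum>j\<le>M. (-1) ^ j * of_nat (M choose j) * pochhammer 2 j / pochhammer (z + 2) j *
      ((N + 1) / (N + 1 + of_nat j))))"
    using partial_hypergeometric_sum[of M "N + 1" "z + 2" z] assms by (simp add: add_ac)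
  also have "(\<Sum>j\<le>M. (-1) ^ j * of_nat (M choose j) * pochhammer 2 j / pochhammer (z + 2) j *
      ((N + 1) / (N + 1 + of_nat j))) =
     (\<Sum>j\<le>M. (-1) ^ j * of_nat (M choose j) * pochhammer 2 j / pochhammer (z + 2) j -
       (-1) ^ j * of_nat (M choose j) * fact (Suc j) * of_nat j / (pochhammer (z + 2) j * (N + 1 + of_nat j)))"
  proof (rule sum.cong[OF refl])
    fix j assume "j \<in> {..M}"
    then have "(N + 1) / (N + 1 + of_nat j) = 1 - of_nat j / (N + 1 + of_nat j)"
      using assms(2)[of j] by (simp add: field_simps)
    then show "(-1) ^ j * of_nat (M choose j) * pochhammer 2 j / pochhammer (z + 2) j *
      ((N + 1) / (N + 1 + of_nat j)) = (-1) ^ j * of_nat (M choose j) * pochhammer 2 j / pochhammer (z + 2) j -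
       (-1) ^ j * of_nat (M choose j) * fact (Suc j) * of_nat j / (pochhammer (z + 2) j * (N + 1 + of_nat j))"
      unfolding p2 by (simp add: right_diff_distrib)
  qed
  also have "\<dots> = pochhammer z M / pochhammer (z + 2) M -
     (\<Sum>j\<le>M. (-1) ^ j * of_nat (M choose j) * fact (Suc j) * of_nat j /
         (pochhammer (z + 2) j * (N + 1 + of_nat j)))"
    unfolding sum_subtractf using sum_choose_pochhammer[OF assms(1), of M 2] by simp
  finally show ?thesis using nz by (simp add: algebra_simps)
qed

text \<open>At \<open>z = - k\<close>, where \<open>N = d - z = d + k\<close>, only the summands
  \<open>h = k - 1\<close> and \<open>h = k\<close> survive. These are the sign changes that produce
  the negative roots.\<close>

lemma kl_weight_neg_int:
  assumes "k \<le> M" "0 < d"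
  shows "(-1) ^ k * kl_weight M (real d + real k) (- real k) > 0"
proof -
  let ?N = "real d + real k"
  let ?f = "\<lambda>h. pochhammer (?N + 1) h * pochhammer (- real k) h *
     pochhammer (- real k + real h + 2) (M - h) / fact h"
  \<comment> \<open>For \<open>h > k\<close> the factor \<open>pochhammer (- k) h\<close> contains
    zero; for \<open>h < k - 1\<close> the factor starting at \<open>h + 2 - k \<le> 0\<close> does,
    since \<open>k \<le> M\<close>.\<close>
  have zero: "?f h = 0" if "h \<le> M" "h \<noteq> k" "Suc h \<noteq> k" for h
  proof (cases "h > k")
    case True
    then show ?thesis by (simp add: pochhammer_of_nat_eq_0_lemma)
  next
    case False
    then have "- real k + real h + 2 = - real (k - h - 2)" "M - h > k - h - 2"
      using that assms by (auto simp: of_nat_diff)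
    then have "pochhammer (- real k + real h + 2) (M - h) = 0"
      using pochhammer_of_nat_eq_0_lemma[of "k - h - 2" "M - h", where 'a = real] by (metis)
    then show ?thesis by simp
  qed
  have k: "?f k = (-1) ^ k * (fact (Suc (M - k)) * pochhammer (?N + 1) k)"
  proof -
    have "pochhammer 2 (M - k) = (fact (Suc (M - k)) :: real)"
      by (simp add: pochhammer_fact pochhammer_rec del: fact_Suc)
    then show ?thesis by (simp add: pochhammer_same del: fact_Suc)
  qed
  show ?thesis
  proof (cases k)
    case 0
    have "kl_weight M ?N (- real k) = (\<Sum>h\<in>{k}. ?f h)"
      unfolding kl_weight_def
      using 0 zero by (intro sum.mono_neutral_right) auto
    then show ?thesis using k 0 by (simp del: fact_Suc)
  next
    case (Suc l)
    have l: "?f l = - ((-1) ^ k * (fact (Suc (M - k)) * pochhammer (?N + 1) l * real k))"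
    proof -
      have "pochhammer (- real k) k = pochhammer (- real k) l * (- 1)"
        unfolding Suc by (simp add: pochhammer_Suc)
      then have 1: "pochhammer (- real k) l = - ((-1) ^ k * fact k)" by (simp add: pochhammer_same)
      have "pochhammer (- real k + real l + 2) (M - l) = fact (Suc (M - k))"
        using assms Suc by (simp add: pochhammer_fact Suc_diff_Suc del: fact_Suc)
      then show ?thesis using 1 Suc by (simp add: fact_Suc)
    qed
    have "kl_weight M ?N (- real k) = (\<Sum>h\<in>{l, k}. ?f h)"
      unfolding kl_weight_def
      using Suc zero assms by (intro sum.mono_neutral_right) auto
    also have "\<dots> = ?f l + ?f k" using Suc by simp
    also have "\<dots> = (-1) ^ k * (fact (Suc (M - k)) * pochhammer (?N + 1) l * ?N)"
      unfolding l k unfolding Suc by (simp add: pochhammer_Suc algebra_simps del: fact_Suc)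
    finally have "(-1) ^ k * kl_weight M ?N (- real k) = fact (Suc (M - k)) * pochhammer (?N + 1) l * ?N"
      by (simp flip: mult.assoc power_add del: fact_Suc)
    moreover have "fact (Suc (M - k)) * pochhammer (?N + 1) l * ?N > 0"
      using assms by (intro mult_pos_pos pochhammer_pos) auto
    ultimately show ?thesis by simp
  qed
qed

section \<open>Closed form of the coefficients\<close>

lemma coeff_kl_inverse_transform_real:
  assumes "2 * i < n"
  shows "real_of_int (coeff (kl_inverse_transform (Suc M) n) i) = fact (Suc M + n) *
    ((-1) ^ (n - 1) * (real n - 2 * real i) /
      (fact M * fact i * fact (n - i) * (real n + real (Suc M) - real i) * (real (Suc M) + real i)))"
proof -
  let ?m = "Suc M"
  obtain j where j: "n = i + Suc j" using assms by (metis add_lessD1 less_imp_Suc_add mult_2 add_Suc_right)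
  have A1: "real (?m + n choose i) * real (?m + n - i - 1 choose ?m) =
      fact (?m + n) * (real j + 1) / (fact ?m * fact i * fact (Suc j) * (real ?m + real j + 1))"
  proof -
    have "real (?m + n choose i) = fact (?m + n) / (fact i * ((real ?m + real j + 1) * fact (?m + j)))"
      using binomial_fact[of i "?m + n", where 'a = real] by (simp add: j add_ac)
    moreover have "real (?m + n - i - 1 choose ?m) = fact (?m + j) / (fact ?m * fact j)"
      using binomial_fact[of ?m "?m + j", where 'a = real] by (simp add: j del: fact_Suc)
    ultimately have "real (?m + n choose i) * real (?m + n - i - 1 choose ?m) =
        fact (?m + n) / (fact i * (real ?m + real j + 1) * (fact ?m * fact j))"
      by (simp del: fact_Suc of_nat_Suc)
    also have "\<dots> = fact (?m + n) * (1 / fact j) / (fact i * (real ?m + real j + 1) * fact ?m)"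
      by (simp del: fact_Suc of_nat_Suc)
    also have "1 / fact j = (real j + 1) / fact (Suc j)"
      using of_nat_neq_0[of j, where 'a = real] by (simp add: add.commute)
    finally show ?thesis by (simp add: mult_ac del: fact_Suc of_nat_Suc)
  qed
  have A2: "real (?m + n choose (n - i)) * real (?m + i - 1 choose ?m) =
      fact (?m + n) * real i / (fact ?m * fact i * fact (Suc j) * (real ?m + real i))"
  proof (cases i)
    case 0
    then show ?thesis by (simp add: binomial_eq_0)
  next
    case (Suc l)
    have "real (?m + n choose (n - i)) = fact (?m + n) / (fact (Suc j) * fact (?m + i))"
      using binomial_fact[of "n - i" "?m + n", where 'a = real] j by (simp add: add_ac del: fact_Suc)
    moreover have "fact (?m + i) = (real ?m + real i) * fact (?m + l)" by (simp add: Suc)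
    moreover have "real (?m + i - 1 choose ?m) = fact (?m + l) / (fact ?m * fact l)"
      using binomial_fact[of ?m "?m + l", where 'a = real] by (simp add: Suc del: fact_Suc)
    ultimately have "real (?m + n choose (n - i)) * real (?m + i - 1 choose ?m) =
        fact (?m + n) / (fact (Suc j) * (real ?m + real i) * (fact ?m * fact l))"
      by (simp del: fact_Suc of_nat_Suc)
    also have "\<dots> = fact (?m + n) * (1 / fact l) / (fact (Suc j) * (real ?m + real i) * fact ?m)"
      by (simp del: fact_Suc of_nat_Suc)
    also have "1 / fact l = real i / fact i" by (simp add: Suc del: of_nat_Suc)
    finally show ?thesis by (simp add: mult_ac del: fact_Suc of_nat_Suc)
  qed
  have "real_of_int (coeff (kl_inverse_transform ?m n) i) = (-1) ^ (n - 1) *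
      (real (?m + n choose i) * real (?m + n - i - 1 choose ?m) -
       real (?m + n choose (n - i)) * real (?m + i - 1 choose ?m))"
  proof -
    have "coeff (asym_poly ?m n) i = (-1) ^ (n - 1) *
      (int (?m + n choose (n - i)) * int (?m + i - 1 choose ?m) - int (?m + n choose i) * int (?m + n - i - 1 choose ?m))"
      using assms by (intro coeff_asym_poly) auto
    then show ?thesis using assms
      by (simp add: coeff_kl_inverse_transform del: binomial_Suc_Suc) (simp add: algebra_simps del: binomial_Suc_Suc)
  qed
  also have "\<dots> = (-1) ^ (n - 1) * (fact (?m + n) / (fact ?m * fact i * fact (Suc j)) *
      ((real j + 1) / (real ?m + real j + 1) - real i / (real ?m + real i)))"
    unfolding A1 A2 by (simp add: right_diff_distrib del: fact_Suc of_nat_Suc)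
  also have "(real j + 1) / (real ?m + real j + 1) - real i / (real ?m + real i) =
      real ?m * (real j + 1 - real i) / ((real ?m + real j + 1) * (real ?m + real i))"
  proof -
    have "real ?m + real j + 1 \<noteq> 0" "real ?m + real i \<noteq> 0" by linarith+
    then show ?thesis by (simp add: divide_simps del: of_nat_Suc) (simp add: algebra_simps del: of_nat_Suc)
  qed
  also have "fact (?m + n) / (fact ?m * fact i * fact (Suc j)) *
      (real ?m * (real j + 1 - real i) / ((real ?m + real j + 1) * (real ?m + real i))) =
      fact (?m + n) * ((real j + 1 - real i) / (fact M * fact i * fact (Suc j) * ((real ?m + real j + 1) * (real ?m + real i))))"
    by (simp add: fact_Suc[of M] del: fact_Suc of_nat_Suc)
  also have "real j + 1 - real i = real n - 2 * real i" by (simp add: j)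
  also have "real ?m + real j + 1 = real n + real ?m - real i" by (simp add: j)
  also have "Suc j = n - i" by (simp add: j)
  finally show ?thesis by (simp add: mult_ac del: fact_Suc of_nat_Suc)
qed

lemma sum_tail_alternating_choose:
  assumes "i < N"
  shows "(\<Sum>a=Suc i..N. (-1) ^ (a - Suc i) * real (N choose a)) = real (N - 1 choose i)"
proof -
  have "i \<le> N - 1" using assms by simp
  then show ?thesis
  proof (induction i rule: inc_induct)
    case base
    then show ?case using assms by simp
  next
    case (step i)
    have "{Suc i..N} = insert (Suc i) {Suc (Suc i)..N}" using step by auto
    then have "(\<Sum>a=Suc i..N. (-1) ^ (a - Suc i) * real (N choose a)) =
        real (N choose Suc i) + (\<Sum>a=Suc (Suc i)..N. (-1) ^ (a - Suc i) * real (N choose a))" by simp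
    also have "(\<Sum>a=Suc (Suc i)..N. (-1) ^ (a - Suc i) * real (N choose a)) =
        - (\<Sum>a=Suc (Suc i)..N. (-1) ^ (a - Suc (Suc i)) * real (N choose a))"
      unfolding sum_negf[symmetric]
    proof (rule sum.cong[OF refl])
      fix a assume "a \<in> {Suc (Suc i)..N}"
      then have "a - Suc i = Suc (a - Suc (Suc i))" by simp arith
      then show "(-1) ^ (a - Suc i) * real (N choose a) = - ((-1) ^ (a - Suc (Suc i)) * real (N choose a))"
        by (metis mult_minus_left mult_minus1 power_Suc)
    qed
    also have "\<dots> = - real (N - 1 choose Suc i)" using step by simp
    also have "N choose Suc i = (N - 1 choose i) + (N - 1 choose Suc i)"
      using step by (metis binomial_Suc_Suc Suc_pred' zero_less_diff less_nat_zero_code not_gr_zero diff_0_eq_0)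
    finally show ?case by simp
  qed
qed

text \<open>Backward induction on \<open>i\<close>. The factor \<open>real N - 1\<close> stands on
  the left to avoid a division.\<close>

lemma sum_tail_alternating_choose_linear:
  assumes "i \<le> N" "2 \<le> N"
  shows "(real N - 1) * (\<Sum>a=Suc i..N. (-1) ^ (a - Suc i) * (real a - real i) * real (N choose a)) =
    real i * real (N - 1 choose i)"
  using assms(1)
proof (induction i rule: inc_induct)
  case base
  then show ?case using assms by (simp add: binomial_eq_0)
next
  case (step i)
  let ?h = "\<lambda>i. (\<Sum>a=Suc i..N. (-1) ^ (a - Suc i) * (real a - real i) * real (N choose a))"
  \<comment> \<open>The signs of the two sums are opposite and the linear weights
    \<open>a - i\<close> and \<open>a - i - 1\<close> differ by one, so the weights cancel to
    1.\<close>
  have "?h i + ?h (Suc i) = (\<Sum>a=Suc i..N. (-1) ^ (a - Suc i) * real (N choose a))"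
  proof -
    have "?h (Suc i) = (\<Sum>a=Suc i..N. (-1) ^ (a - Suc i) * (real (Suc i) - real a) * real (N choose a))"
    proof -
      have "{Suc i..N} = insert (Suc i) {Suc (Suc i)..N}" using step by auto
      then have "(\<Sum>a=Suc i..N. (-1) ^ (a - Suc i) * (real (Suc i) - real a) * real (N choose a)) =
          (\<Sum>a=Suc (Suc i)..N. (-1) ^ (a - Suc i) * (real (Suc i) - real a) * real (N choose a))" by simp
      also have "\<dots> = ?h (Suc i)"
      proof (rule sum.cong[OF refl])
        fix a assume "a \<in> {Suc (Suc i)..N}"
        then have "a - Suc i = Suc (a - Suc (Suc i))" by simp arith
        then have "(-1) ^ (a - Suc i) = - ((-1 :: real) ^ (a - Suc (Suc i)))" by simp
        then show "(-1) ^ (a - Suc i) * (real (Suc i) - real a) * real (N choose a) =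
          (-1) ^ (a - Suc (Suc i)) * (real a - real (Suc i)) * real (N choose a)"
          by (simp only:) (simp add: algebra_simps)
      qed
      finally show ?thesis by simp
    qed
    then show ?thesis unfolding sum.distrib[symmetric]
      by (simp add: sum.distrib[symmetric] distrib_right[symmetric] distrib_left[symmetric])
  qed
  also have "\<dots> = real (N - 1 choose i)" by (rule sum_tail_alternating_choose) (use step in simp)
  finally have "?h i = real (N - 1 choose i) - ?h (Suc i)" by (simp only: eq_diff_eq)
  then have "(real N - 1) * ?h i = (real N - 1) * real (N - 1 choose i) - (real N - 1) * ?h (Suc i)"
    by (simp only: right_diff_distrib)
  also have "(real N - 1) * ?h (Suc i) = real (Suc i) * real (N - 1 choose Suc i)" by (rule step.IH)
  also have "real (Suc i) * real (N - 1 choose Suc i) = (real N - 1 - real i) * real (N - 1 choose i)"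
  proof -
    have "Suc i * (N - 1 choose Suc i) = (N - 1 - i) * (N - 1 choose i)"
      by (metis binomial_absorb_comp binomial_absorption mult.commute)
    then have "real (Suc i) * real (N - 1 choose Suc i) = real (N - 1 - i) * real (N - 1 choose i)"
      by (metis of_nat_mult)
    then show ?thesis using step by (simp add: of_nat_diff)
  qed
  finally show ?case by (simp add: algebra_simps)
qed

text \<open>A telescoping recurrence in \<open>N\<close> at fixed \<open>z\<close>; it mirrors the
  passage from \<open>d\<close> to \<open>Suc d\<close> in the coefficient sum.\<close>

lemma kl_weight_recurrence:
  fixes N z :: "'a::field_char_0"
  shows "(N - 1) * kl_weight M N z - (N - 1 - z) * kl_weight M (N - 1) z =
    pochhammer z (Suc M) * pochhammer (N + 1) M / fact M"
proof -
  \<comment> \<open>Every partial sum up to \<open>H\<close> has a closed form, which makes the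
    induction work; \<open>H = M\<close> is the claim.\<close>
  have "(\<Sum>h\<le>H. (N - 1) * (pochhammer (N + 1) h * pochhammer z h * pochhammer (z + of_nat h + 2) (M - h) / fact h) -
      (N - 1 - z) * (pochhammer N h * pochhammer z h * pochhammer (z + of_nat h + 2) (M - h) / fact h)) =
     pochhammer z (Suc H) * pochhammer (N + 1) H * pochhammer (z + of_nat H + 2) (M - H) / fact H" if "H \<le> M" for H
    using that
  proof (induction H)
    case 0
    show ?case by (simp add: algebra_simps)
  next
    case (Suc H)
    define A where "A = pochhammer z (Suc H)"
    define B where "B = pochhammer (N + 1) H"
    define C where "C = pochhammer (z + of_nat (Suc H) + 2) (M - Suc H)"
    have 1: "pochhammer (z + of_nat H + 2) (M - H) = (z + of_nat H + 2) * C"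
    proof -
      have "M - H = Suc (M - Suc H)" using Suc.prems by simp
      then show ?thesis unfolding C_def by (simp add: pochhammer_rec add_ac)
    qed
    have 2: "pochhammer N (Suc H) = N * B" by (simp add: B_def pochhammer_rec)
    have 3: "pochhammer (N + 1) (Suc H) = B * (N + 1 + of_nat H)" by (simp add: B_def pochhammer_Suc)
    have 4: "pochhammer z (Suc (Suc H)) = A * (z + 1 + of_nat H)" by (simp add: A_def pochhammer_Suc[of z "Suc H"] add_ac)
    have f: "fact H \<noteq> (0::'a)" "fact (Suc H) = (1 + of_nat H) * (fact H :: 'a)" "1 + of_nat H \<noteq> (0::'a)"
      by (simp_all add: of_nat_Suc[symmetric] del: of_nat_Suc)
    have "(\<Sum>h\<le>Suc H. (N - 1) * (pochhammer (N + 1) h * pochhammer z h * pochhammer (z + of_nat h + 2) (M - h) / fact h) -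
      (N - 1 - z) * (pochhammer N h * pochhammer z h * pochhammer (z + of_nat h + 2) (M - h) / fact h)) =
      A * B * ((z + of_nat H + 2) * C) / fact H +
      ((N - 1) * (B * (N + 1 + of_nat H) * A * C / fact (Suc H)) - (N - 1 - z) * (N * B * A * C / fact (Suc H)))"
      unfolding sum.atMost_Suc using Suc by (simp only: 1 2 3 A_def[symmetric] B_def[symmetric] C_def[symmetric])
    also have "A * B * ((z + of_nat H + 2) * C) / fact H = (1 + of_nat H) * (A * B * ((z + of_nat H + 2) * C)) / fact (Suc H)"
      unfolding f(2) using f(3) by simp
    also have "(1 + of_nat H) * (A * B * ((z + of_nat H + 2) * C)) / fact (Suc H) +
      ((N - 1) * (B * (N + 1 + of_nat H) * A * C / fact (Suc H)) - (N - 1 - z) * (N * B * A * C / fact (Suc H))) =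
      ((1 + of_nat H) * (A * B * ((z + of_nat H + 2) * C)) +
      ((N - 1) * (B * (N + 1 + of_nat H) * A * C) - (N - 1 - z) * (N * B * A * C))) / fact (Suc H)"
      by (simp only: add_divide_distrib diff_divide_distrib times_divide_eq_right)
    also have "(1 + of_nat H) * (A * B * ((z + of_nat H + 2) * C)) +
      ((N - 1) * (B * (N + 1 + of_nat H) * A * C) - (N - 1 - z) * (N * B * A * C)) =
      A * B * C * ((1 + of_nat H) * (z + of_nat H + 2) + (N - 1) * (N + 1 + of_nat H) - (N - 1 - z) * N)"
      by (simp add: algebra_simps)
    also have "(1 + of_nat H) * (z + of_nat H + 2) + (N - 1) * (N + 1 + of_nat H) - (N - 1 - z) * N =
        (z + 1 + of_nat H) * (N + 1 + of_nat H)" by (simp add: algebra_simps)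
    also have "A * B * C * ((z + 1 + of_nat H) * (N + 1 + of_nat H)) / fact (Suc H) =
      pochhammer z (Suc (Suc H)) * pochhammer (N + 1) (Suc H) * C / fact (Suc H)"
      unfolding 3 4 by (simp add: mult_ac)
    finally show ?case unfolding C_def .
  qed
  from this[of M] show ?thesis
    by (simp add: kl_weight_def sum_subtractf sum_distrib_left)
qed

text \<open>For \<open>N = z + 1\<close> the factor \<open>N - 1 - z\<close> of the recurrence
  vanishes, leaving a product. The case \<open>i = 0\<close> is separate because the recurrence is
  then divided by \<open>N - 1 = 0\<close>. This is the base case \<open>d = 2 * i + 1\<close> of
  the coefficient sum.\<close>

lemma kl_weight_diagonal:
  "kl_weight M (real i + 1) (real i) = pochhammer (real i + 1) M * pochhammer (real i + 2) M / fact M"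
proof (cases "i = 0")
  case True
  have "kl_weight M 1 0 = (\<Sum>h\<in>{0}. pochhammer (1 + 1) h * pochhammer 0 h * pochhammer (0 + real h + 2) (M - h) / fact h)"
    unfolding kl_weight_def by (intro sum.mono_neutral_right) (auto simp: pochhammer_0_left)
  then show ?thesis using True by (simp add: pochhammer_fact[symmetric])
next
  case False
  have "real i * kl_weight M (real i + 1) (real i) = pochhammer (real i) (Suc M) * pochhammer (real i + 2) M / fact M"
    using kl_weight_recurrence[of "real i + 1" M "real i"] by (simp add: add_ac)
  also have "\<dots> = real i * (pochhammer (real i + 1) M * pochhammer (real i + 2) M / fact M)"
    by (simp add: pochhammer_rec)
  finally show ?thesis using False by (metis mult_left_cancel of_nat_eq_0_iff)
qed

lemma pochhammer_real_fact: "pochhammer (real a + 1) n = fact (a + n) / fact a"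
  by (induction n) (simp_all add: pochhammer_Suc algebra_simps)

text \<open>Induction on \<open>d\<close> from the first nonempty sum \<open>d = 2 * i + 1\<close>.
  The sum satisfies a first-order inhomogeneous recurrence in \<open>d\<close>, and
  \<open>kl_weight_recurrence\<close> says that the closed form satisfies the same one.\<close>

lemma kl_coefficient_sum:
  assumes "2 * i < d"
  shows "(\<Sum>n=2*i+1..d. (-1) ^ (n - 1) * (real n - 2 * real i) /
      (fact M * fact i * fact (n - i) * (real n + real (Suc M) - real i) * (real (Suc M) + real i)) / fact (d - n)) =
    real (d - 1 - i choose i) * kl_weight M (real d - real i) (real i) /
      (fact (d + Suc M - i) * fact (i + Suc M))"
proof -
  define \<phi> where "\<phi> n = (-1) ^ (n - 1) * (real n - 2 * real i) /
      (fact M * fact i * fact (n - i) * (real n + real (Suc M) - real i) * (real (Suc M) + real i))" for n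
  define S where "S d = (\<Sum>n=2*i+1..d. \<phi> n / fact (d - n))" for d
  have step_eq: "(real (Suc d) + real (Suc M) - real i) * S (Suc d) = S d +
      real i * real (d - i choose i) / ((real d - real i) * (fact M * fact i * (real (Suc M) + real i) * fact (Suc d - i)))"
    if d: "2 * i + 1 \<le> d" for d
  proof -
    let ?N = "Suc d - i"
    have N: "?N = Suc (d - i)" "2 \<le> ?N" "i \<le> ?N" "?N - 1 = d - i" using d by auto
    \<comment> \<open>The prefactor is \<open>(Suc d - n) + (n + Suc M - i)\<close>: the first part
      lowers \<open>fact (Suc d - n)\<close> to \<open>fact (d - n)\<close>, the second cancels the
      linear denominator in \<open>n\<close> and leaves a tail of an alternating binomial
      sum.\<close>
    have split: "(real (Suc d) + real (Suc M) - real i) * (\<phi> n / fact (Suc d - n)) =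
        (if n \<le> d then \<phi> n / fact (d - n) else 0) +
        (-1) ^ (n - 1) * (real n - 2 * real i) / (fact M * fact i * fact (n - i) * (real (Suc M) + real i)) / fact (Suc d - n)"
      if n: "n \<in> {2*i+1..Suc d}" for n
    proof -
      define c where "c = real n + real (Suc M) - real i"
      have c: "c \<noteq> 0" using n unfolding c_def by auto
      have \<phi>: "\<phi> n * c = (-1) ^ (n - 1) * (real n - 2 * real i) / (fact M * fact i * fact (n - i) * (real (Suc M) + real i))"
        using c unfolding \<phi>_def c_def[symmetric] by simp
      have eq: "real (Suc d) + real (Suc M) - real i = (real (Suc d) - real n) + c" by (simp add: c_def)
      have "(real (Suc d) + real (Suc M) - real i) * (\<phi> n / fact (Suc d - n)) =
          (real (Suc d) - real n) * (\<phi> n / fact (Suc d - n)) + \<phi> n * c / fact (Suc d - n)"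
        unfolding eq by (simp only: distrib_right add_divide_distrib times_divide_eq_right mult.commute[of c])
      also have "(real (Suc d) - real n) * (\<phi> n / fact (Suc d - n)) = (if n \<le> d then \<phi> n / fact (d - n) else 0)"
      proof (cases "n \<le> d")
        case True
        then have "fact (Suc d - n) = (real (Suc d) - real n) * fact (d - n)"
          by (simp add: Suc_diff_le of_nat_diff)
        then show ?thesis using True by simp
      next
        case False
        then have "n = Suc d" using n by simp
        then show ?thesis by simp
      qed
      finally show ?thesis unfolding \<phi> .
    qed
    have "(real (Suc d) + real (Suc M) - real i) * S (Suc d) =
      (\<Sum>n=2*i+1..Suc d. if n \<le> d then \<phi> n / fact (d - n) else 0) +
      (\<Sum>n=2*i+1..Suc d. (-1) ^ (n - 1) * (real n - 2 * real i) / (fact M * fact i * fact (n - i) * (real (Suc M) + real i)) / fact (Suc d - n))"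
      unfolding S_def sum_distrib_left sum.distrib[symmetric] by (intro sum.cong refl split)
    also have "(\<Sum>n=2*i+1..Suc d. if n \<le> d then \<phi> n / fact (d - n) else 0) = S d"
      unfolding S_def by (intro sum.mono_neutral_cong_right) auto
    also have "(\<Sum>n=2*i+1..Suc d. (-1) ^ (n - 1) * (real n - 2 * real i) / (fact M * fact i * fact (n - i) * (real (Suc M) + real i)) / fact (Suc d - n)) =
        (\<Sum>a=Suc i..?N. (-1) ^ (a - Suc i) * (real a - real i) * real (?N choose a)) / (fact M * fact i * (real (Suc M) + real i) * fact ?N)"
      unfolding sum_divide_distrib
    proof (rule sum.reindex_bij_witness[of _ "\<lambda>a. a + i" "\<lambda>n. n - i"])
      fix n assume n: "n \<in> {2*i+1..Suc d}"
      have "real (?N choose (n - i)) = fact ?N / (fact (n - i) * fact (Suc d - n))"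
        using binomial_fact[of "n - i" ?N, where 'a = real] n by auto
      moreover have "(-1) ^ (n - i - Suc i) = (-1 :: real) ^ (n - 1)"
      proof -
        have "n - 1 = (n - i - Suc i) + 2 * i" using n by auto
        then show ?thesis by (simp only: power_add power_mult) simp
      qed
      moreover have "real (n - i) - real i = real n - 2 * real i" using n by (simp add: of_nat_diff)
      ultimately show "(-1) ^ (n - i - Suc i) * (real (n - i) - real i) * real (?N choose (n - i)) / (fact M * fact i * (real (Suc M) + real i) * fact ?N) =
         (-1) ^ (n - 1) * (real n - 2 * real i) / (fact M * fact i * fact (n - i) * (real (Suc M) + real i)) / fact (Suc d - n)"
        by (simp add: mult_ac del: of_nat_Suc fact_Suc)
    qed (use d in auto)
    also have "(\<Sum>a=Suc i..?N. (-1) ^ (a - Suc i) * (real a - real i) * real (?N choose a)) =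
        real i * real (d - i choose i) / (real d - real i)"
    proof -
      have "(real d - real i) * (\<Sum>a=Suc i..?N. (-1) ^ (a - Suc i) * (real a - real i) * real (?N choose a)) = real i * real (d - i choose i)"
        using sum_tail_alternating_choose_linear[OF N(3,2)] unfolding N(4) using N(1) d by (simp add: of_nat_diff)
      moreover have "real d - real i \<noteq> 0" using d by simp
      ultimately show ?thesis by (simp add: field_simps)
    qed
    finally show ?thesis by (simp add: mult_ac del: of_nat_Suc fact_Suc)
  qed
  have "2 * i + 1 \<le> d" using assms by simp
  then have "S d = real (d - 1 - i choose i) * kl_weight M (real d - real i) (real i) / (fact (d + Suc M - i) * fact (i + Suc M))"
  proof (induction d rule: dec_induct)
    case base
    have "S (2 * i + 1) = 1 / (fact M * fact i * fact (Suc i) * (real i + real (Suc M) + 1) * (real (Suc M) + real i))"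
    proof -
      have "S (2 * i + 1) = \<phi> (2 * i + 1)" by (simp add: S_def)
      moreover have "real (2 * i + 1) - 2 * real i = 1" "2 * i + 1 - i = Suc i" "(-1 :: real) ^ (2 * i + 1 - 1) = 1"
        "real (2 * i + 1) + real (Suc M) - real i = real i + real (Suc M) + 1" by simp_all
      ultimately show ?thesis unfolding \<phi>_def by (simp only: mult_1_left)
    qed
    also have "\<dots> = pochhammer (real i + 1) M * pochhammer (real i + 2) M / fact M / (fact (i + 1 + Suc M) * fact (i + Suc M))"
    proof -
      have 1: "pochhammer (real i + 1) M = fact (i + M) / fact i" by (rule pochhammer_real_fact)
      have 2: "pochhammer (real i + 2) M = fact (i + Suc M) / fact (Suc i)"
        using pochhammer_real_fact[of "Suc i" M] by (simp add: add_ac del: fact_Suc)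
      define x where "x = real (Suc M) + real i"
      define y where "y = real i + real (Suc M) + 1"
      have 3: "fact (i + 1 + Suc M) = y * fact (i + Suc M)" by (simp add: y_def add_ac)
      have 4: "fact (i + Suc M) = x * fact (i + M)" by (simp add: x_def add_ac)
      have 5: "x \<noteq> 0" "y \<noteq> 0" unfolding x_def y_def by linarith+
      show ?thesis unfolding 1 2 3 x_def[symmetric] y_def[symmetric] unfolding 4 using 5
        by (simp add: field_simps del: fact_Suc of_nat_Suc)
    qed
    finally have "S (2 * i + 1) = kl_weight M (real i + 1) (real i) / (fact (i + 1 + Suc M) * fact (i + Suc M))"
      unfolding kl_weight_diagonal .
    moreover have "2 * i + 1 - 1 - i = i" "real (2 * i + 1) - real i = real i + 1" "2 * i + 1 + Suc M - i = i + 1 + Suc M"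
      by simp_all
    ultimately show ?case by (simp only: binomial_n_n of_nat_1 mult_1_left)
  next
    case (step d)
    define N where "N = d - i"
    define W where "W = kl_weight M (real N) (real i)"
    define W' where "W' = kl_weight M (real N + 1) (real i)"
    have d: "d = N + i" "i < N" "0 < N" using step by (auto simp: N_def)
    have eqs: "Suc d - i = Suc N" "d - i = N" "real d - real i = real N" "d - 1 - i = N - 1"
      "real (Suc d) + real (Suc M) - real i = real N + real (Suc M) + 1" "d + Suc M - i = N + Suc M"
      "Suc d - 1 - i = N" "real (Suc d) - real i = real N + 1" "Suc d + Suc M - i = Suc N + Suc M"
      using d by simp_all
    have rec: "real N * W' - (real N - real i) * W = pochhammer (real i) (Suc M) * pochhammer (real N + 2) M / fact M"
    proof -
      have "real N + 1 - 1 = real N" "real N + 1 + 1 = real N + 2" by simp_all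
      then show ?thesis using kl_weight_recurrence[of "real N + 1" M "real i"] unfolding W_def W'_def by (simp only:)
    qed
    have p1: "pochhammer (real i) (Suc M) = real i * (fact (i + M) / fact i)"
      using pochhammer_real_fact[of i M] by (simp add: pochhammer_rec)
    have p2: "pochhammer (real N + 2) M = fact (N + Suc M) / fact (Suc N)"
      using pochhammer_real_fact[of "Suc N" M] by (simp add: add_ac del: fact_Suc)
    have bin: "real N * real (N - 1 choose i) = (real N - real i) * real (N choose i)"
    proof -
      have "N * (N - 1 choose i) = (N - i) * (N choose i)" using binomial_absorb_comp[of N i] by simp
      then have "real N * real (N - 1 choose i) = real (N - i) * real (N choose i)" by (metis of_nat_mult)
      then show ?thesis by (simp only: of_nat_diff[OF less_imp_le[OF d(2)]])
    qed
    have nz: "real N \<noteq> 0" "real N - real i \<noteq> 0" "real N + real (Suc M) + 1 \<noteq> 0" "real i + real (Suc M) \<noteq> 0"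
      using d by auto
    have f1: "fact (i + Suc M) = (real i + real (Suc M)) * fact (i + M)" by (simp add: add_ac)
    have "(real N + real (Suc M) + 1) * S (Suc d) = S d +
       real i * real (N choose i) / (real N * (fact M * fact i * (real (Suc M) + real i) * fact (Suc N)))"
      using step_eq[OF step.hyps(1)] unfolding eqs .
    also have "S d = real (N - 1 choose i) * W / (fact (N + Suc M) * fact (i + Suc M))"
      using step.IH unfolding eqs W_def .
    also have "real (N - 1 choose i) = (real N - real i) * real (N choose i) / real N"
      using bin nz by (simp add: field_simps)
    also have "(real N - real i) * real (N choose i) / real N * W / (fact (N + Suc M) * fact (i + Suc M)) +
        real i * real (N choose i) / (real N * (fact M * fact i * (real (Suc M) + real i) * fact (Suc N))) =
       real (N choose i) / (real N * (fact (N + Suc M) * fact (i + Suc M))) *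
        ((real N - real i) * W + pochhammer (real i) (Suc M) * pochhammer (real N + 2) M / fact M)"
    proof -
      have "real i / (fact M * fact i * (real (Suc M) + real i) * fact (Suc N)) =
        pochhammer (real i) (Suc M) * pochhammer (real N + 2) M / fact M / (fact (N + Suc M) * fact (i + Suc M))"
      proof -
        define x where "x = real i + real (Suc M)"
        have "x \<noteq> 0" "real (Suc M) + real i = x" using nz by (simp_all add: x_def)
        then show ?thesis unfolding p1 p2 f1 x_def[symmetric] by (simp add: field_simps del: fact_Suc of_nat_Suc)
      qed
      then have T: "real i * real (N choose i) / (real N * (fact M * fact i * (real (Suc M) + real i) * fact (Suc N))) =
        real (N choose i) / real N * (pochhammer (real i) (Suc M) * pochhammer (real N + 2) M / fact M / (fact (N + Suc M) * fact (i + Suc M)))"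
        by (metis (no_types, lifting) mult.commute times_divide_times_eq)
      have gen: "a * b / n * w / (f * g) + b / n * (y / (f * g)) = b / (n * (f * g)) * (a * w + y)" for a b n w f g y :: real
        by (simp add: distrib_left add_divide_distrib mult_ac)
      show ?thesis unfolding T by (rule gen)
    qed
    also have "(real N - real i) * W + pochhammer (real i) (Suc M) * pochhammer (real N + 2) M / fact M = real N * W'"
      using rec by linarith
    also have "real (N choose i) / (real N * (fact (N + Suc M) * fact (i + Suc M))) * (real N * W') =
        real (N choose i) * W' / (fact (N + Suc M) * fact (i + Suc M))" using nz by simp
    finally have "(real N + real (Suc M) + 1) * S (Suc d) = real (N choose i) * W' / (fact (N + Suc M) * fact (i + Suc M))" .
    then have "S (Suc d) = real (N choose i) * W' / (fact (N + Suc M) * fact (i + Suc M)) / (real N + real (Suc M) + 1)"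
      by (subst nonzero_eq_divide_eq[OF nz(3)], subst mult.commute)
    also have "\<dots> = real (N choose i) * W' / ((real N + real (Suc M) + 1) * fact (N + Suc M) * fact (i + Suc M))"
      by (simp add: mult_ac del: fact_Suc of_nat_Suc)
    also have "(real N + real (Suc M) + 1) * fact (N + Suc M) = fact (Suc N + Suc M)" by (simp add: add_ac)
    finally show ?case unfolding eqs W'_def .
  qed
  then show ?thesis unfolding S_def \<phi>_def .
qed

lemma coeff_uniform_kl:
  "real_of_int (coeff (uniform_kl (Suc M) d) i) = (if 2 * i < d then
    fact (d + Suc M) * (real (d - 1 - i choose i) * kl_weight M (real d - real i) (real i) /
      (fact (d + Suc M - i) * fact (i + Suc M))) else 0)"
proof -
  let ?m = "Suc M"
  have cm: "coeff (of_nat c * p) i = int c * coeff p i" for c and p :: "int poly" by (simp add: of_nat_poly)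
  have "real_of_int (coeff (uniform_kl ?m d) i) =
      (\<Sum>j<d. real (?m + d choose j) * real_of_int (coeff (kl_inverse_transform ?m (d - j)) i))"
    unfolding uniform_kl_def coeff_sum cm by simp
  also have "\<dots> = (\<Sum>n=1..d. real (?m + d choose (d - n)) * real_of_int (coeff (kl_inverse_transform ?m n) i))"
    by (rule sum.reindex_bij_witness[of _ "\<lambda>n. d - n" "\<lambda>j. d - j"]) auto
  also have "\<dots> = (\<Sum>n=2*i+1..d. real (?m + d choose (d - n)) * real_of_int (coeff (kl_inverse_transform ?m n) i))"
    by (intro sum.mono_neutral_right) (auto simp: coeff_kl_inverse_transform)
  also have "\<dots> = fact (d + ?m) * (\<Sum>n=2*i+1..d. (-1) ^ (n - 1) * (real n - 2 * real i) /
      (fact M * fact i * fact (n - i) * (real n + real ?m - real i) * (real ?m + real i)) / fact (d - n))"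
    unfolding sum_distrib_left
  proof (rule sum.cong[OF refl])
    fix n assume n: "n \<in> {2*i+1..d}"
    have "real (?m + d choose (d - n)) = fact (?m + d) / (fact (d - n) * fact (?m + n))"
      using binomial_fact[of "d - n" "?m + d", where 'a = real] n by (simp add: add_ac del: fact_Suc)
    then show "real (?m + d choose (d - n)) * real_of_int (coeff (kl_inverse_transform ?m n) i) =
      fact (d + ?m) * ((-1) ^ (n - 1) * (real n - 2 * real i) /
      (fact M * fact i * fact (n - i) * (real n + real ?m - real i) * (real ?m + real i)) / fact (d - n))"
      using coeff_kl_inverse_transform_real[of i n M] n by (simp add: add.commute[of d] del: fact_Suc of_nat_Suc)
  qed
  finally show ?thesis using kl_coefficient_sum[of i d M] by (cases "2 * i < d") (simp_all del: fact_Suc of_nat_Suc)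
qed

section \<open>Operations preserving negative-rootedness\<close>

text \<open>Quantifying over all complex zeros also excludes the zero polynomial. The version that
  admits a zero at the origin is needed for \<open>exp_dual\<close>, which acquires one when its
  index exceeds the degree.\<close>

definition nonpos_rooted :: "complex poly \<Rightarrow> bool" where
  "nonpos_rooted p \<longleftrightarrow> (\<forall>z. poly p z = 0 \<longrightarrow> z \<in> \<real> \<and> Re z \<le> 0)"

definition neg_rooted :: "complex poly \<Rightarrow> bool" where
  "neg_rooted p \<longleftrightarrow> (\<forall>z. poly p z = 0 \<longrightarrow> z \<in> \<real> \<and> Re z < 0)"

lemma nonpos_rooted_nonzero: "nonpos_rooted p \<Longrightarrow> p \<noteq> 0"
  unfolding nonpos_rooted_def by (metis complex_Re_numeral not_numeral_le_zero poly_0)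

lemma neg_rooted_imp_nonpos_rooted: "neg_rooted p \<Longrightarrow> nonpos_rooted p"
  by (auto simp: neg_rooted_def nonpos_rooted_def intro: less_imp_le)

lemma neg_rooted_nonzero: "neg_rooted p \<Longrightarrow> p \<noteq> 0"
  using neg_rooted_imp_nonpos_rooted nonpos_rooted_nonzero by blast

lemma nonpos_rooted_decompose:
  assumes "nonpos_rooted p"
  obtains c and r :: "nat \<Rightarrow> real" where "c \<noteq> 0" "\<And>i. i < degree p \<Longrightarrow> r i \<ge> 0"
    "p = smult c (\<Prod>i<degree p. [:of_real (r i), 1:])"
proof -
  have "\<exists>c r. c \<noteq> 0 \<and> (\<forall>i<degree p. r i \<ge> (0::real)) \<and>
      p = smult c (\<Prod>i<degree p. [:of_real (r i), 1:])"
    using assms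
  proof (induction "degree p" arbitrary: p)
    case 0
    then obtain c where "p = [:c:]" by (metis degree_eq_zeroE)
    with nonpos_rooted_nonzero[OF 0(2)] show ?case by (intro exI[of _ c]) auto
  next
    case (Suc n)
    have "\<not> constant (poly p)" using Suc(2) by (simp add: constant_degree)
    then obtain z where z: "poly p z = 0" using fundamental_theorem_of_algebra by blast
    with Suc.prems have zr: "z = of_real (Re z)" "Re z \<le> 0"
      unfolding nonpos_rooted_def by (auto simp: complex_is_Real_iff complex_eq_iff)
    obtain q where q: "p = [:-z, 1:] * q" using z by (auto simp: poly_eq_0_iff_dvd elim: dvdE)
    have q0: "q \<noteq> 0" using nonpos_rooted_nonzero[OF Suc.prems] q by auto
    have dq: "degree q = n" using Suc(2) degree_mult_eq[of "[:-z, 1:]" q] q0 unfolding q by simp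
    have "nonpos_rooted q" using Suc.prems unfolding nonpos_rooted_def q by auto
    then obtain c r where c: "c \<noteq> 0" "\<forall>i<n. r i \<ge> (0::real)"
        "q = smult c (\<Prod>i<n. [:of_real (r i), 1:])"
      using Suc(1)[of q] dq by auto
    show ?case
    proof (intro exI[of _ c] exI[of _ "r(n := - Re z)"] conjI)
      have "(\<Prod>i<Suc n. [:complex_of_real ((r(n := - Re z)) i), 1:]) =
          (\<Prod>i<n. [:of_real (r i), 1:]) * [:-z, 1:]"
        using arg_cong[OF zr(1), of uminus] by simp
      then show "p = smult c (\<Prod>i<degree p. [:of_real ((r(n := - Re z)) i), 1:])"
        using q c(3) Suc(2) by (simp add: mult.commute)
    qed (use c Suc(2) zr in \<open>auto simp: less_Suc_eq\<close>)
  qed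
  then show thesis using that by blast
qed

lemma neg_rooted_decompose:
  assumes "neg_rooted p"
  obtains c and r :: "nat \<Rightarrow> real" where "c \<noteq> 0" "\<And>i. i < degree p \<Longrightarrow> r i > 0"
    "p = smult c (\<Prod>i<degree p. [:of_real (r i), 1:])"
proof -
  obtain c and r :: "nat \<Rightarrow> real" where c: "c \<noteq> 0"
    and p: "p = smult c (\<Prod>i<degree p. [:of_real (r i), 1:])"
    using nonpos_rooted_decompose[OF neg_rooted_imp_nonpos_rooted[OF assms]] by metis
  have "r i > 0" if "i < degree p" for i
  proof -
    have "poly p (- of_real (r i)) = 0"
      by (subst p) (use that in \<open>auto simp: poly_prod\<close>)
    then show ?thesis using assms by (force simp: neg_rooted_def)
  qed
  then show thesis using c p that by blast
qed

definition euler_op :: "complex poly \<Rightarrow> complex poly" where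
  "euler_op p = pCons 0 (pderiv p)"

lemma coeff_euler_op [simp]: "coeff (euler_op p) i = of_nat i * coeff p i"
  by (cases i) (auto simp: euler_op_def coeff_pderiv)

lemma euler_op_smult: "euler_op (smult c p) = smult c (euler_op p)"
  by (simp add: euler_op_def pderiv_smult)

lemma euler_op_add: "euler_op (p + q) = euler_op p + euler_op q"
  by (simp add: euler_op_def pderiv_add)

text \<open>For the Euler operator \<open>z * d/dz\<close> the logarithmic derivative of
  \<open>z + r\<close> is \<open>u = z / (z + r)\<close>, and applying the operator to
  \<open>u\<close> gives \<open>u * (1 - u)\<close>.\<close>

lemma euler_op_prod:
  fixes r :: "nat \<Rightarrow> real" and z :: complex
  assumes "\<And>i. i < n \<Longrightarrow> z + of_real (r i) \<noteq> 0"
  defines "p \<equiv> (\<Prod>i<n. [:of_real (r i), 1:])" and "u \<equiv> (\<lambda>i. z / (z + of_real (r i)))"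
  shows "poly (euler_op p) z = poly p z * (\<Sum>i<n. u i)"
    and "poly (euler_op (euler_op p)) z =
      poly p z * ((\<Sum>i<n. u i)\<^sup>2 + (\<Sum>i<n. u i * (1 - u i)))"
proof -
  define P where "P n = (\<Prod>i<n. [:complex_of_real (r i), 1:])" for n
  have "poly (euler_op (P n)) z = poly (P n) z * (\<Sum>i<n. u i) \<and>
    poly (euler_op (euler_op (P n))) z =
      poly (P n) z * ((\<Sum>i<n. u i)\<^sup>2 + (\<Sum>i<n. u i * (1 - u i)))"
    using assms(1)
  proof (induction n)
    case 0
    then show ?case by (simp add: P_def euler_op_def)
  next
    case (Suc n)
    define w where "w = z + of_real (r n)"
    have w: "w \<noteq> 0" using Suc.prems[of n] by (simp add: w_def)
    have uz: "z = w * u n" using w by (simp add: u_def w_def)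
    then have uzP: "z * poly (P n) z = w * u n * poly (P n) z" by simp
    have IH1: "poly (euler_op (P n)) z = poly (P n) z * (\<Sum>i<n. u i)"
      and IH2: "poly (euler_op (euler_op (P n))) z =
      poly (P n) z * ((\<Sum>i<n. u i)\<^sup>2 + (\<Sum>i<n. u i * (1 - u i)))" using Suc by auto
    have PS: "P (Suc n) = [:of_real (r n), 1:] * P n" by (simp add: P_def mult.commute)
    have l: "poly [:of_real (r n), 1:] z = w" by (simp add: w_def)
    have e1: "euler_op (P (Suc n)) = [:of_real (r n), 1:] * euler_op (P n) + [:0, 1:] * P n"
      unfolding PS euler_op_def by (simp add: pderiv_mult pderiv_pCons pderiv_add pderiv_smult algebra_simps)
    have e2: "euler_op (euler_op (P (Suc n))) =
        [:of_real (r n), 1:] * euler_op (euler_op (P n)) + [:0, 1:] * (P n + 2 * euler_op (P n))"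
      unfolding e1 euler_op_add
      unfolding euler_op_def by (simp add: pderiv_mult pderiv_pCons pderiv_add pderiv_smult algebra_simps)
    have 1: "poly (euler_op (P (Suc n))) z = poly (P (Suc n)) z * (\<Sum>i<Suc n. u i)"
    proof -
      have "poly (euler_op (P (Suc n))) z = w * (poly (P n) z * (\<Sum>i<n. u i)) + z * poly (P n) z"
        unfolding e1 poly_add poly_mult l IH1 by simp
      also have "\<dots> = w * poly (P n) z * (\<Sum>i<Suc n. u i)"
        using uzP by (simp add: algebra_simps)
      finally show ?thesis unfolding PS poly_mult l .
    qed
    have "poly (euler_op (euler_op (P (Suc n)))) z =
        w * poly (P n) z * ((\<Sum>i<n. u i)\<^sup>2 + (\<Sum>i<n. u i * (1 - u i))) +
        z * (poly (P n) z + 2 * (poly (P n) z * (\<Sum>i<n. u i)))"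
      unfolding e2 poly_add poly_mult l IH1 IH2 by simp
    also have "\<dots> = w * poly (P n) z * ((\<Sum>i<Suc n. u i)\<^sup>2 + (\<Sum>i<Suc n. u i * (1 - u i)))"
    proof -
      have "z * (poly (P n) z + 2 * (poly (P n) z * (\<Sum>i<n. u i))) =
          (z * poly (P n) z) * (1 + 2 * (\<Sum>i<n. u i))" by (simp add: algebra_simps)
      then show ?thesis unfolding uzP by (simp add: algebra_simps power2_eq_square)
    qed
    also have "w * poly (P n) z = poly (P (Suc n)) z" unfolding PS poly_mult l ..
    finally show ?case using 1 by blast
  qed
  then show "poly (euler_op p) z = poly p z * (\<Sum>i<n. u i)"
    "poly (euler_op (euler_op p)) z =
      poly p z * ((\<Sum>i<n. u i)\<^sup>2 + (\<Sum>i<n. u i * (1 - u i)))" by (simp_all add: P_def p_def)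
qed

text \<open>For \<open>r > 0\<close> the map from \<open>z\<close> to \<open>z / (z + r)\<close>
  preserves both half planes and sends nonnegative reals into \<open>[0, 1]\<close>. Claims about
  zeros off the negative axis thereby become claims about the points \<open>u i\<close>.\<close>

lemma neg_rooted_euler_op:
  assumes "neg_rooted p" "\<not> (z \<in> \<real> \<and> Re z < 0)"
  obtains u :: "nat \<Rightarrow> complex" where "poly p z \<noteq> 0"
    "poly (euler_op p) z = poly p z * (\<Sum>i<degree p. u i)"
    "poly (euler_op (euler_op p)) z =
      poly p z * ((\<Sum>i<degree p. u i)\<^sup>2 + (\<Sum>i<degree p. u i * (1 - u i)))"
    "Im z > 0 \<longrightarrow> (\<forall>i<degree p. Im (u i) > 0)"
    "Im z < 0 \<longrightarrow> (\<forall>i<degree p. Im (u i) < 0)"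
    "Im z = 0 \<longrightarrow> (\<forall>i<degree p. u i \<in> \<real> \<and> 0 \<le> Re (u i) \<and> Re (u i) \<le> 1)"
proof -
  obtain c and r :: "nat \<Rightarrow> real" where c: "c \<noteq> 0" and r: "\<And>i. i < degree p \<Longrightarrow> r i > 0"
    and p: "p = smult c (\<Prod>i<degree p. [:of_real (r i), 1:])"
    using neg_rooted_decompose[OF assms(1)] by metis
  have nz: "z + of_real (r i) \<noteq> 0" if "i < degree p" for i
  proof
    assume "z + of_real (r i) = 0"
    then have "z = of_real (- r i)" by (simp add: add_eq_0_iff2)
    with assms(2) r[OF that] show False by auto
  qed
  define u where "u i = z / (z + of_real (r i))" for i
  note E = euler_op_prod[of "degree p" z r, OF nz, folded u_def]
  have Imu: "Im (u i) = Im z * r i / (cmod (z + of_real (r i)))\<^sup>2" for i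
    unfolding u_def by (simp add: Im_divide cmod_power2 field_simps)
  have pos: "(cmod (z + of_real (r i)))\<^sup>2 > 0" if "i < degree p" for i using nz[OF that] by simp
  show thesis
  proof (rule that[of u])
    show "poly p z \<noteq> 0" using assms by (auto simp: neg_rooted_def)
    show "poly (euler_op p) z = poly p z * (\<Sum>i<degree p. u i)"
      using E(1) by (subst (1 2) p) (simp add: euler_op_smult)
    show "poly (euler_op (euler_op p)) z =
      poly p z * ((\<Sum>i<degree p. u i)\<^sup>2 + (\<Sum>i<degree p. u i * (1 - u i)))"
      using E(2) by (subst (1 2) p) (simp add: euler_op_smult)
    show "Im z > 0 \<longrightarrow> (\<forall>i<degree p. Im (u i) > 0)" using Imu pos r by simp
    show "Im z < 0 \<longrightarrow> (\<forall>i<degree p. Im (u i) < 0)" using Imu pos r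
      by (simp add: divide_neg_pos mult_neg_pos)
    show "Im z = 0 \<longrightarrow> (\<forall>i<degree p. u i \<in> \<real> \<and> 0 \<le> Re (u i) \<and> Re (u i) \<le> 1)"
    proof (intro allI impI)
    fix i assume z: "Im z = 0" and i: "i < degree p"
    from z have zr: "z = of_real (Re z)" "Re z \<ge> 0" using assms(2)
      by (auto simp: complex_is_Real_iff complex_eq_iff)
    have "u i = of_real (Re z / (Re z + r i))" unfolding u_def by (subst (1 2) zr(1)) simp
    then show "u i \<in> \<real> \<and> 0 \<le> Re (u i) \<and> Re (u i) \<le> 1"
      using zr(2) r[OF i] by (auto simp: field_simps)
    qed
  qed
qed

text \<open>A zero off the negative axis would make the \<open>u i\<close> sum to \<open>c\<close>.
  Imaginary parts of one sign rule out nonreal zeros, and on the nonnegative axis the sum lies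
  between 0 and the degree.\<close>

lemma neg_rooted_linear_multiplier:
  assumes "neg_rooted p" "c < 0 \<or> c > real (degree p)"
  shows "neg_rooted (euler_op p - smult (of_real c) p)"
  unfolding neg_rooted_def
proof (intro allI impI, rule ccontr)
  fix z assume 0: "poly (euler_op p - smult (of_real c) p) z = 0" and z: "\<not> (z \<in> \<real> \<and> Re z < 0)"
  obtain u where u: "poly p z \<noteq> 0" "poly (euler_op p) z = poly p z * (\<Sum>i<degree p. u i)"
    "poly (euler_op (euler_op p)) z =
      poly p z * ((\<Sum>i<degree p. u i)\<^sup>2 + (\<Sum>i<degree p. u i * (1 - u i)))"
    and up: "Im z > 0 \<longrightarrow> (\<forall>i<degree p. Im (u i) > 0)"
    and un: "Im z < 0 \<longrightarrow> (\<forall>i<degree p. Im (u i) < 0)"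
    and u0: "Im z = 0 \<longrightarrow> (\<forall>i<degree p. u i \<in> \<real> \<and> 0 \<le> Re (u i) \<and> Re (u i) \<le> 1)"
    by (rule neg_rooted_euler_op[OF assms(1) z])
  have "poly p z * ((\<Sum>i<degree p. u i) - of_real c) = 0"
    using 0 unfolding poly_diff poly_smult u(2) by (simp add: algebra_simps)
  then have S: "(\<Sum>i<degree p. u i) = of_real c" using u(1) by simp
  have R: "(\<Sum>i<degree p. Re (u i)) = c" using arg_cong[OF S, of Re] by simp
  have I: "(\<Sum>i<degree p. Im (u i)) = 0" using arg_cong[OF S, of Im] by simp
  have d: "degree p > 0" using R assms(2) by (cases "degree p = 0") auto
  consider "Im z > 0" | "Im z < 0" | "Im z = 0" by linarith
  then show False
  proof cases
    case 1
    have "(\<Sum>i<degree p. Im (u i)) > 0" using d up 1 by (intro sum_pos) auto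
    then show False using I by simp
  next
    case 2
    have "(\<Sum>i<degree p. - Im (u i)) > 0" using d un 2 by (intro sum_pos) auto
    then show False using I by (simp add: sum_negf)
  next
    case 3
    have "(\<Sum>i<degree p. Re (u i)) \<le> (\<Sum>i<degree p. 1)" using u0 3 by (intro sum_mono) auto
    moreover have "(\<Sum>i<degree p. Re (u i)) \<ge> 0" using u0 3 by (intro sum_nonneg) auto
    ultimately show False using R assms(2) by simp
  qed
qed

text \<open>The quadratic form \<open>(\<Sum>v)\<^sup>2 - \<Sum>v\<^sup>2\<close> is Lorentzian, so it takes no nonnegative real
  value when all imaginary parts are positive; the linear term is removed by a real shift.\<close>

lemma quadratic_multiplier_nonzero_aux:
  fixes u :: "nat \<Rightarrow> complex" and a b :: real
  assumes n: "n \<ge> 2" and im: "\<And>i. i < n \<Longrightarrow> Im (u i) > 0"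
    and ab: "4 * (real n - 1) * b\<^sup>2 \<le> 4 * a * (a - real n) + real n"
  shows "((\<Sum>i<n. u i) - of_real a)\<^sup>2 + of_real (b\<^sup>2) + (\<Sum>i<n. u i * (1 - u i)) \<noteq> 0"
proof
  assume 0: "((\<Sum>i<n. u i) - of_real a)\<^sup>2 + of_real (b\<^sup>2) + (\<Sum>i<n. u i * (1 - u i)) = 0"
  \<comment> \<open>With \<open>2 * s * (n - 1) = 2 * a - 1\<close> the terms linear in
    \<open>A\<close> and in \<open>B\<close> disappear from the real and the imaginary part.\<close>
  define s where "s = (2 * a - 1) / (2 * (real n - 1))"
  have s: "2 * s * (real n - 1) = 2 * a - 1" using n by (simp add: s_def divide_simps) (simp add: algebra_simps)
  define \<alpha> where "\<alpha> i = Re (u i) - s" for i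
  define \<beta> where "\<beta> i = Im (u i)" for i
  define A where "A = (\<Sum>i<n. \<alpha> i)"
  define B where "B = (\<Sum>i<n. \<beta> i)"
  \<comment> \<open>The constant left after the shift; the hypothesis \<open>ab\<close> is exactly
    \<open>4 * (n - 1) * C \<le> 0\<close>.\<close>
  define C where "C = (real n * s - a)\<^sup>2 + b\<^sup>2 + real n * s - real n * s\<^sup>2"
  have SR: "(\<Sum>i<n. Re (u i)) = A + real n * s" by (simp add: A_def \<alpha>_def sum_subtractf)
  have SI: "(\<Sum>i<n. Im (u i)) = B" by (simp add: B_def \<beta>_def)
  have "(\<Sum>i<n. Im (u i * (1 - u i))) = (\<Sum>i<n. \<beta> i * (1 - 2 * s) - 2 * (\<alpha> i * \<beta> i))"
    by (intro sum.cong) (auto simp: \<alpha>_def \<beta>_def algebra_simps)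
  also have "\<dots> = B * (1 - 2 * s) - 2 * (\<Sum>i<n. \<alpha> i * \<beta> i)"
    by (simp add: sum_subtractf B_def sum_distrib_left sum_distrib_right)
  finally have SI2: "(\<Sum>i<n. Im (u i * (1 - u i))) = B * (1 - 2 * s) - 2 * (\<Sum>i<n. \<alpha> i * \<beta> i)" .
  have "(\<Sum>i<n. Re (u i * (1 - u i))) =
     (\<Sum>i<n. \<alpha> i * (1 - 2 * s) + (s - s\<^sup>2) - (\<alpha> i)\<^sup>2 + (\<beta> i)\<^sup>2)"
    by (intro sum.cong) (auto simp: \<alpha>_def \<beta>_def algebra_simps power2_eq_square)
  also have "\<dots> = A * (1 - 2 * s) + real n * (s - s\<^sup>2) - (\<Sum>i<n. (\<alpha> i)\<^sup>2) + (\<Sum>i<n. (\<beta> i)\<^sup>2)"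
    by (simp add: sum_subtractf sum.distrib A_def sum_distrib_right)
  finally have SR2: "(\<Sum>i<n. Re (u i * (1 - u i))) =
      A * (1 - 2 * s) + real n * (s - s\<^sup>2) - (\<Sum>i<n. (\<alpha> i)\<^sup>2) + (\<Sum>i<n. (\<beta> i)\<^sup>2)" .
  have "2 * (A + real n * s - a) * B + (B * (1 - 2 * s) - 2 * (\<Sum>i<n. \<alpha> i * \<beta> i)) = 0"
    using arg_cong[OF 0, of Im] SR SI SI2 by (simp add: power2_eq_square Im_sum algebra_simps)
  moreover have "2 * (A + real n * s - a) * B + (B * (1 - 2 * s) - 2 * (\<Sum>i<n. \<alpha> i * \<beta> i)) =
      2 * (A * B - (\<Sum>i<n. \<alpha> i * \<beta> i)) + B * (2 * s * (real n - 1) - (2 * a - 1))"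
    by (simp add: algebra_simps)
  ultimately have AB: "A * B = (\<Sum>i<n. \<alpha> i * \<beta> i)" using s by simp
  have "(A + real n * s - a)\<^sup>2 - B\<^sup>2 + b\<^sup>2 + (A * (1 - 2 * s) + real n * (s - s\<^sup>2) -
      (\<Sum>i<n. (\<alpha> i)\<^sup>2) + (\<Sum>i<n. (\<beta> i)\<^sup>2)) = 0"
    using arg_cong[OF 0, of Re] SR SI SR2 by (simp add: power2_eq_square Re_sum algebra_simps)
  moreover have "(A + real n * s - a)\<^sup>2 - B\<^sup>2 + b\<^sup>2 + (A * (1 - 2 * s) + real n * (s - s\<^sup>2) -
      (\<Sum>i<n. (\<alpha> i)\<^sup>2) + (\<Sum>i<n. (\<beta> i)\<^sup>2)) =
     A\<^sup>2 - (\<Sum>i<n. (\<alpha> i)\<^sup>2) - (B\<^sup>2 - (\<Sum>i<n. (\<beta> i)\<^sup>2)) + C + A * (2 * s * (real n - 1) - (2 * a - 1))"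
    unfolding C_def by (simp add: algebra_simps power2_eq_square)
  ultimately have E: "A\<^sup>2 - (\<Sum>i<n. (\<alpha> i)\<^sup>2) = (B\<^sup>2 - (\<Sum>i<n. (\<beta> i)\<^sup>2)) - C" using s by simp
  have as: "a = s * (real n - 1) + 1 / 2" using s by simp
  have "4 * (real n - 1) * C = 4 * (real n - 1) * b\<^sup>2 - (4 * a * (a - real n) + real n)"
    unfolding C_def as by (simp add: algebra_simps power2_eq_square)
  also have "\<dots> \<le> 0" using ab by linarith
  finally have C: "C \<le> 0" using n by (simp add: mult_le_0_iff)
  \<comment> \<open>Positive entries make the vector of imaginary parts timelike,
    \<open>C \<le> 0\<close> makes the shifted real parts timelike too, and the vanishing imaginary
    part makes the two orthogonal. This contradicts the reversed Cauchy-Schwarz inequality.\<close>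
  have "(\<Sum>i<n. (\<beta> i)\<^sup>2) < (\<Sum>i<n. \<beta> i * B)"
  proof (rule sum_strict_mono)
    fix i assume "i \<in> {..<n}"
    then have i: "i < n" by simp
    obtain k where k: "k < n" "k \<noteq> i" using n that[of 0] that[of 1] i by (cases "i = 0") auto
    have "sum \<beta> {i, k} \<le> B" unfolding B_def using i k im
      by (intro sum_mono2) (auto simp: \<beta>_def intro: less_imp_le)
    then have "\<beta> i + \<beta> k \<le> B" using k by simp
    moreover have "\<beta> k > 0" "\<beta> i > 0" using im k i by (simp_all add: \<beta>_def)
    ultimately have "\<beta> i * \<beta> i < \<beta> i * B" by (intro mult_strict_left_mono) auto
    then show "(\<beta> i)\<^sup>2 < \<beta> i * B" by (simp add: power2_eq_square)
  qed (use n in \<open>auto simp: lessThan_empty_iff\<close>)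
  also have "\<dots> = B\<^sup>2" by (simp add: B_def power2_eq_square sum_distrib_right)
  finally have B: "(\<Sum>i<n. (\<beta> i)\<^sup>2) < B\<^sup>2" .
  then have A: "(\<Sum>i<n. (\<alpha> i)\<^sup>2) < A\<^sup>2" using E C by linarith
  have "(\<Sum>i<n. (\<alpha> i)\<^sup>2) * (\<Sum>i<n. (\<beta> i)\<^sup>2) < A\<^sup>2 * B\<^sup>2"
    using A B by (intro mult_strict_mono') (auto intro: sum_nonneg)
  also have "\<dots> = (\<Sum>i<n. \<alpha> i * \<beta> i)\<^sup>2" unfolding AB[symmetric] by (simp add: power_mult_distrib)
  finally show False using Cauchy_Schwarz_ineq_sum[of \<alpha> \<beta> "{..<n}"] by simp
qed

text \<open>The simpler bounds give the previous inequality through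
  \<open>(n - 1) * b\<^sup>2 \<le> (n - 1) * a \<le> (a - n) * a\<close>. The quadratic form
  degenerates for \<open>n \<le> 1\<close>, treated by hand; the lower half plane follows by
  conjugation.\<close>

lemma quadratic_multiplier_nonzero:
  fixes u :: "nat \<Rightarrow> complex" and a b :: real
  assumes im: "(\<forall>i<n. Im (u i) > 0) \<or> (\<forall>i<n. Im (u i) < 0)"
    and a: "a \<ge> 2 * real n - 1" and b: "b \<noteq> 0" "b\<^sup>2 \<le> a"
  shows "((\<Sum>i<n. u i) - of_real a)\<^sup>2 + of_real (b\<^sup>2) + (\<Sum>i<n. u i * (1 - u i)) \<noteq> 0"
proof -
  have a0: "a > 0" using b by (metis less_le_trans zero_less_power2)
  consider "n = 0" | "n = 1" | "n \<ge> 2" by linarith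
  then show ?thesis
  proof cases
    case 1
    have "a\<^sup>2 + b\<^sup>2 \<noteq> 0" using b by simp
    then have "complex_of_real (a\<^sup>2 + b\<^sup>2) \<noteq> 0" by (metis of_real_eq_0_iff)
    with 1 show ?thesis by simp
  next
    case 2
    have "Im ((u 0 - of_real a)\<^sup>2 + of_real (b\<^sup>2) + u 0 * (1 - u 0)) = (1 - 2 * a) * Im (u 0)"
      by (simp add: power2_eq_square algebra_simps)
    moreover have "\<dots> \<noteq> 0" using a im 2 by auto
    ultimately show ?thesis using 2 by (metis (no_types, lifting) One_nat_def lessThan_0 lessThan_Suc
      sum.empty sum.insert finite.emptyI empty_iff add_0_right zero_complex.sel(2))
  next
    case 3
    have "(real n - 1) * b\<^sup>2 \<le> (real n - 1) * a" using 3 b by (intro mult_left_mono) auto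
    also have "\<dots> \<le> (a - real n) * a" using a a0 by (intro mult_right_mono) auto
    finally have ab: "4 * (real n - 1) * b\<^sup>2 \<le> 4 * a * (a - real n) + real n"
      by (simp add: algebra_simps)
    show ?thesis
    proof (cases "\<forall>i<n. Im (u i) > 0")
      case True
      then show ?thesis using 3 ab by (intro quadratic_multiplier_nonzero_aux) auto
    next
      case False
      then have "((\<Sum>i<n. cnj (u i)) - of_real a)\<^sup>2 + of_real (b\<^sup>2) +
          (\<Sum>i<n. cnj (u i) * (1 - cnj (u i))) \<noteq> 0"
        using im 3 ab by (intro quadratic_multiplier_nonzero_aux) auto
      then have "cnj (((\<Sum>i<n. u i) - of_real a)\<^sup>2 + of_real (b\<^sup>2) + (\<Sum>i<n. u i * (1 - u i))) \<noteq> 0"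
        by simp
      then show ?thesis by (metis complex_cnj_zero)
    qed
  qed
qed

text \<open>The operator is the product of \<open>euler_op - w\<close> and
  \<open>euler_op - cnj w\<close>. At a nonnegative real point the resulting expression is a sum of
  nonnegative terms, one of which is \<open>(Im w)\<^sup>2 > 0\<close>.\<close>

lemma neg_rooted_quadratic_multiplier:
  assumes "neg_rooted p" "w \<notin> \<real>" "Re w \<ge> 2 * real (degree p) - 1" "(Im w)\<^sup>2 \<le> Re w"
  shows "neg_rooted (euler_op (euler_op p) - smult (w + cnj w) (euler_op p) + smult (w * cnj w) p)"
  unfolding neg_rooted_def
proof (intro allI impI, rule ccontr)
  fix z assume 0: "poly (euler_op (euler_op p) - smult (w + cnj w) (euler_op p) + smult (w * cnj w) p) z = 0"
    and z: "\<not> (z \<in> \<real> \<and> Re z < 0)"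
  obtain u where u: "poly p z \<noteq> 0" "poly (euler_op p) z = poly p z * (\<Sum>i<degree p. u i)"
    "poly (euler_op (euler_op p)) z =
      poly p z * ((\<Sum>i<degree p. u i)\<^sup>2 + (\<Sum>i<degree p. u i * (1 - u i)))"
    and up: "Im z > 0 \<longrightarrow> (\<forall>i<degree p. Im (u i) > 0)"
    and un: "Im z < 0 \<longrightarrow> (\<forall>i<degree p. Im (u i) < 0)"
    and u0: "Im z = 0 \<longrightarrow> (\<forall>i<degree p. u i \<in> \<real> \<and> 0 \<le> Re (u i) \<and> Re (u i) \<le> 1)"
    by (rule neg_rooted_euler_op[OF assms(1) z])
  define S where "S = (\<Sum>i<degree p. u i)"
  define U where "U = (\<Sum>i<degree p. u i * (1 - u i))"
  have w: "w + cnj w = of_real (2 * Re w)" "w * cnj w = of_real ((Re w)\<^sup>2 + (Im w)\<^sup>2)"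
    by (simp_all add: complex_eq_iff power2_eq_square)
  have b: "Im w \<noteq> 0" using assms(2) by (simp add: complex_is_Real_iff)
  have "poly p z * ((S - of_real (Re w))\<^sup>2 + of_real ((Im w)\<^sup>2) + U) = 0"
  proof -
    have "poly p z * (S\<^sup>2 + U) - of_real (2 * Re w) * (poly p z * S) +
        of_real ((Re w)\<^sup>2 + (Im w)\<^sup>2) * poly p z = 0"
      using 0 unfolding poly_add poly_diff poly_smult w u(2,3) S_def U_def .
    then show ?thesis by (simp add: algebra_simps power2_eq_square)
  qed
  then have F: "(S - of_real (Re w))\<^sup>2 + of_real ((Im w)\<^sup>2) + U = 0" using u(1) by simp
  show False
  proof (cases "Im z = 0")
    case False
    then have "(\<forall>i<degree p. Im (u i) > 0) \<or> (\<forall>i<degree p. Im (u i) < 0)"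
      using up un by (cases "Im z > 0") auto
    from quadratic_multiplier_nonzero[OF this assms(3) b assms(4)] F
    show False unfolding S_def U_def by blast
  next
    case True
    have ur: "u i = of_real (Re (u i))" "0 \<le> Re (u i)" "Re (u i) \<le> 1" if "i < degree p" for i
      using u0 that True by (auto simp: complex_is_Real_iff complex_eq_iff)
    have S: "S = of_real (\<Sum>i<degree p. Re (u i))" unfolding S_def of_real_sum
      by (intro sum.cong refl ur(1)) simp
    have U: "U = of_real (\<Sum>i<degree p. Re (u i) * (1 - Re (u i)))" unfolding U_def of_real_sum
    proof (intro sum.cong refl)
      fix i assume "i \<in> {..<degree p}"
      then have "u i = of_real (Re (u i))" by (intro ur(1)) simp
      then show "u i * (1 - u i) = of_real (Re (u i) * (1 - Re (u i)))"
        by (metis of_real_1 of_real_diff of_real_mult)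
    qed
    have "0 \<le> (\<Sum>i<degree p. Re (u i) * (1 - Re (u i)))"
      using ur by (intro sum_nonneg) auto
    moreover have "of_real (((\<Sum>i<degree p. Re (u i)) - Re w)\<^sup>2 + (Im w)\<^sup>2 +
        (\<Sum>i<degree p. Re (u i) * (1 - Re (u i)))) = (0::complex)"
      using F unfolding S U by (simp only: of_real_add of_real_diff of_real_power)
    then have "((\<Sum>i<degree p. Re (u i)) - Re w)\<^sup>2 + (Im w)\<^sup>2 +
        (\<Sum>i<degree p. Re (u i) * (1 - Re (u i))) = 0" by (metis of_real_eq_0_iff)
    ultimately show False using b
      by (smt (verit, best) power2_less_eq_zero_iff zero_le_power2)
  qed
qed

definition diag_poly :: "(nat \<Rightarrow> complex) \<Rightarrow> complex poly \<Rightarrow> complex poly" where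
  "diag_poly b p = (\<Sum>i\<le>degree p. monom (b i * coeff p i) i)"

lemma coeff_diag_poly [simp]: "coeff (diag_poly b p) i = b i * coeff p i"
  by (auto simp: diag_poly_def coeff_sum coeff_eq_0)

lemma degree_diag_poly_le: "degree (diag_poly b p) \<le> degree p"
  by (rule degree_le) (simp add: coeff_eq_0)

text \<open>Each step moves one real root or one conjugate pair of \<open>q\<close> into an operator
  on \<open>p\<close>. The quotient must again have real coefficients for the pairing to continue,
  and \<open>n\<close> bounds the degree of every intermediate polynomial.\<close>

lemma neg_rooted_diag_poly:
  fixes q :: "complex poly"
  assumes "q \<noteq> 0" "\<And>i. coeff q i \<in> \<real>"
    and roots: "\<And>w. poly q w = 0 \<Longrightarrow> w \<in> \<real> \<Longrightarrow> Re w < 0 \<or> Re w > real n"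
      "\<And>w. poly q w = 0 \<Longrightarrow> w \<notin> \<real> \<Longrightarrow> Re w \<ge> 2 * real n - 1 \<and> (Im w)\<^sup>2 \<le> Re w"
    and "neg_rooted p" "degree p \<le> n"
  shows "neg_rooted (diag_poly (\<lambda>i. poly q (of_nat i)) p)"
  using assms
proof (induction "degree q" arbitrary: q p rule: less_induct)
  case less
  show ?case
  proof (cases "degree q = 0")
    case True
    then obtain c where c: "q = [:c:]" by (metis degree_eq_zeroE)
    have "diag_poly (\<lambda>i. poly q (of_nat i)) p = smult c p" by (rule poly_eqI) (simp add: c)
    then show ?thesis using less.prems(1,5) c by (simp add: neg_rooted_def)
  next
    case False
    then obtain w where w: "poly q w = 0" using fundamental_theorem_of_algebra constant_degree by metis
    show ?thesis
    proof (cases "w \<in> \<real>")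
      case True
      then obtain x where x: "w = of_real x" by (auto elim: Reals_cases)
      obtain q' where q: "q = [:-w, 1:] * q'" using w by (auto simp: poly_eq_0_iff_dvd elim: dvdE)
      have q0: "q' \<noteq> 0" using less.prems(1) q by auto
      have dq: "degree q' < degree q" unfolding q using q0 by (subst degree_mult_eq) auto
      have dp: "degree (euler_op p - smult (of_real x) p) \<le> n"
        using less.prems(6) by (intro degree_le) (auto simp: coeff_eq_0)
      have "x < 0 \<or> real (degree p) < x" using less.prems(3)[OF w True] less.prems(6) x by auto
      then have nr: "neg_rooted (euler_op p - smult (of_real x) p)"
        by (intro neg_rooted_linear_multiplier less.prems)
      have "coeff q' i \<in> \<real>" for i
      proof -
        \<comment> \<open>Conjugation fixes \<open>q\<close> and the real factor; cancelling the
          factor shows that it fixes the quotient.\<close>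
        have cnj: "map_poly cnj q = q" using less.prems(2) by (intro poly_eqI) (simp add: coeff_map_poly Reals_cnj_iff)
        have "map_poly cnj ([:-w, 1:] * q') = [:-w, 1:] * map_poly cnj q'"
          using x by (intro poly_eqI) (simp add: coeff_map_poly coeff_pCons mult_pCons_left split: nat.split)
        then have "[:-w, 1:] * map_poly cnj q' = [:-w, 1:] * q'" using cnj q by simp
        then have "map_poly cnj q' = q'" by (simp del: mult_pCons_left)
        then have "cnj (coeff q' i) = coeff q' i" by (metis coeff_map_poly complex_cnj_zero)
        then show ?thesis by (simp add: Reals_cnj_iff)
      qed
      then have "neg_rooted (diag_poly (\<lambda>i. poly q' (of_nat i)) (euler_op p - smult (of_real x) p))"
        using less.prems(3,4) q by (intro less.hyps dq q0 nr dp) auto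
      also have "diag_poly (\<lambda>i. poly q' (of_nat i)) (euler_op p - smult (of_real x) p) =
          diag_poly (\<lambda>i. poly q (of_nat i)) p"
        by (rule poly_eqI) (simp add: q x algebra_simps)
      finally show ?thesis .
    next
      case False
      have cnj: "map_poly cnj q = q"
        using less.prems(2) by (intro poly_eqI) (simp add: coeff_map_poly Reals_cnj_iff)
      have "poly q (cnj w) = cnj (poly (map_poly cnj q) w)" by (simp add: cnj poly_cnj)
      then have "poly q (cnj w) = 0" using w cnj by simp
      obtain q1 where q1: "q = [:-w, 1:] * q1" using w by (auto simp: poly_eq_0_iff_dvd elim: dvdE)
      have "cnj w \<noteq> w" using False by (simp add: Reals_cnj_iff)
      then have "poly q1 (cnj w) = 0" using \<open>poly q (cnj w) = 0\<close> q1 by simp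
      then obtain q' where "q1 = [:-cnj w, 1:] * q'" by (auto simp: poly_eq_0_iff_dvd elim: dvdE)
      then have q: "q = [:w * cnj w, - (w + cnj w), 1:] * q'" using q1
        by (simp only: mult.assoc[symmetric]) (simp add: algebra_simps)
      define x where "x = Re w" define y where "y = (cmod w)\<^sup>2"
      have xy: "w * cnj w = of_real y" "w + cnj w = of_real (2 * x)"
        by (simp_all only: x_def y_def complex_norm_square complex_add_cnj)
      have q0: "q' \<noteq> 0" using less.prems(1) q by auto
      have dq: "degree q' < degree q" unfolding q using q0 by (subst degree_mult_eq) auto
      let ?p = "euler_op (euler_op p) - smult (w + cnj w) (euler_op p) + smult (w * cnj w) p"
      have dp: "degree ?p \<le> n"
        using less.prems(6) by (intro degree_le) (auto simp: coeff_eq_0)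
      have nr: "neg_rooted ?p" using less.prems(4)[OF w False] less.prems(6)
        by (intro neg_rooted_quadratic_multiplier less.prems(5) False) auto
      have "coeff q' i \<in> \<real>" for i
      proof -
        have "map_poly cnj ([:w * cnj w, - (w + cnj w), 1:] * q') =
            [:w * cnj w, - (w + cnj w), 1:] * map_poly cnj q'"
          unfolding xy
          by (intro poly_eqI) (simp add: coeff_map_poly coeff_pCons mult_pCons_left split: nat.split)
        then have "[:w * cnj w, - (w + cnj w), 1:] * map_poly cnj q' =
            [:w * cnj w, - (w + cnj w), 1:] * q'" using cnj q by simp
        then have "map_poly cnj q' = q'" by (simp del: mult_pCons_left)
        then have "cnj (coeff q' i) = coeff q' i" by (metis coeff_map_poly complex_cnj_zero)
        then show ?thesis by (simp add: Reals_cnj_iff)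
      qed
      then have "neg_rooted (diag_poly (\<lambda>i. poly q' (of_nat i)) ?p)"
        using less.prems(3,4) q by (intro less.hyps dq q0 nr dp) auto
      also have "diag_poly (\<lambda>i. poly q' (of_nat i)) ?p = diag_poly (\<lambda>i. poly q (of_nat i)) p"
        by (rule poly_eqI) (simp add: q algebra_simps)
      finally show ?thesis .
    qed
  qed
qed

section \<open>Reciprocal factorials as multipliers\<close>

lemma poly_eq_sum_coeff:
  fixes p :: "'a::comm_semiring_1 poly"
  assumes "degree p \<le> n" shows "poly p x = (\<Sum>i\<le>n. coeff p i * x ^ i)"
  using assms by (subst poly_altdef, intro sum.mono_neutral_left) (auto simp: coeff_eq_0)

text \<open>Up to scaling, \<open>exp_dual K f\<close> is \<open>f(D)\<close> applied to \<open>x\<^sup>K\<close>.\<close>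

definition exp_dual :: "nat \<Rightarrow> complex poly \<Rightarrow> complex poly" where
  "exp_dual K f = (\<Sum>j\<le>K. monom (coeff f (K - j) / fact j) j)"

lemma coeff_exp_dual: "coeff (exp_dual K f) j = (if j \<le> K then coeff f (K - j) / fact j else 0)"
  by (auto simp: exp_dual_def coeff_sum)

text \<open>With \<open>D\<close> for differentiation, a factor \<open>t + r\<close> of
  \<open>f\<close> acts as \<open>D + r\<close>, so the dual can be built one root at a
  time.\<close>

lemma exp_dual_linear_mult:
  "exp_dual K ([:r, 1:] * f) = smult r (exp_dual K f) + pderiv (exp_dual K f)"
proof (rule poly_eqI)
  fix j
  consider "j > K" | "j = K" | "j < K" by linarith
  then show "coeff (exp_dual K ([:r, 1:] * f)) j = coeff (smult r (exp_dual K f) + pderiv (exp_dual K f)) j"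
  proof cases
    case 3
    then obtain l where l: "K - j = Suc l" by (metis Suc_diff_Suc)
    then have "K - Suc j = l" by simp
    moreover have "(1 + of_nat j) * c / fact (Suc j) = (c / fact j :: complex)" for c
      using of_nat_neq_0[of j, where 'a = complex] by (simp add: fact_Suc)
    ultimately show ?thesis using 3 l
      by (simp add: coeff_exp_dual coeff_pderiv add_divide_distrib del: fact_Suc)
  qed (auto simp: coeff_exp_dual coeff_pderiv)
qed

text \<open>A zero outside the nonpositive axis would make the sum of the
  \<open>1 / (z + s i)\<close> equal to \<open>- r\<close>. Off the real axis the imaginary parts
  have one sign; for \<open>z > 0\<close> the sum is nonnegative.\<close>

lemma nonpos_rooted_deriv_add:
  assumes "nonpos_rooted g" "r > 0"
  shows "nonpos_rooted (smult (of_real r) g + pderiv g)"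
  unfolding nonpos_rooted_def
proof (intro allI impI, rule ccontr)
  fix z assume 0: "poly (smult (of_real r) g + pderiv g) z = 0" and z: "\<not> (z \<in> \<real> \<and> Re z \<le> 0)"
  obtain c and s :: "nat \<Rightarrow> real" where c: "c \<noteq> 0" and s: "\<And>i. i < degree g \<Longrightarrow> s i \<ge> 0"
    and g: "g = smult c (\<Prod>i<degree g. [:of_real (s i), 1:])"
    using nonpos_rooted_decompose[OF assms(1)] by metis
  have nz: "z + of_real (s i) \<noteq> 0" if "i < degree g" for i
  proof
    assume "z + of_real (s i) = 0"
    then have "z = of_real (- s i)" by (simp add: add_eq_0_iff2)
    with z s[OF that] show False by auto
  qed
  have z0: "z \<noteq> 0" using z by auto
  have gz: "poly g z \<noteq> 0" using assms z by (auto simp: nonpos_rooted_def)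
  define u where "u i = 1 / (z + of_real (s i))" for i
  have "poly (euler_op g) z = poly g z * (\<Sum>i<degree g. z / (z + of_real (s i)))"
    using euler_op_prod(1)[of "degree g" z s, OF nz] by (subst (1 2) g) (simp add: euler_op_smult)
  also have "(\<Sum>i<degree g. z / (z + of_real (s i))) = z * (\<Sum>i<degree g. u i)"
    by (simp add: u_def sum_distrib_left)
  finally have "poly (pderiv g) z = poly g z * (\<Sum>i<degree g. u i)"
    using z0 by (simp add: euler_op_def)
  then have "poly g z * (of_real r + (\<Sum>i<degree g. u i)) = 0" using 0 by (simp add: algebra_simps)
  then have S: "(\<Sum>i<degree g. u i) = - of_real r" using gz by (simp add: add_eq_0_iff)
  have R: "(\<Sum>i<degree g. Re (u i)) = - r" using arg_cong[OF S, of Re] by simp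
  have I: "(\<Sum>i<degree g. Im (u i)) = 0" using arg_cong[OF S, of Im] by simp
  have d: "{..<degree g} \<noteq> {}" using R assms(2) by auto
  have Imu: "Im (u i) = - Im z / (cmod (z + of_real (s i)))\<^sup>2" for i
    unfolding u_def by (simp add: Im_divide cmod_power2)
  have pos: "(cmod (z + of_real (s i)))\<^sup>2 > 0" if "i < degree g" for i using nz[OF that] by simp
  consider "Im z > 0" | "Im z < 0" | "Im z = 0" by linarith
  then show False
  proof cases
    case 1
    have "(\<Sum>i<degree g. - Im (u i)) > 0" using d 1 pos by (intro sum_pos) (auto simp: Imu)
    then show False using I by (simp add: sum_negf)
  next
    case 2
    have "(\<Sum>i<degree g. Im (u i)) > 0" using d 2 pos
      by (intro sum_pos) (auto simp: Imu divide_neg_pos)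
    then show False using I by simp
  next
    case 3
    then have zr: "z = of_real (Re z)" "Re z > 0" using z
      by (auto simp: complex_is_Real_iff complex_eq_iff)
    have "Re (u i) \<ge> 0" if "i < degree g" for i
    proof -
      have "u i = of_real (1 / (Re z + s i))" unfolding u_def by (subst zr(1)) simp
      then show ?thesis using zr(2) s[OF that] by simp
    qed
    then have "(\<Sum>i<degree g. Re (u i)) \<ge> 0" by (intro sum_nonneg) auto
    then show False using R assms(2) by simp
  qed
qed

lemma nonpos_rooted_exp_dual:
  assumes "neg_rooted f"
  shows "nonpos_rooted (exp_dual K f)"
proof -
  obtain c and r :: "nat \<Rightarrow> real" where c: "c \<noteq> 0" and r: "\<And>i. i < degree f \<Longrightarrow> r i > 0"
    and f: "f = smult c (\<Prod>i<degree f. [:of_real (r i), 1:])"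
    using neg_rooted_decompose[OF assms] by metis
  have "nonpos_rooted (exp_dual K (smult c (\<Prod>i<n. [:of_real (r i), 1:])))" if "n \<le> degree f" for n
    using that
  proof (induction n)
    case 0
    have "exp_dual K [:c:] = monom (c / fact K) K"
      by (rule poly_eqI) (auto simp: coeff_exp_dual coeff_pCons split: nat.split)
    then show ?case using c by (auto simp: nonpos_rooted_def poly_monom)
  next
    case (Suc n)
    have eq: "smult c (\<Prod>i<Suc n. [:of_real (r i), 1:]) =
        [:of_real (r n), 1:] * smult c (\<Prod>i<n. [:of_real (r i), 1:])" by (simp add: mult.commute)
    show ?case unfolding eq exp_dual_linear_mult
      using Suc r by (intro nonpos_rooted_deriv_add) auto
  qed
  from this[of "degree f"] show ?thesis using f by simp
qed

text \<open>The polynomial is \<open>z ^ K\<close> times \<open>exp_dual K f\<close> at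
  \<open>1 / z\<close>. A zero of the dual at the origin goes to infinity, so the inequality becomes
  strict.\<close>

lemma neg_rooted_div_fact_diff:
  assumes "neg_rooted f" "degree f \<le> K"
  shows "neg_rooted (diag_poly (\<lambda>i. 1 / fact (K - i)) f)"
  unfolding neg_rooted_def
proof (intro allI impI)
  fix z assume 0: "poly (diag_poly (\<lambda>i. 1 / fact (K - i)) f) z = 0"
  have "poly f 0 \<noteq> 0" using assms(1) by (auto simp: neg_rooted_def)
  then have z: "z \<noteq> 0" using 0 by (auto simp: poly_0_coeff_0)
  have "poly (diag_poly (\<lambda>i. 1 / fact (K - i)) f) z = (\<Sum>i\<le>K. 1 / fact (K - i) * coeff f i * z ^ i)"
    using assms(2) degree_diag_poly_le[of _ f] by (subst poly_eq_sum_coeff[of _ K]) (auto intro: order_trans)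
  also have "\<dots> = (\<Sum>j\<le>K. 1 / fact j * coeff f (K - j) * z ^ (K - j))"
    by (rule sum.reindex_bij_witness[of _ "\<lambda>j. K - j" "\<lambda>j. K - j"]) auto
  also have "\<dots> = (\<Sum>j\<le>K. z ^ K * (coeff (exp_dual K f) j * (1 / z) ^ j))"
    using z by (intro sum.cong) (auto simp: coeff_exp_dual power_diff field_simps)
  also have "\<dots> = z ^ K * poly (exp_dual K f) (1 / z)"
    by (subst poly_eq_sum_coeff[of _ K]) (auto simp: sum_distrib_left coeff_exp_dual intro: degree_le)
  finally have "poly (exp_dual K f) (1 / z) = 0" using 0 z by simp
  then have "1 / z \<in> \<real>" "Re (1 / z) \<le> 0"
    using nonpos_rooted_exp_dual[OF assms(1), of K] by (auto simp: nonpos_rooted_def)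
  then obtain x where x: "1 / z = of_real x" "x \<le> 0" by (metis Re_complex_of_real Reals_cases)
  then have "z = of_real (1 / x)" using z by (metis of_real_1 of_real_divide divide_divide_eq_right div_by_1 mult_1)
  moreover have "x \<noteq> 0" using x z by auto
  ultimately show "z \<in> \<real> \<and> Re z < 0" using x by auto
qed

lemma neg_rooted_reflect_poly:
  assumes "neg_rooted f" shows "neg_rooted (reflect_poly f)"
  unfolding neg_rooted_def
proof (intro allI impI)
  fix z assume 0: "poly (reflect_poly f) z = 0"
  have "z \<noteq> 0" using 0 neg_rooted_nonzero[OF assms] by auto
  then have "poly f (inverse z) = 0" using 0 by (simp add: poly_reflect_poly_nz)
  then have "inverse z \<in> \<real>" "Re (inverse z) < 0" using assms by (auto simp: neg_rooted_def)
  then obtain x where x: "inverse z = of_real x" "x < 0" by (metis Re_complex_of_real Reals_cases)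
  then have "z = of_real (inverse x)" by (metis inverse_inverse_eq of_real_inverse)
  then show "z \<in> \<real> \<and> Re z < 0" using x by (metis Re_complex_of_real Reals_of_real inverse_negative_iff_negative)
qed

text \<open>Reversal of coefficients turns \<open>i + m\<close> into \<open>n + m - i\<close> with
  \<open>n\<close> the degree, which is the preceding case with \<open>K = n + m\<close>.\<close>

lemma neg_rooted_div_fact_add:
  assumes "neg_rooted f"
  shows "neg_rooted (diag_poly (\<lambda>i. 1 / fact (i + m)) f)"
proof -
  let ?n = "degree f"
  have f0: "coeff f 0 \<noteq> 0" using assms by (auto simp: neg_rooted_def poly_0_coeff_0[symmetric])
  let ?g = "diag_poly (\<lambda>j. 1 / fact (?n + m - j)) (reflect_poly f)"
  have dr: "degree (reflect_poly f) = ?n" using f0 by simp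
  have "neg_rooted ?g"
    by (intro neg_rooted_div_fact_diff neg_rooted_reflect_poly assms) (simp add: dr)
  moreover have "degree ?g = ?n"
  proof (rule antisym)
    show "degree ?g \<le> ?n" using degree_diag_poly_le dr by metis
    show "?n \<le> degree ?g" using f0 by (intro le_degree) (simp add: coeff_reflect_poly)
  qed
  moreover from this have "reflect_poly ?g = diag_poly (\<lambda>i. 1 / fact (i + m)) f"
    by (intro poly_eqI) (auto simp: coeff_reflect_poly coeff_eq_0 add.commute)
  ultimately show ?thesis using neg_rooted_reflect_poly by metis
qed

section \<open>Fibonacci polynomials\<close>

fun fib_poly :: "nat \<Rightarrow> complex poly" where
  "fib_poly 0 = 1"
| "fib_poly (Suc 0) = 1"
| "fib_poly (Suc (Suc n)) = fib_poly (Suc n) + pCons 0 (fib_poly n)"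

lemma coeff_fib_poly: "coeff (fib_poly n) i = of_nat ((n - i) choose i)"
proof (induction n arbitrary: i rule: fib_poly.induct)
  case (3 n)
  show ?case
  proof (cases i)
    case (Suc j)
    then show ?thesis using 3 by (cases "j \<le> n") (auto simp: Suc_diff_le)
  qed (use 3 in auto)
qed (auto simp: coeff_pCons split: nat.split)

text \<open>Consecutive ratios satisfy \<open>r' = 1 + z / r\<close>. For nonreal \<open>z\<close>
  the invariant is that \<open>r\<close> lies in the closed and \<open>z / r\<close> in the open
  half plane of \<open>z\<close>; it keeps the ratios, hence the polynomials, away from zero. On the
  nonnegative axis all values are at least 1.\<close>

lemma neg_rooted_fib_poly: "neg_rooted (fib_poly n)"
proof -
  have nonreal: "poly (fib_poly n) z \<noteq> 0 \<and>
      Im z * Im (poly (fib_poly (Suc n)) z / poly (fib_poly n) z) \<ge> 0 \<and>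
      Im z * Im (z / (poly (fib_poly (Suc n)) z / poly (fib_poly n) z)) > 0" if "Im z \<noteq> 0" for n z
  proof (induction n)
    case 0
    then show ?case using that by (simp add: not_square_less_zero less_le)
  next
    case (Suc n)
    define r where "r = poly (fib_poly (Suc n)) z / poly (fib_poly n) z"
    have r: "Im z * Im r \<ge> 0" "Im z * Im (z / r) > 0" and p: "poly (fib_poly n) z \<noteq> 0"
      using Suc by (auto simp: r_def)
    have r0: "r \<noteq> 0" using r(2) by auto
    have p1: "poly (fib_poly (Suc n)) z \<noteq> 0" using r0 by (auto simp: r_def)
    define r' where "r' = poly (fib_poly (Suc (Suc n))) z / poly (fib_poly (Suc n)) z"
    have r': "r' = 1 + z / r" using p p1 by (simp add: r'_def r_def field_simps)
    have "Im z * Im r' > 0" using r by (simp add: r')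
    then have r'0: "r' \<noteq> 0" by auto
    have "Im (z / r') = Im (z * cnj r') / (cmod r')\<^sup>2"
      by (simp add: complex_div_cnj[of z r'])
    also have "z * cnj r' = z + z * cnj z / cnj r" by (simp add: r' field_simps)
    also have "z * cnj z / cnj r = of_real ((cmod z)\<^sup>2 / (cmod r)\<^sup>2) * r"
    proof -
      have "of_real ((cmod z)\<^sup>2 / (cmod r)\<^sup>2) = z * cnj z / (r * cnj r)"
        by (simp only: of_real_divide complex_norm_square)
      then show ?thesis using r0 by simp
    qed
    finally have "Im z * Im (z / r') =
        ((Im z)\<^sup>2 + ((cmod z)\<^sup>2 / (cmod r)\<^sup>2) * (Im z * Im r)) / (cmod r')\<^sup>2"
      by (simp add: power2_eq_square algebra_simps)
    also have "\<dots> > 0" using that r'0 by (intro divide_pos_pos add_pos_nonneg mult_nonneg_nonneg[OF _ r(1)]) auto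
    finally show ?case using p1 \<open>Im z * Im r' > 0\<close> unfolding r'_def by (simp add: less_imp_le)
  qed
  have real: "Re (poly (fib_poly n) (of_real x)) \<ge> 1 \<and> poly (fib_poly n) (of_real x) \<in> \<real>" if "x \<ge> 0" for n x
    using that
    by (induction n rule: fib_poly.induct) (auto simp: complex_is_Real_iff intro!: add_increasing2)
  show ?thesis unfolding neg_rooted_def
  proof (intro allI impI)
    fix z assume 0: "poly (fib_poly n) z = 0"
    then have "Im z = 0" using nonreal by blast
    then have z: "z = of_real (Re z)" by (simp add: complex_eq_iff)
    moreover have "Re z < 0" using real[of "Re z" n] 0 z by (metis linorder_not_less not_one_le_zero zero_complex.sel(1))
    ultimately show "z \<in> \<real> \<and> Re z < 0" by (metis Reals_of_real)
  qed
qed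

section \<open>The roots of the weight polynomial\<close>

lemma norm_pochhammer_ge:
  fixes z :: complex
  assumes "Re z \<ge> 0"
  shows "pochhammer (Re z) j \<le> cmod (pochhammer z j)"
proof (induction j)
  case (Suc j)
  have "Re z + real j \<le> cmod (z + of_nat j)" using complex_Re_le_cmod[of "z + of_nat j"] by simp
  moreover have "0 \<le> pochhammer (Re z) j"
    using assms by (induction j) (auto simp: pochhammer_Suc)
  ultimately show ?case using Suc assms by (auto simp: pochhammer_Suc norm_mult intro!: mult_mono)
qed simp

text \<open>Factorwise: \<open>(M choose j) * fact j\<close> is the falling factorial of
  \<open>M\<close>, and three times each of its factors is at most the corresponding factor of the
  rising factorial of \<open>a\<close>.\<close>

lemma choose_fact_le_pochhammer:
  fixes a :: real
  assumes "3 * real M \<le> a"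
  shows "real (M choose j) * fact j * 3 ^ j \<le> pochhammer a j"
proof (cases "j \<le> M")
  case True
  have nn: "0 \<le> pochhammer a k" for k
    using assms by (induction k) (auto simp: pochhammer_Suc intro!: mult_nonneg_nonneg)
  from True show ?thesis
  proof (induction j)
    case (Suc j)
    have "real (M choose Suc j) * fact (Suc j) = real (M choose j) * fact j * (real M - real j)"
    proof -
      have "Suc j * (M choose Suc j) = (M choose j) * (M - j)" using binomial_absorb_comp[of M j]
        by (metis Suc_times_binomial_add binomial_absorption binomial_absorb_comp mult.commute)
      then have "real (Suc j) * real (M choose Suc j) = real (M choose j) * (real M - real j)"
        using Suc.prems by (metis of_nat_diff of_nat_mult Suc_leD)
      then show ?thesis by (simp add: fact_Suc mult_ac del: of_nat_Suc)
    qed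
    then have "real (M choose Suc j) * fact (Suc j) * 3 ^ Suc j =
       (real (M choose j) * fact j * 3 ^ j) * (3 * (real M - real j))"
      by (simp del: fact_Suc binomial_Suc_Suc)
    also have "\<dots> \<le> pochhammer a j * (a + real j)"
      using Suc assms nn by (intro mult_mono) auto
    finally show ?case by (simp add: pochhammer_Suc)
  qed simp
next
  case False
  have "0 \<le> pochhammer a j" using assms by (induction j) (auto simp: pochhammer_Suc intro!: mult_nonneg_nonneg)
  then show ?thesis using False by (simp add: binomial_eq_0)
qed

text \<open>\<open>9 / 4\<close> is the sum of the infinite series, the value of
  \<open>2 * x / (1 - x) ^ 3\<close> at \<open>x = 1 / 3\<close>.\<close>

lemma sum_quadratic_geometric_less: "(\<Sum>j\<le>M. real j * real (Suc j) / 3 ^ j) < 9 / 4"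
proof -
  have "(\<Sum>j\<le>M. real j * real (Suc j) / 3 ^ j) = 9 / 4 - (2 * real M ^ 2 + 8 * real M + 9) / (4 * 3 ^ M)"
  proof (induction M)
    case (Suc M)
    show ?case unfolding sum.atMost_Suc Suc.IH by (simp add: field_simps power2_eq_square)
  qed simp
  also have "\<dots> < 9 / 4"
  proof -
    have "(2 * real M ^ 2 + 8 * real M + 9) / (4 * 3 ^ M) > 0"
      by (intro divide_pos_pos add_nonneg_pos add_nonneg_nonneg) auto
    then show ?thesis by linarith
  qed
  finally show ?thesis .
qed

text \<open>The constants 3 and 4 match exactly. Dividing by
  \<open>cmod (N + 1 + of_nat j) \<ge> 4\<close> bounds the sum in the remainder by less than
  \<open>9 / 16\<close>. On the other hand the quotient of \<open>pochhammer (z + 2) M\<close> and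
  \<open>pochhammer z M\<close> is \<open>(z + M) * (z + 1 + M) / (z * (z + 1))\<close>, of modulus
  at most \<open>(4 / 3) ^ 2 = 16 / 9\<close>. Strictness comes from the truncated series.\<close>

lemma kl_weight_dominance:
  fixes z N :: complex
  assumes z: "Re z \<ge> 3 * real M" "z \<noteq> 0" and N: "N + 1 \<noteq> 0" "\<And>j. 1 \<le> j \<Longrightarrow> j \<le> M \<Longrightarrow> cmod (N + 1 + of_nat j) \<ge> 4"
  shows "cmod (fact M * kl_weight M N z - pochhammer z M * pochhammer (N + 2) M) <
    cmod (pochhammer z M * pochhammer (N + 2) M)"
proof -
  note False = z(2)
  have nz: "z + 2 + of_nat j \<noteq> 0" for j
  proof
    assume "z + 2 + of_nat j = 0"
    then have "Re (z + 2 + of_nat j) = 0" by simp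
    then show False using z by simp
  qed
  have nN: "N + 1 + of_nat j \<noteq> 0" if "j \<le> M" for j
    using N(1) N(2)[of j] that by (cases "j = 0") auto
  define S where "S = (\<Sum>j\<le>M. (-1) ^ j * of_nat (M choose j) * fact (Suc j) * of_nat j /
         (pochhammer (z + 2) j * (N + 1 + of_nat j)))"
  have term_le: "cmod ((-1) ^ j * of_nat (M choose j) * fact (Suc j) * of_nat j /
         (pochhammer (z + 2) j * (N + 1 + of_nat j))) \<le> (real j * real (Suc j) / 3 ^ j) / 4" if "j \<le> M" for j
  proof (cases "j = 0")
    case False
    have "real (M choose j) * fact j * 3 ^ j \<le> pochhammer (Re (z + 2)) j"
      using z by (intro choose_fact_le_pochhammer) simp
    also have "\<dots> \<le> cmod (pochhammer (z + 2) j)" using z by (intro norm_pochhammer_ge) simp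
    finally have 1: "real (M choose j) * fact j * 3 ^ j \<le> cmod (pochhammer (z + 2) j)" .
    have 2: "cmod (N + 1 + of_nat j) \<ge> 4" using N(2)[of j] False that by simp
    have "(real (M choose j) * fact j * 3 ^ j) * 4 \<le> cmod (pochhammer (z + 2) j) * cmod (N + 1 + of_nat j)"
      using 1 2 by (intro mult_mono) auto
    then have 3: "real (Suc j) * real j * ((real (M choose j) * fact j * 3 ^ j) * 4) \<le>
        real (Suc j) * real j * (cmod (pochhammer (z + 2) j) * cmod (N + 1 + of_nat j))"
      by (intro mult_left_mono) auto
    have pos: "cmod (pochhammer (z + 2) j) * cmod (N + 1 + of_nat j) > 0"
      using nz nN[OF that] by (auto simp: pochhammer_eq_0_iff eq_neg_iff_add_eq_0)
    have "real (M choose j) * fact (Suc j) * real j / (cmod (pochhammer (z + 2) j) * cmod (N + 1 + of_nat j))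
        \<le> real (Suc j) * real j / (3 ^ j * 4)"
      using pos 3 by (simp add: divide_simps fact_Suc mult_ac del: of_nat_Suc)
    then show ?thesis by (simp add: norm_mult norm_divide norm_power mult_ac del: of_nat_Suc fact_Suc)
  qed simp
  have "cmod S \<le> (\<Sum>j\<le>M. (real j * real (Suc j) / 3 ^ j) / 4)"
    unfolding S_def by (rule order_trans[OF norm_sum]) (intro sum_mono term_le, simp)
  also have "\<dots> = (\<Sum>j\<le>M. real j * real (Suc j) / 3 ^ j) / 4" by (simp add: sum_divide_distrib)
  also have "\<dots> < 9 / 16" using sum_quadratic_geometric_less[of M] by simp
  finally have S: "cmod S < 9 / 16" .
  have quarter: "3 * cmod (w + of_nat M) \<le> 4 * cmod w" if "Re w \<ge> 3 * real M" for w
  proof (rule power2_le_imp_le)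
    have "9 * ((Re w + real M)\<^sup>2) \<le> 16 * (Re w)\<^sup>2"
    proof -
      have "(3 * (Re w + real M))\<^sup>2 \<le> (4 * Re w)\<^sup>2" using that by (intro power_mono) auto
      then show ?thesis by (simp only: power_mult_distrib) simp
    qed
    then show "(3 * cmod (w + of_nat M))\<^sup>2 \<le> (4 * cmod w)\<^sup>2"
      by (simp add: power_mult_distrib cmod_power2) (smt (verit) zero_le_power2)
  qed simp
  have "pochhammer z (M + 2) = pochhammer z M * ((z + of_nat M) * (z + 1 + of_nat M))"
    using pochhammer_product'[of z M 2] by (simp add: numeral_2_eq_2 pochhammer_Suc add_ac)
  moreover have "pochhammer z (M + 2) = z * (z + 1) * pochhammer (z + 2) M"
    using pochhammer_product'[of z 2 M] by (simp add: numeral_2_eq_2 pochhammer_Suc add_ac)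
  ultimately have eq: "z * (z + 1) * pochhammer (z + 2) M = pochhammer z M * ((z + of_nat M) * (z + 1 + of_nat M))"
    by simp
  have z1: "z + 1 \<noteq> 0"
  proof
    assume "z + 1 = 0"
    then have "Re (z + 1) = 0" by simp
    then show False using z by simp
  qed
  have p2: "pochhammer (z + 2) M \<noteq> 0" "pochhammer (N + 2) M \<noteq> 0"
  proof -
    show "pochhammer (z + 2) M \<noteq> 0" using nz by (auto simp: pochhammer_eq_0_iff eq_neg_iff_add_eq_0)
    have "N + 2 + of_nat k \<noteq> 0" if "k < M" for k
    proof -
      have eq: "N + 2 + of_nat k = N + 1 + of_nat (Suc k)" by simp
      show ?thesis unfolding eq using that by (intro nN) simp
    qed
    then show "pochhammer (N + 2) M \<noteq> 0" unfolding pochhammer_eq_0_iff eq_neg_iff_add_eq_0 by blast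
  qed
  have pz: "pochhammer z M \<noteq> 0"
  proof
    assume "pochhammer z M = 0"
    then have "z * (z + 1) * pochhammer (z + 2) M = 0" unfolding eq by simp
    then show False using False z1 p2(1) by simp
  qed
  have "(3 * cmod (z + of_nat M)) * (3 * cmod (z + 1 + of_nat M)) \<le> (4 * cmod z) * (4 * cmod (z + 1))"
    using z by (intro mult_mono quarter) auto
  then have *: "9 * (cmod (z + of_nat M) * cmod (z + 1 + of_nat M)) * cmod (pochhammer z M) \<le>
      16 * (cmod z * cmod (z + 1)) * cmod (pochhammer z M)" by (intro mult_right_mono) auto
  then have "9 * (cmod z * cmod (z + 1) * cmod (pochhammer (z + 2) M)) \<le>
      16 * (cmod z * cmod (z + 1)) * cmod (pochhammer z M)"
  proof -
    have "cmod z * cmod (z + 1) * cmod (pochhammer (z + 2) M) =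
        cmod (z + of_nat M) * cmod (z + 1 + of_nat M) * cmod (pochhammer z M)"
      using arg_cong[OF eq, of cmod] by (simp only: norm_mult mult.commute[of "cmod (pochhammer z M)"])
    then show ?thesis using * by (simp only: mult.assoc)
  qed
  moreover have "cmod z * cmod (z + 1) > 0" using False z1 by simp
  ultimately have "9 * cmod (pochhammer (z + 2) M) \<le> 16 * cmod (pochhammer z M)"
    using mult_le_cancel_left_pos[of "cmod z * cmod (z + 1)" "9 * cmod (pochhammer (z + 2) M)"]
    by (simp only: mult.assoc mult.left_commute[of 9] mult.left_commute[of 16])
  moreover have "16 * (cmod (pochhammer (z + 2) M) * cmod S) < 9 * cmod (pochhammer (z + 2) M)"
    using S p2 by (simp add: mult.commute)
  ultimately have "cmod (pochhammer (z + 2) M) * cmod S < cmod (pochhammer z M)" by linarith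
  then have "cmod (pochhammer (z + 2) M) * cmod S * cmod (pochhammer (N + 2) M) <
      cmod (pochhammer z M) * cmod (pochhammer (N + 2) M)"
    using p2 by (intro mult_strict_right_mono) auto
  moreover have "fact M * kl_weight M N z - pochhammer z M * pochhammer (N + 2) M =
      - (pochhammer (z + 2) M * S * pochhammer (N + 2) M)"
  proof -
    have "fact M * kl_weight M N z = pochhammer z M * pochhammer (N + 2) M -
        pochhammer (z + 2) M * pochhammer (N + 2) M * S"
      unfolding S_def by (rule kl_weight_partial_fractions[OF nz nN])
    then show ?thesis by simp
  qed
  ultimately show ?thesis by (simp only: norm_minus_cancel norm_mult)
qed

section \<open>Counting roots by sign changes and by Rouche's theorem\<close>

lemma alternating_signs_roots:
  fixes f :: "real \<Rightarrow> real" and t :: "nat \<Rightarrow> real"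
  assumes cont: "\<And>x. isCont f x" and dec: "\<And>k. k < n \<Longrightarrow> t (Suc k) < t k"
    and sgn: "\<And>k. k \<le> n \<Longrightarrow> (-1) ^ k * f (t k) > 0"
  obtains A where "finite A" "card A = n" "\<And>x. x \<in> A \<Longrightarrow> f x = 0 \<and> x < t 0"
proof -
  have "\<exists>x. t (Suc k) < x \<and> x < t k \<and> f x = 0" if "k < n" for k
  proof -
    have s: "(-1) ^ k * f (t k) > 0" "(-1) ^ k * f (t (Suc k)) < 0"
      using sgn[of k] sgn[of "Suc k"] that by auto
    have "\<exists>x\<ge>t (Suc k). x \<le> t k \<and> (-1) ^ k * f x = 0"
      using s cont dec[OF that] by (intro IVT) auto
    then obtain x where "t (Suc k) \<le> x" "x \<le> t k" "f x = 0" by auto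
    moreover from this s have "x \<noteq> t (Suc k)" "x \<noteq> t k" by auto
    ultimately show ?thesis by force
  qed
  then obtain x where x: "\<And>k. k < n \<Longrightarrow> t (Suc k) < x k \<and> x k < t k \<and> f (x k) = 0" by metis
  have mono: "t l \<le> t k" if "k \<le> l" "l \<le> n" for k l
    using that(1,2)
  proof (induction l rule: dec_induct)
    case (step l)
    then show ?case using dec[of l] by simp
  qed simp
  have less: "x l < x k" if "k < l" "l < n" for k l
    using x[of k] x[of l] mono[of "Suc k" l] that by fastforce
  have "inj_on x {..<n}"
    by (rule inj_onI) (metis less lessThan_iff linorder_neqE_nat order_less_irrefl)
  then have "card (x ` {..<n}) = n" by (simp add: card_image)
  moreover have "f y = 0 \<and> y < t 0" if "y \<in> x ` {..<n}" for y
  proof -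
    obtain k where k: "k < n" "y = x k" using \<open>y \<in> _\<close> by auto
    then show ?thesis using x[OF k(1)] mono[of 0 k] by auto
  qed
  ultimately show thesis using that[of "x ` {..<n}"] by blast
qed

lemma holomorphic_on_poly: "poly p holomorphic_on A" for p :: "complex poly"
  using poly_holomorphic_on[OF holomorphic_on_ident] by (simp add: id_def)

lemma zorder_poly:
  assumes "p \<noteq> 0" shows "zorder (poly p) z = int (order z p)"
proof -
  obtain q where q: "p = [:- z, 1:] ^ order z p * q" "\<not> [:- z, 1:] dvd q"
    using order_decomp[OF assms] by blast
  show ?thesis
  proof (rule zorder_eqI[of UNIV z "poly q"])
    show "poly q z \<noteq> 0" using q(2) by (simp add: poly_eq_0_iff_dvd)
    show "poly p w = poly q w * (w - z) powi int (order z p)" for w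
      by (subst q(1)) (simp add: power_int_def mult.commute)
  qed (auto intro: holomorphic_on_poly)
qed

text \<open>\<open>Rouche_theorem\<close> compares orders weighted by winding numbers over all zeros
  in the plane; for a circle the weights are 1 inside and 0 outside.\<close>

lemma poly_Rouche:
  fixes p q :: "complex poly"
  assumes r: "r > 0" and less: "\<And>z. cmod (z - c) = r \<Longrightarrow> cmod (poly p z - poly q z) < cmod (poly q z)"
  shows "(\<Sum>z | poly p z = 0 \<and> cmod (z - c) < r. order z p) = (\<Sum>z | poly q z = 0 \<and> cmod (z - c) < r. order z q)"
proof -
  have "cmod (c + of_real r - c) = r" using r by simp
  from less[OF this] have "poly p (c + of_real r) \<noteq> 0" "poly q (c + of_real r) \<noteq> 0" by auto
  then have nz: "p \<noteq> 0" "q \<noteq> 0" by auto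
  let ?\<gamma> = "circlepath c r"
  have w: "(\<Sum>z | z \<in> UNIV \<and> poly f z = 0. winding_number ?\<gamma> z * zorder (poly f) z) =
      of_nat (\<Sum>z | poly f z = 0 \<and> cmod (z - c) < r. order z f)"
    if f: "f \<noteq> 0" "\<And>z. cmod (z - c) = r \<Longrightarrow> poly f z \<noteq> 0" for f
  proof -
    have "(\<Sum>z | z \<in> UNIV \<and> poly f z = 0. winding_number ?\<gamma> z * zorder (poly f) z) =
       (\<Sum>z | poly f z = 0 \<and> cmod (z - c) < r. winding_number ?\<gamma> z * zorder (poly f) z)"
    proof (rule sum.mono_neutral_right)
      show "finite {z \<in> UNIV. poly f z = 0}" using poly_roots_finite[OF f(1)] by simp
      have "winding_number ?\<gamma> z = 0" if "poly f z = 0" "\<not> cmod (z - c) < r" for z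
      proof -
        have "cmod (z - c) \<noteq> r" using f(2) that(1) by blast
        then have "z \<notin> cball c r" using that(2) by (simp add: dist_norm norm_minus_commute)
        then show ?thesis
          by (intro winding_number_zero_outside[of _ "cball c r"]) (use r in \<open>auto simp: path_image_circlepath\<close>)
      qed
      then show "\<forall>z\<in>{z \<in> UNIV. poly f z = 0} - {z. poly f z = 0 \<and> cmod (z - c) < r}.
          winding_number ?\<gamma> z * zorder (poly f) z = 0" by auto
    qed auto
    also have "\<dots> = (\<Sum>z | poly f z = 0 \<and> cmod (z - c) < r. of_nat (order z f))"
      by (intro sum.cong) (auto simp: winding_number_circlepath zorder_poly[OF f(1)])
    finally show ?thesis by simp
  qed
  have "(\<Sum>z | z \<in> UNIV \<and> poly q z + poly (p - q) z = 0. winding_number ?\<gamma> z * zorder (\<lambda>z. poly q z + poly (p - q) z) z)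
     = (\<Sum>z | z \<in> UNIV \<and> poly q z = 0. winding_number ?\<gamma> z * zorder (poly q) z)"
  proof (rule Rouche_theorem)
    show "finite {z \<in> UNIV. poly q z + poly (p - q) z = 0}" "finite {z \<in> UNIV. poly q z = 0}"
      using poly_roots_finite[OF nz(1)] poly_roots_finite[OF nz(2)] by simp_all
    show "\<forall>z\<in>path_image ?\<gamma>. cmod (poly (p - q) z) < cmod (poly q z)"
      using less r by (auto simp: path_image_circlepath dist_norm norm_minus_commute)
  qed (auto intro!: holomorphic_on_poly holomorphic_on_diff)
  then have eq: "(\<Sum>z | z \<in> UNIV \<and> poly p z = 0. winding_number ?\<gamma> z * zorder (poly p) z)
     = (\<Sum>z | z \<in> UNIV \<and> poly q z = 0. winding_number ?\<gamma> z * zorder (poly q) z)" by simp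
  have nz': "poly p z \<noteq> 0" "poly q z \<noteq> 0" if "cmod (z - c) = r" for z
    using less[OF that] by auto
  have "complex_of_nat (\<Sum>z | poly p z = 0 \<and> cmod (z - c) < r. order z p) =
      of_nat (\<Sum>z | poly q z = 0 \<and> cmod (z - c) < r. order z q)"
    using trans[OF w[OF nz(1) nz'(1), symmetric] trans[OF eq w[OF nz(2) nz'(2)]]] by simp
  then show ?thesis by (simp only: of_nat_eq_iff)
qed

lemma sum_order_le_degree:
  assumes "p \<noteq> 0" "finite A"
  shows "(\<Sum>z\<in>A. order z p) \<le> degree (p :: 'a::idom poly)"
proof -
  have "(\<Sum>z\<in>A. order z p) = (\<Sum>z\<in>A. count (proots p) z)" using assms by simp
  also have "\<dots> = (\<Sum>z\<in>A \<inter> set_mset (proots p). count (proots p) z)"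
    using assms by (intro sum.mono_neutral_right) (auto simp: order_root)
  also have "\<dots> \<le> (\<Sum>z\<in>set_mset (proots p). count (proots p) z)" by (intro sum_mono2) auto
  also have "\<dots> \<le> degree p" using size_proots_le[of p] by (simp add: size_multiset_overloaded_eq)
  finally show ?thesis .
qed

section \<open>The weight as a polynomial and the location of its roots\<close>

definition real_coeffs :: "complex poly \<Rightarrow> bool" where
  "real_coeffs p \<longleftrightarrow> (\<forall>i. coeff p i \<in> \<real>)"

lemma real_coeffs_mult: "real_coeffs p \<Longrightarrow> real_coeffs q \<Longrightarrow> real_coeffs (p * q)"
  by (auto simp: real_coeffs_def coeff_mult intro!: sum_in_Reals)

lemma real_coeffs_pochhammer: "real_coeffs p \<Longrightarrow> real_coeffs (pochhammer p n)"
proof (induction n)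
  case (Suc n)
  have "real_coeffs (p + of_nat n)"
    using Suc.prems by (auto simp: real_coeffs_def of_nat_poly coeff_pCons split: nat.split)
  with Suc show ?case by (simp add: pochhammer_Suc real_coeffs_mult)
qed (auto simp: real_coeffs_def)

lemma poly_pochhammer: "poly (pochhammer p n) x = pochhammer (poly p x) n"
  by (induction n) (auto simp: pochhammer_Suc)

lemma degree_pochhammer_linear_le: "degree (pochhammer [:a, b:] n) \<le> n"
proof (induction n)
  case (Suc n)
  have "degree ([:a, b:] + of_nat n) \<le> 1" by (simp add: of_nat_poly)
  then show ?case unfolding pochhammer_Suc using Suc degree_mult_le[of "pochhammer [:a, b:] n" "[:a, b:] + of_nat n"]
    by linarith
qed simp

definition kl_weight_poly :: "nat \<Rightarrow> nat \<Rightarrow> complex poly" where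
  "kl_weight_poly M d = (\<Sum>h\<le>M. pochhammer [:of_nat d + 1, - 1:] h * pochhammer [:0, 1:] h *
     pochhammer [:of_nat h + 2, 1:] (M - h) * [:1 / fact h:])"

lemma poly_kl_weight_poly: "poly (kl_weight_poly M d) z = kl_weight M (of_nat d - z) z"
  by (simp add: kl_weight_poly_def kl_weight_def poly_sum poly_pochhammer algebra_simps)

lemma real_coeffs_kl_weight_poly: "real_coeffs (kl_weight_poly M d)"
proof -
  have lin: "real_coeffs [:a, b:]" if "a \<in> \<real>" "b \<in> \<real>" for a b
    using that by (auto simp: real_coeffs_def coeff_pCons split: nat.split)
  have "real_coeffs (pochhammer [:of_nat d + 1, - 1:] h * pochhammer [:0, 1:] h *
     pochhammer [:of_nat h + 2, 1:] (M - h) * [:1 / fact h:])" for h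
  proof -
    have "1 / fact h \<in> (\<real> :: complex set)" by (metis Reals_1 Reals_divide Reals_of_nat of_nat_fact)
    then have "real_coeffs [:1 / fact h:]" by (auto simp: real_coeffs_def coeff_pCons split: nat.split)
    then show ?thesis by (intro real_coeffs_mult real_coeffs_pochhammer lin Reals_add Reals_minus Reals_of_nat Reals_1 Reals_0 Reals_numeral)
  qed
  then show ?thesis unfolding kl_weight_poly_def real_coeffs_def coeff_sum by (auto intro!: sum_in_Reals)
qed

lemma degree_kl_weight_poly: "degree (kl_weight_poly M d) \<le> 2 * M"
  unfolding kl_weight_poly_def
proof (intro degree_sum_le)
  fix h assume h: "h \<in> {..M}"
  let ?a = "pochhammer [:of_nat d + 1, - 1 :: complex:] h" and ?b = "pochhammer [:0, 1 :: complex:] h"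
    and ?c = "pochhammer [:of_nat h + 2, 1 :: complex:] (M - h)" and ?e = "[:1 / fact h :: complex:]"
  have "degree (?a * ?b * ?c * ?e) \<le> degree ?a + degree ?b + degree ?c + degree ?e"
    using degree_mult_le[of "?a * ?b * ?c" ?e] degree_mult_le[of "?a * ?b" ?c] degree_mult_le[of ?a ?b] by linarith
  also have "\<dots> \<le> h + h + (M - h) + 0"
    by (intro add_mono degree_pochhammer_linear_le) simp
  finally show "degree (?a * ?b * ?c * ?e) \<le> 2 * M" using h by simp
qed simp

lemma kl_weight_of_real: "kl_weight M (of_real N) (of_real z :: complex) = of_real (kl_weight M N z)"
  by (simp add: kl_weight_def pochhammer_of_real[symmetric])

lemma kl_weight_poly_neg_roots:
  assumes "0 < d"
  obtains A where "finite A" "card A = M" "\<And>z. z \<in> A \<Longrightarrow> poly (kl_weight_poly M d) z = 0 \<and> z \<in> \<real> \<and> Re z < 0"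
proof -
  define f where "f x = kl_weight M (real d - x) x" for x
  have "continuous_on UNIV f"
  proof -
    have "f x = Re (poly (kl_weight_poly M d) (of_real x))" for x
      using kl_weight_of_real[of M "real d - x" x] by (simp add: f_def poly_kl_weight_poly)
    then have "f = (\<lambda>x. Re (poly (kl_weight_poly M d) (of_real x)))" by auto
    then show ?thesis by (auto intro!: continuous_intros)
  qed
  then have cont: "isCont f x" for x by (simp add: continuous_on_eq_continuous_at)
  have sgn: "(-1) ^ k * f (- real k) > 0" if "k \<le> M" for k
    using kl_weight_neg_int[OF that assms] by (simp add: f_def)
  obtain A where A: "finite A" "card A = M" "\<And>x. x \<in> A \<Longrightarrow> f x = 0 \<and> x < - real 0"
    using alternating_signs_roots[of f M "\<lambda>k. - real k"] cont sgn by auto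
  show thesis
  proof (rule that[of "complex_of_real ` A"])
    show "finite (complex_of_real ` A)" "card (complex_of_real ` A) = M"
      using A(1,2) by (simp_all add: card_image inj_on_def)
    fix z assume "z \<in> complex_of_real ` A"
    then obtain x where x: "x \<in> A" "z = of_real x" by auto
    have "poly (kl_weight_poly M d) z = of_real (f x)"
      unfolding x poly_kl_weight_poly f_def kl_weight_of_real[symmetric] by simp
    then show "poly (kl_weight_poly M d) z = 0 \<and> z \<in> \<real> \<and> Re z < 0" using A(3)[OF x(1)] x(2) by auto
  qed
qed

lemma kl_weight_poly_roots:
  assumes M: "3 * M + 2 \<le> d" and d: "0 < d" "2 < d" and z: "poly (kl_weight_poly M d) z = 0"
  shows "z \<in> \<real> \<and> Re z < 0 \<or> real d - 2 \<le> Re z \<and> \<bar>Im z\<bar> < 4"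
proof -
  let ?p = "smult (fact M) (kl_weight_poly M d)"
  define q where "q = pochhammer [:0, 1 :: complex:] M * pochhammer [:of_nat d + 2, - 1:] M"
  have pv: "poly ?p w = fact M * kl_weight M (of_nat d - w) w" for w
    by (simp add: poly_kl_weight_poly)
  have qv: "poly q w = pochhammer w M * pochhammer ((of_nat d - w) + 2) M" for w
    by (simp add: q_def poly_pochhammer algebra_simps)
  \<comment> \<open>The circle has centre \<open>d + M + 1\<close> and meets the real axis at
    \<open>d - 2\<close> and \<open>d + 2 * M + 4\<close>. It encloses the roots
    \<open>d + 2, ..., d + M + 1\<close> of the second factor of \<open>q\<close>.\<close>
  define r where "r = real M + 3"
  define c where "c = complex_of_real (real d - 2 + r)"
  have less: "cmod (poly ?p w - poly q w) < cmod (poly q w)" if "cmod (w - c) = r" for w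
    unfolding pv qv
  proof (rule kl_weight_dominance)
    have "\<bar>Re (w - c)\<bar> \<le> r" using abs_Re_le_cmod[of "w - c"] that by simp
    then have Re: "Re w \<ge> real d - 2" by (simp add: c_def)
    then show "Re w \<ge> 3 * real M" using M by linarith
    show "w \<noteq> 0" using Re d by auto
    \<comment> \<open>The point \<open>d + 1 + j\<close> is \<open>M - j\<close> to the left of the
      centre, hence at distance at least \<open>3 + j\<close> from the circle. This is the required
      4 for \<open>j \<ge> 1\<close>; for \<open>j = 0\<close> only nonvanishing is needed.\<close>
    have dist: "cmod (of_nat d - w + 1 + of_nat j) \<ge> 3 + real j" if "j \<le> M" for j
    proof -
      have "cmod (c - (of_nat d + 1 + of_nat j)) = r - 3 - real j"
      proof -
        have "c - (of_nat d + 1 + of_nat j) = of_real (r - 3 - real j)" by (simp add: c_def)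
        then show ?thesis using that by (simp only: norm_of_real) (simp add: r_def)
      qed
      moreover have "cmod (w - c) \<le> cmod (of_nat d - w + 1 + of_nat j) + cmod (c - (of_nat d + 1 + of_nat j))"
        using norm_triangle_ineq[of "of_nat d - w + 1 + of_nat j" "c - (of_nat d + 1 + of_nat j)"]
        by (simp add: norm_minus_commute[of w c])
      ultimately show ?thesis using \<open>cmod (w - c) = r\<close> by linarith
    qed
    show "of_nat d - w + 1 \<noteq> 0" using dist[of 0] by auto
    show "cmod (of_nat d - w + 1 + of_nat j) \<ge> 4" if "1 \<le> j" "j \<le> M" for j using dist[of j] that by simp
  qed
  have r0: "r > 0" by (simp add: r_def)
  have "cmod (c + of_real r - c) = r" using r0 by simp
  from less[OF this] have nz: "?p \<noteq> 0" "q \<noteq> 0" by auto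
  have dp: "degree ?p \<le> 2 * M" using degree_kl_weight_poly[of M d] by simp
  let ?B = "\<lambda>f. {w. poly f w = 0 \<and> cmod (w - c) < r}"
  have fin: "finite (?B ?p)" "finite (?B q)"
    using poly_roots_finite[OF nz(1)] poly_roots_finite[OF nz(2)] by auto
  have "M = card ((\<lambda>k. complex_of_nat (d + 2 + k)) ` {..<M})"
    by (subst card_image) (auto simp: inj_on_def)
  also have "\<dots> = (\<Sum>w\<in>(\<lambda>k. complex_of_nat (d + 2 + k)) ` {..<M}. 1)" by simp
  also have "\<dots> \<le> (\<Sum>w\<in>(\<lambda>k. complex_of_nat (d + 2 + k)) ` {..<M}. order w q)"
  proof (rule sum_mono)
    fix w assume "w \<in> (\<lambda>k. complex_of_nat (d + 2 + k)) ` {..<M}"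
    then obtain k where k: "k < M" "w = of_nat (d + 2 + k)" by auto
    have "of_nat d - w + 2 = - of_nat k" unfolding k by simp
    then have "poly q w = 0" unfolding qv using k(1) by (simp add: pochhammer_of_nat_eq_0_lemma)
    then show "1 \<le> order w q" using nz(2) order_root[of q w] by simp
  qed
  also have "\<dots> \<le> (\<Sum>w\<in>?B q. order w q)"
  proof (rule sum_mono2)
    show "(\<lambda>k. complex_of_nat (d + 2 + k)) ` {..<M} \<subseteq> ?B q"
    proof clarify
      fix k assume k: "k < M"
      have "of_nat d - complex_of_nat (d + 2 + k) + 2 = - of_nat k" by simp
      then have "poly q (of_nat (d + 2 + k)) = 0" unfolding qv using k by (simp add: pochhammer_of_nat_eq_0_lemma)
      moreover have "complex_of_nat (d + 2 + k) - c = of_real (real k + 4 - r)" by (simp add: c_def)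
      then have "cmod (of_nat (d + 2 + k) - c) < r" using k by (simp only: norm_of_real) (simp add: r_def)
      ultimately show "poly q (of_nat (d + 2 + k)) = 0 \<and> cmod (of_nat (d + 2 + k) - c) < r" by blast
    qed
  qed (use fin in auto)
  also have "\<dots> = (\<Sum>w\<in>?B ?p. order w ?p)" using poly_Rouche[OF r0, of c ?p q] less by simp
  finally have ballM: "M \<le> (\<Sum>w\<in>?B ?p. order w ?p)" .
  have pz: "poly ?p z = 0" using z by simp
  obtain A where A: "finite A" "card A = M" "\<And>z. z \<in> A \<Longrightarrow> poly (kl_weight_poly M d) z = 0 \<and> z \<in> \<real> \<and> Re z < 0"
    using kl_weight_poly_neg_roots[OF d(1)] by metis
  have ReB: "Re w > real d - 2" if "w \<in> ?B ?p" for w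
  proof -
    have "\<bar>Re (w - c)\<bar> < r" using abs_Re_le_cmod[of "w - c"] that by simp
    then show ?thesis by (simp add: c_def)
  qed
  have AB: "A \<inter> ?B ?p = {}" using A(3) ReB d by force
  \<comment> \<open>The \<open>M\<close> negative roots and the \<open>M\<close> roots in the disc,
    the latter counted with multiplicity, already exhaust the degree \<open>2 * M\<close>.\<close>
  have "z \<in> A \<or> z \<in> ?B ?p"
  proof (rule ccontr)
    assume zn: "\<not> ?thesis"
    have ord: "order w ?p \<ge> 1" if "poly ?p w = 0" for w using nz(1) that order_root[of ?p w] by linarith
    have "M \<le> (\<Sum>w\<in>A. order w ?p)"
    proof -
      have "(\<Sum>w\<in>A. 1) \<le> (\<Sum>w\<in>A. order w ?p)" using A(3) by (intro sum_mono ord) simp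
      then show ?thesis using A(2) by simp
    qed
    then have "M + M + 1 \<le> (\<Sum>w\<in>A. order w ?p) + (\<Sum>w\<in>?B ?p. order w ?p) + order z ?p"
      using ballM ord[OF pz] by linarith
    also have "\<dots> = (\<Sum>w\<in>insert z (A \<union> ?B ?p). order w ?p)"
      using zn A(1) fin AB by (subst sum.insert) (auto simp: sum.union_disjoint)
    also have "\<dots> \<le> degree ?p" using A(1) fin by (intro sum_order_le_degree nz) auto
    finally show False using dp by simp
  qed
  then show ?thesis
  proof
    assume "z \<in> A"
    then show ?thesis using A(3) by blast
  next
    assume zB: "z \<in> ?B ?p"
    \<comment> \<open>The domination also holds inside the disc wherever the imaginary part is at
      least 4 in modulus, because all \<open>d + 1 + j\<close> are real; so no zero lies
      there.\<close>
    have "\<bar>Im z\<bar> < 4"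
    proof (rule ccontr)
      assume Im: "\<not> \<bar>Im z\<bar> < 4"
      have big: "cmod (of_nat d - z + 1 + of_nat j) \<ge> 4" for j
        using abs_Im_le_cmod[of "of_nat d - z + 1 + of_nat j"] Im by simp
      have "cmod (poly ?p z - poly q z) < cmod (poly q z)"
        unfolding pv qv
      proof (rule kl_weight_dominance)
        show "of_nat d - z + 1 \<noteq> 0" using big[of 0] by auto
        show "z \<noteq> 0" using Im by auto
        show "Re z \<ge> 3 * real M" using ReB[OF zB] M by linarith
      qed (use big in auto)
      then show False using pz by simp
    qed
    then show ?thesis using ReB[OF zB] by auto
  qed
qed

section \<open>Negative-rootedness for large \<open>d\<close>\<close>

lemma degree_fib_poly_le: "degree (fib_poly n) \<le> n div 2"
  by (rule degree_le) (auto simp: coeff_fib_poly binomial_eq_0)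

lemma neg_rooted_diag_kl_weight_poly:
  assumes "3 * M + 2 \<le> d" "18 \<le> d"
  shows "neg_rooted (diag_poly (\<lambda>i. poly (kl_weight_poly M d) (of_nat i)) (fib_poly (d - 1)))"
proof (rule neg_rooted_diag_poly[where n = "(d - 1) div 2"])
  show "degree (fib_poly (d - 1)) \<le> (d - 1) div 2" by (rule degree_fib_poly_le)
  show "neg_rooted (fib_poly (d - 1))" by (rule neg_rooted_fib_poly)
  show "kl_weight_poly M d \<noteq> 0"
  proof
    assume "kl_weight_poly M d = 0"
    then have "kl_weight M (of_nat d) (0 :: complex) = 0" using poly_kl_weight_poly[of M d 0] by simp
    then have "kl_weight M (real d + real 0) (- real 0) = 0"
      using kl_weight_of_real[of M "real d" 0] by simp
    then show False using kl_weight_neg_int[of 0 M d] assms by simp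
  qed
  show "coeff (kl_weight_poly M d) i \<in> \<real>" for i
    using real_coeffs_kl_weight_poly by (simp add: real_coeffs_def)
  \<comment> \<open>Hence \<open>2 * n - 1 \<le> d - 2\<close>, the real part guaranteed for the
    right-hand roots.\<close>
  have n: "2 * real ((d - 1) div 2) \<le> real d - 1" using assms by linarith
  fix w assume w: "poly (kl_weight_poly M d) w = 0"
  have roots: "w \<in> \<real> \<and> Re w < 0 \<or> real d - 2 \<le> Re w \<and> \<bar>Im w\<bar> < 4"
    using kl_weight_poly_roots[OF assms(1) _ _ w] assms by simp
  show "Re w < 0 \<or> Re w > real ((d - 1) div 2)" using roots n assms by auto
  show "Re w \<ge> 2 * real ((d - 1) div 2) - 1 \<and> (Im w)\<^sup>2 \<le> Re w" if "w \<notin> \<real>"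
  proof -
    have *: "real d - 2 \<le> Re w" "\<bar>Im w\<bar> < 4" using roots that by auto
    have "\<bar>Im w\<bar>\<^sup>2 \<le> 4\<^sup>2" using *(2) by (intro power_mono) auto
    then show ?thesis using * n assms by auto
  qed
qed

section \<open>Certificates for small ranks\<close>

text \<open>Horner's scheme at \<open>p / q\<close> without fractions. For a nonempty list the first
  component is the value times \<open>q\<close> to the power of the length minus one; the second is
  \<open>q\<close> to the power of the length.\<close>

fun hom_eval :: "int \<Rightarrow> int \<Rightarrow> int list \<Rightarrow> int \<times> int" where
  "hom_eval p q [] = (0, 1)"
| "hom_eval p q (c # cs) = (case hom_eval p q cs of (v, w) \<Rightarrow> (c * w + p * v, q * w))"

fun alternating :: "int list \<Rightarrow> int \<Rightarrow> (int \<times> int) list \<Rightarrow> bool" where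
  "alternating cs s [] \<longleftrightarrow> True"
| "alternating cs s ((p, q) # ps) \<longleftrightarrow> 0 < s * fst (hom_eval (- p) q cs) \<and> alternating cs (- s) ps"

fun increasing_fractions :: "(int \<times> int) list \<Rightarrow> bool" where
  "increasing_fractions ((p, q) # (p', q') # ps) \<longleftrightarrow>
     0 < q \<and> 0 < q' \<and> p * q' < p' * q \<and> increasing_fractions ((p', q') # ps)"
| "increasing_fractions _ \<longleftrightarrow> True"

fun add_lists :: "int list \<Rightarrow> int list \<Rightarrow> int list" where
  "add_lists [] ys = ys"
| "add_lists xs [] = xs"
| "add_lists (x # xs) (y # ys) = (x + y) # add_lists xs ys"

text \<open>Computed by the recurrence of \<open>fib_poly\<close>, so no binomial coefficient has to
  be evaluated.\<close>

definition fib_list :: "int \<Rightarrow> int list" where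
  "fib_list d = fst (foldl (\<lambda>(f, f') _. (f', add_lists f' (0 # f))) ([1], [1]) [1..d - 1])"

text \<open>The triple for \<open>M\<close> consists of \<open>i\<close>, the integer \<open>fact M * kl_weight M (d - i) i\<close>, and the
  last summand of the latter.\<close>

fun weight_update :: "int \<Rightarrow> int \<Rightarrow> int \<Rightarrow> int \<Rightarrow> int \<times> int \<times> int" where
  "weight_update k i q g = (i, q * ((k + 1) * (i + k + 2)) + g, g)"

text \<open>Passing the new summand as an argument of \<open>weight_update\<close> shares it between
  its two occurrences there.\<close>

fun weight_step :: "int \<Rightarrow> int \<Rightarrow> int \<times> int \<times> int \<Rightarrow> int \<times> int \<times> int" where
  "weight_step d k (i, q, g) = weight_update k i q (g * ((d - i + k + 1) * (i + k)))"

text \<open>One list of points serves all \<open>m\<close> of a range. The weights held for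
  \<open>m\<close> have index \<open>M = m - 1\<close>, so they are advanced by the step with
  \<open>k = m - 1\<close>.\<close>

fun certified_range ::
  "int \<Rightarrow> int list \<Rightarrow> (int \<times> int) list \<Rightarrow> (int \<times> int \<times> int) list \<Rightarrow> int list \<Rightarrow> bool" where
  "certified_range d fs ps st [] \<longleftrightarrow> True"
| "certified_range d fs ps st (m # ms) \<longleftrightarrow> alternating (map2 (\<lambda>f s. f * fst (snd s)) fs st) 1 ps \<and>
     certified_range d fs ps (map (weight_step d (m - 1)) st) ms"

text \<open>A list \<open>ps\<close> of fractions certifies, for a given \<open>d\<close> and all \<open>m\<close> with \<open>lo \<le> m \<le> hi\<close>, that
  the polynomial with coefficients \<open>(d - 1 - i choose i) * kl_weight (m - 1) (d - i) i\<close> changes sign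
  between any two consecutive points among \<open>0\<close> and the negatives of the members of \<open>ps\<close>.\<close>

definition certified :: "int \<times> int \<times> int \<times> (int \<times> int) list \<Rightarrow> bool" where
  "certified = (\<lambda>(d, lo, hi, ps). length (fib_list d) = Suc (length ps) \<and> increasing_fractions ((0, 1) # ps) \<and>
     certified_range d (fib_list d) ((0, 1) # ps)
       (foldl (\<lambda>st k. map (weight_step d k) st) (map (\<lambda>i. (i, 1, 1)) [0..(d - 1) div 2]) [0..lo - 2]) [lo..hi])"

section \<open>Soundness of the checker\<close>

text \<open>The extra factor \<open>q\<close> on the left makes the formula hold for the empty list
  too.\<close>

lemma hom_eval_correct:
  assumes "q \<noteq> 0"
  shows "snd (hom_eval p q cs) = q ^ length cs \<and>
    real_of_int (fst (hom_eval p q cs)) * of_int q =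
      of_int q ^ length cs * (\<Sum>i<length cs. of_int (cs ! i) * (of_int p / of_int q) ^ i)"
proof (induction cs)
  case (Cons c cs)
  obtain v w where vw: "hom_eval p q cs = (v, w)" by force
  have w: "w = q ^ length cs" and v: "real_of_int v * of_int q =
      of_int q ^ length cs * (\<Sum>i<length cs. of_int (cs ! i) * (of_int p / of_int q) ^ i)"
    using Cons vw by auto
  let ?x = "real_of_int p / of_int q"
  have "(\<Sum>i<length (c # cs). of_int ((c # cs) ! i) * ?x ^ i) =
      of_int c + ?x * (\<Sum>i<length cs. of_int (cs ! i) * ?x ^ i)"
    by (simp add: sum.lessThan_Suc_shift sum_distrib_left mult_ac del: sum.lessThan_Suc)
  then have "of_int q ^ length (c # cs) * (\<Sum>i<length (c # cs). of_int ((c # cs) ! i) * ?x ^ i) =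
      of_int c * of_int q ^ length cs * of_int q + of_int p * (real_of_int q ^ length cs * (\<Sum>i<length cs. of_int (cs ! i) * ?x ^ i))"
    using assms by (simp add: algebra_simps)
  also have "\<dots> = (of_int c * of_int q ^ length cs + of_int p * of_int v) * of_int q"
    unfolding v[symmetric] by (simp add: algebra_simps)
  finally have e: "of_int q ^ length (c # cs) * (\<Sum>i<length (c # cs). of_int ((c # cs) ! i) * ?x ^ i) =
      (of_int c * of_int q ^ length cs + of_int p * of_int v) * of_int q" .
  have "fst (hom_eval p q (c # cs)) = c * q ^ length cs + p * v" "snd (hom_eval p q (c # cs)) = q ^ length (c # cs)"
    by (simp_all add: vw w)
  then show ?case using e by (simp only: of_int_add of_int_mult of_int_power)
qed simp

lemma alternating_nth:
  assumes "alternating cs s ps" "k < length ps"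
  shows "0 < s * (-1) ^ k * fst (hom_eval (- fst (ps ! k)) (snd (ps ! k)) cs)"
  using assms
proof (induction cs s ps arbitrary: k rule: alternating.induct)
  case (2 cs s p q ps)
  then show ?case by (cases k) auto
qed simp

lemma increasing_fractions_nth:
  assumes "increasing_fractions ps" "Suc k < length ps"
  shows "0 < snd (ps ! k) \<and> 0 < snd (ps ! Suc k) \<and>
    fst (ps ! k) * snd (ps ! Suc k) < fst (ps ! Suc k) * snd (ps ! k)"
  using assms
proof (induction ps arbitrary: k rule: increasing_fractions.induct)
  case (1 p q p' q' ps)
  then show ?case by (cases k) auto
qed auto

lemma length_add_lists: "length (add_lists xs ys) = max (length xs) (length ys)"
  by (induction xs ys rule: add_lists.induct) auto

lemma nth_add_lists:
  "i < max (length xs) (length ys) \<Longrightarrow> add_lists xs ys ! i =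
    (if i < length xs then xs ! i else 0) + (if i < length ys then ys ! i else 0)"
proof (induction xs ys arbitrary: i rule: add_lists.induct)
  case (3 x xs y ys)
  then show ?case by (cases i) auto
qed auto

lemma fib_list_eq:
  assumes "d > 0"
  shows "fib_list (int d) = map (\<lambda>i. int (d - 1 - i choose i)) [0..<Suc ((d - 1) div 2)]"
proof -
  define F where "F k = map (\<lambda>i. int (k - i choose i)) [0..<Suc (k div 2)]" for k
  let ?s = "\<lambda>(f, f') _. (f', add_lists f' (0 # f))"
  have rec: "F (Suc (Suc k)) = add_lists (F (Suc k)) (0 # F k)" for k
  proof (rule nth_equalityI)
    show len: "length (F (Suc (Suc k))) = length (add_lists (F (Suc k)) (0 # F k))"
      by (auto simp: F_def length_add_lists)
    fix i assume "i < length (F (Suc (Suc k)))"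
    then have i: "i \<le> Suc (k div 2)" by (simp add: F_def)
    have Fn: "F k ! i = int (k - i choose i)" if "i \<le> k div 2" for k i
      using that unfolding F_def by (subst nth_map) (auto simp del: upt_Suc)
    have lF: "length (F k) = Suc (k div 2)" for k by (simp add: F_def)
    have "add_lists (F (Suc k)) (0 # F k) ! i =
        (if i < length (F (Suc k)) then F (Suc k) ! i else 0) + (if i < length (0 # F k) then (0 # F k) ! i else 0)"
      using i by (intro nth_add_lists) (auto simp: lF)
    also have "(if i < length (F (Suc k)) then F (Suc k) ! i else 0) = int (Suc k - i choose i)"
      using Fn[of i "Suc k"] by (auto simp: lF binomial_eq_0)
    also have "(if i < length (0 # F k) then (0 # F k) ! i else 0) = (case i of 0 \<Rightarrow> 0 | Suc j \<Rightarrow> int (k - j choose j))"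
      using i Fn[of "i - 1" k] by (auto simp: lF split: nat.split)
    also have "int (Suc k - i choose i) + (case i of 0 \<Rightarrow> 0 | Suc j \<Rightarrow> int (k - j choose j)) = int (Suc (Suc k) - i choose i)"
    proof (cases i)
      case (Suc j)
      then have "j \<le> k" using i by simp
      then show ?thesis using Suc by (simp add: Suc_diff_le)
    qed simp
    also have "\<dots> = F (Suc (Suc k)) ! i" using i Fn[of i "Suc (Suc k)"] by simp
    finally show "F (Suc (Suc k)) ! i = add_lists (F (Suc k)) (0 # F k) ! i" by simp
  qed
  have "foldl ?s ([1], [1]) [1..int k] = (F k, F (Suc k))" for k
  proof (induction k)
    case 0
    show ?case by (simp add: F_def)
  next
    case (Suc k)
    have "[1..int (Suc k)] = [1..int k] @ [int (Suc k)]" using upto_rec2[of 1 "int (Suc k)"] by simp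
    then show ?case using Suc rec by simp
  qed
  from this[of "d - 1"] have "foldl ?s ([1], [1]) [1..int d - 1] = (F (d - 1), F (Suc (d - 1)))"
    using assms by (simp add: of_nat_diff)
  then show ?thesis unfolding fib_list_def by (simp add: F_def)
qed

fun weights :: "nat \<Rightarrow> int \<Rightarrow> int \<Rightarrow> int \<times> int \<times> int" where
  "weights 0 d i = (i, 1, 1)"
| "weights (Suc M) d i = weight_step d (int M) (weights M d i)"

lemma weights_correct:
  "fst (weights M d i) = i"
  "real_of_int (fst (snd (weights M d i))) = fact M * kl_weight M (of_int (d - i)) (of_int i)"
  "real_of_int (snd (snd (weights M d i))) = pochhammer (of_int (d - i) + 1) M * pochhammer (of_int i) M"
proof -
  define N where "N = real_of_int (d - i)"
  have "fst (weights M d i) = i \<and>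
    real_of_int (fst (snd (weights M d i))) = fact M * kl_weight M N (of_int i) \<and>
    real_of_int (snd (snd (weights M d i))) = pochhammer (N + 1) M * pochhammer (of_int i) M"
  proof (induction M)
    case 0
    then show ?case by (simp add: kl_weight_def)
  next
    case (Suc M)
    obtain q g where w: "weights M d i = (i, q, g)" using Suc by (metis prod.collapse)
    have IH: "real_of_int q = fact M * kl_weight M N (of_int i)"
      "real_of_int g = pochhammer (N + 1) M * pochhammer (of_int i) M" using Suc w by auto
    define g' where "g' = g * ((d - i + int M + 1) * (i + int M))"
    have g': "real_of_int g' = pochhammer (N + 1) (Suc M) * pochhammer (of_int i) (Suc M)"
      unfolding g'_def by (simp add: IH pochhammer_Suc N_def mult_ac add_ac)
    have "kl_weight (Suc M) N (of_int i) =
       (\<Sum>h\<le>M. pochhammer (N + 1) h * pochhammer (of_int i) h *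
          (pochhammer (of_int i + of_nat h + 2) (M - h) * (of_int i + real M + 2)) / fact h) +
       pochhammer (N + 1) (Suc M) * pochhammer (of_int i) (Suc M) / fact (Suc M)"
    proof -
      have "pochhammer (real_of_int i + of_nat h + 2) (Suc M - h) =
          pochhammer (of_int i + of_nat h + 2) (M - h) * (of_int i + real M + 2)" if "h \<le> M" for h
        using that by (simp add: Suc_diff_le pochhammer_Suc of_nat_diff)
      then have "(\<Sum>h\<le>M. pochhammer (N + 1) h * pochhammer (of_int i) h *
          pochhammer (of_int i + of_nat h + 2) (Suc M - h) / fact h) =
        (\<Sum>h\<le>M. pochhammer (N + 1) h * pochhammer (of_int i) h *
          (pochhammer (of_int i + of_nat h + 2) (M - h) * (of_int i + real M + 2)) / fact h)"
        by (intro sum.cong refl) simp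
      then show ?thesis unfolding kl_weight_def sum.atMost_Suc by simp
    qed
    also have "\<dots> = kl_weight M N (of_int i) * (of_int i + real M + 2) + of_int g' / fact (Suc M)"
      unfolding kl_weight_def g' sum_distrib_right by (simp add: mult_ac)
    finally have "fact (Suc M) * kl_weight (Suc M) N (of_int i) =
       of_int q * ((real M + 1) * (of_int i + real M + 2)) + of_int g'"
      unfolding IH by (simp add: distrib_left del: fact_Suc) (simp add: algebra_simps)
    then show ?case using w g' by (simp add: g'_def add_ac del: fact_Suc)
  qed
  then show "fst (weights M d i) = i"
    "real_of_int (fst (snd (weights M d i))) = fact M * kl_weight M (of_int (d - i)) (of_int i)"
    "real_of_int (snd (snd (weights M d i))) = pochhammer (of_int (d - i) + 1) M * pochhammer (of_int i) M"
    by (simp_all add: N_def)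
qed

lemma foldl_weight_step:
  "foldl (\<lambda>st k. map (weight_step d k) st) (map (\<lambda>i. (i, 1, 1)) is) [0..int M - 1] = map (weights M d) is"
proof (induction M)
  case (Suc M)
  have "[0..int (Suc M) - 1] = [0..int M - 1] @ [int M]" using upto_rec2[of 0 "int M"] by simp
  then show ?case using Suc by simp
qed simp

lemma certified_range_correct:
  assumes "certified_range d fs ps (map (weights M d) is) [int M + 1..hi]" "int m \<le> hi" "Suc M \<le> m"
  shows "alternating (map2 (\<lambda>f i. f * fst (snd (weights (m - 1) d i))) fs is) 1 ps"
  using assms
proof (induction "m - Suc M" arbitrary: M)
  case 0
  then have m: "m - 1 = M" by simp
  have "[int M + 1..hi] = (int M + 1) # [int M + 1 + 1..hi]" using 0 by (intro upto_rec1) auto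
  then show ?case using 0 by (simp add: m zip_map2 case_prod_unfold o_def)
next
  case (Suc n)
  have "[int M + 1..hi] = (int M + 1) # [int M + 1 + 1..hi]" using Suc by (intro upto_rec1) auto
  also have "int M + 1 + 1 = int (Suc M) + 1" by simp
  finally have "[int M + 1..hi] = (int M + 1) # [int (Suc M) + 1..hi]" .
  then have "certified_range d fs ps (map (weight_step d (int M + 1 - 1)) (map (weights M d) is)) [int (Suc M) + 1..hi]"
    using Suc.prems(1) by (simp only: certified_range.simps)
  also have "map (weight_step d (int M + 1 - 1)) (map (weights M d) is) = map (weights (Suc M) d) is" by simp
  finally have "certified_range d fs ps (map (weights (Suc M) d) is) [int (Suc M) + 1..hi]" .
  from Suc.hyps(1)[OF _ this Suc.prems(2)] show ?case using Suc.hyps(2) by simp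
qed

text \<open>The certificate has as many points besides 0 as the degree bound
  \<open>(d - 1) div 2\<close>, so the intermediate zeros between them are all the zeros there are.
  The checked integers are the coefficients scaled by \<open>fact (m - 1)\<close>.\<close>

lemma certified_imp_neg_rooted:
  fixes m d :: nat
  assumes cert: "certified (int d, int lo, int hi, ps)" and m: "1 \<le> lo" "lo \<le> m" "m \<le> hi" and d: "0 < d"
  shows "neg_rooted (diag_poly (\<lambda>i. poly (kl_weight_poly (m - 1) d) (of_nat i)) (fib_poly (d - 1)))"
proof -
  let ?n = "length ps" and ?ps = "(0, 1) # ps" and ?M = "m - 1"
  define cs where "cs = map (\<lambda>i. int (d - 1 - i choose i) * fst (snd (weights ?M (int d) (int i)))) [0..<Suc ?n]"
  have n: "?n = (d - 1) div 2" and inc: "increasing_fractions ?ps"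
    using cert d by (auto simp: certified_def fib_list_eq)
  have "alternating cs 1 ?ps"
  proof -
    have up: "[0..(int d - 1) div 2] = map int [0..<Suc ?n]"
    proof -
      have "[0..int k] = map int [0..<Suc k]" for k
      proof (induction k)
        case (Suc k)
        then show ?case using upto_rec2[of 0 "int (Suc k)"] by simp
      qed simp
      moreover have "(int d - 1) div 2 = int ?n" using d unfolding n by (simp add: zdiv_int of_nat_diff)
      ultimately show ?thesis by (simp only:)
    qed
    have lo: "[0..int lo - 2] = [0..int (lo - 1) - 1]" "[int lo..int hi] = [int (lo - 1) + 1..int hi]"
      using m by (auto simp: of_nat_diff)
    have "certified_range (int d) (fib_list (int d)) ?ps (map (weights (lo - 1) (int d)) (map int [0..<Suc ?n])) [int (lo - 1) + 1..int hi]"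
      using cert unfolding certified_def prod.case up lo foldl_weight_step by blast
    then have "alternating (map2 (\<lambda>f i. f * fst (snd (weights ?M (int d) i))) (fib_list (int d)) (map int [0..<Suc ?n])) 1 ?ps"
      using m by (intro certified_range_correct[where hi = "int hi" and M = "lo - 1"]) auto
    also have "map2 (\<lambda>f i. f * fst (snd (weights ?M (int d) i))) (fib_list (int d)) (map int [0..<Suc ?n]) = cs"
      unfolding fib_list_eq[OF d] cs_def n by (simp add: zip_map_map zip_same_conv_map case_prod_unfold del: upt_Suc)
    finally show ?thesis .
  qed
  note alt = alternating_nth[OF this]
  define t where "t k = - (real_of_int (fst (?ps ! k)) / of_int (snd (?ps ! k)))" for k
  define f where "f x = (\<Sum>i<length cs. real_of_int (cs ! i) * x ^ i)" for x
  have q: "0 < snd (?ps ! k)" if "k \<le> ?n" for k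
  proof (cases k)
    case (Suc l)
    then show ?thesis using increasing_fractions_nth[OF inc, of l] that by simp
  qed simp
  have cont: "isCont f x" for x unfolding f_def by (intro continuous_intros)
  have dec: "t (Suc k) < t k" if "k < ?n" for k
  proof -
    have *: "fst (?ps ! k) * snd (?ps ! Suc k) < fst (?ps ! Suc k) * snd (?ps ! k)"
      "0 < snd (?ps ! k)" "0 < snd (?ps ! Suc k)"
      using increasing_fractions_nth[OF inc, of k] that by auto
    have "real_of_int (fst (?ps ! k)) * of_int (snd (?ps ! Suc k)) < of_int (fst (?ps ! Suc k)) * of_int (snd (?ps ! k))"
      using *(1) unfolding of_int_mult[symmetric] of_int_less_iff .
    moreover have "x / y < x' / y'" if "x * y' < x' * y" "0 < y" "0 < y'" for x y x' y' :: real
      using that by (simp add: field_simps)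
    ultimately show ?thesis using *(2,3) unfolding t_def neg_less_iff_less by (simp only: of_int_0_less_iff)
  qed
  have sgn: "(-1) ^ k * f (t k) > 0" if "k \<le> ?n" for k
  proof -
    let ?p = "fst (?ps ! k)" and ?q = "snd (?ps ! k)"
    have q0: "?q > 0" by (rule q[OF that])
    have "0 < (-1) ^ k * fst (hom_eval (- ?p) ?q cs)" using alt[of k] that by simp
    then have "real_of_int ((-1) ^ k * fst (hom_eval (- ?p) ?q cs)) > 0" by (simp only: of_int_0_less_iff)
    then have "0 < (-1) ^ k * real_of_int (fst (hom_eval (- ?p) ?q cs)) * of_int ?q"
      using q0 by simp
    also have "\<dots> = (-1) ^ k * (of_int ?q ^ length cs * f (t k))"
      using hom_eval_correct[of ?q "- ?p" cs] q0 unfolding f_def t_def by (simp add: mult.assoc)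
    finally have "0 < of_int ?q ^ length cs * ((-1) ^ k * f (t k))" by (simp add: mult_ac)
    moreover have "0 < real_of_int ?q ^ length cs" using q0 by simp
    ultimately show ?thesis by (simp only: zero_less_mult_pos)
  qed
  obtain A where A: "finite A" "card A = ?n" "\<And>x. x \<in> A \<Longrightarrow> f x = 0 \<and> x < t 0"
    using alternating_signs_roots[of f ?n t, OF cont dec sgn] by metis
  define G where "G = diag_poly (\<lambda>i. poly (kl_weight_poly ?M d) (of_nat i)) (fib_poly (d - 1))"
  have cs: "of_real (real_of_int (cs ! i)) = fact ?M * coeff G i" if "i \<le> ?n" for i
  proof -
    have "cs ! i = int (d - 1 - i choose i) * fst (snd (weights ?M (int d) (int i)))"
      using that unfolding cs_def by (subst nth_map) (auto simp del: upt_Suc)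
    then have "real_of_int (cs ! i) = real (d - 1 - i choose i) * (fact ?M * kl_weight ?M (real d - real i) (real i))"
      using weights_correct(2)[of ?M "int d" "int i"] by simp
    moreover have "poly (kl_weight_poly ?M d) (of_nat i) = of_real (kl_weight ?M (real d - real i) (real i))"
      using kl_weight_of_real[of ?M "real d - real i" "real i"] by (simp add: poly_kl_weight_poly)
    ultimately show ?thesis by (simp add: G_def coeff_fib_poly mult_ac)
  qed
  have degG: "degree G \<le> ?n"
    unfolding G_def by (rule degree_le) (auto simp: n coeff_fib_poly binomial_eq_0)
  have Pf: "fact ?M * poly G (of_real x) = of_real (f x)" for x
  proof -
    have "fact ?M * poly G (of_real x) = (\<Sum>i\<le>?n. fact ?M * coeff G i * of_real x ^ i)"
      unfolding poly_eq_sum_coeff[OF degG] sum_distrib_left by (simp add: mult.assoc)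
    also have "\<dots> = (\<Sum>i\<le>?n. of_real (real_of_int (cs ! i) * x ^ i))"
    proof (rule sum.cong[OF refl])
      fix i assume "i \<in> {..?n}"
      then have "fact ?M * coeff G i = of_real (real_of_int (cs ! i))" using cs[of i] by simp
      then show "fact ?M * coeff G i * of_real x ^ i = of_real (real_of_int (cs ! i) * x ^ i)" by simp
    qed
    also have "\<dots> = of_real (f x)" by (simp add: f_def cs_def lessThan_Suc_atMost del: upt_Suc)
    finally show ?thesis .
  qed
  have "G \<noteq> 0"
  proof
    assume "G = 0"
    then have "f (t 0) = 0" using Pf[of "t 0"] by simp
    then show False using sgn[of 0] by simp
  qed
  then have fin: "finite {z. poly G z = 0}" "card {z. poly G z = 0} \<le> ?n"
    using poly_roots_finite[of G] card_poly_roots_bound[of G] degG by auto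
  have sub: "of_real ` A \<subseteq> {z. poly G z = 0}"
  proof
    fix z :: complex assume "z \<in> of_real ` A"
    then obtain x where x: "x \<in> A" "z = of_real x" by auto
    then have "fact ?M * poly G z = 0" using Pf[of x] A(3)[of x] by simp
    then show "z \<in> {z. poly G z = 0}" by simp
  qed
  have "card (complex_of_real ` A) = ?n" using A(2) by (simp add: card_image inj_on_def)
  then have roots: "of_real ` A = {z. poly G z = 0}" using sub fin by (intro card_seteq) auto
  show ?thesis unfolding neg_rooted_def G_def[symmetric]
  proof (intro allI impI)
    fix z assume "poly G z = 0"
    then obtain x where "x \<in> A" "z = of_real x" using roots by blast
    then show "z \<in> \<real> \<and> Re z < 0" using A(3)[of x] by (auto simp: t_def)
  qed
qed

section \<open>The certificates and their evaluation\<close>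

text \<open>All denominators are powers of two. Up to \<open>d = 17\<close> every \<open>m\<close>
  from 2 to 15 is covered; from \<open>d = 18\<close> on the ranges start at the least
  \<open>m\<close> with \<open>d < 3 * m - 1\<close>. A rank has several entries where the points
  change with \<open>m\<close>.\<close>

definition certificate_list :: "(int \<times> int \<times> int \<times> (int \<times> int) list) list" where
  "certificate_list =
   [(1, 2, 15, []),
    (2, 2, 15, []),
    (3, 2, 15, [(1, 1)]),
    (4, 2, 15, [(1, 1)]),
    (5, 2, 15, [(1, 2), (2, 1)]),
    (6, 2, 15, [(1, 4), (1, 1)]),
    (7, 2, 15, [(1, 8), (1, 1), (8, 1)]),
    (8, 2, 15, [(1, 8), (1, 2), (2, 1)]),
    (9, 2, 15, [(1, 16), (7, 16), (1, 1), (8, 1)]),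
    (10, 2, 11, [(1, 16), (23, 64), (1, 1), (4, 1)]),
    (10, 12, 15, [(1, 16), (1, 4), (1, 1), (2, 1)]),
    (11, 2, 6, [(1, 16), (11, 32), (1, 1), (2, 1), (16, 1)]),
    (11, 7, 15, [(1, 16), (1, 4), (1, 2), (2, 1), (16, 1)]),
    (12, 2, 5, [(1, 16), (21, 64), (1, 2), (1, 1), (4, 1)]),
    (12, 6, 15, [(1, 32), (1, 8), (1, 2), (1, 1), (4, 1)]),
    (13, 2, 4, [(1, 8), (5, 16), (1, 2), (1, 1), (2, 1), (32, 1)]),
    (13, 5, 15, [(1, 32), (1, 8), (3, 8), (1, 1), (2, 1), (16, 1)]),
    (14, 2, 4, [(1, 16), (19, 64), (1, 2), (1, 1), (2, 1), (8, 1)]),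
    (14, 5, 15, [(1, 32), (1, 8), (5, 16), (3, 4), (2, 1), (8, 1)]),
    (15, 2, 3, [(1, 8), (5, 16), (1, 2), (3, 4), (1, 1), (4, 1), (32, 1)]),
    (15, 4, 15, [(1, 32), (1, 8), (19, 64), (1, 2), (1, 1), (4, 1), (32, 1)]),
    (16, 2, 3, [(1, 8), (5, 16), (3, 8), (1, 2), (1, 1), (2, 1), (8, 1)]),
    (16, 4, 12, [(1, 32), (1, 8), (9, 32), (1, 2), (1, 1), (2, 1), (8, 1)]),
    (16, 13, 15, [(1, 32), (1, 16), (1, 4), (1, 2), (1, 1), (2, 1), (8, 1)]),
    (17, 2, 3, [(1, 8), (5, 16), (3, 8), (1, 2), (1, 1), (2, 1), (4, 1), (32, 1)]),
    (17, 4, 10, [(1, 32), (1, 8), (17, 64), (7, 16), (3, 4), (2, 1), (4, 1), (32, 1)]),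
    (17, 11, 15, [(1, 64), (1, 16), (1, 8), (3, 8), (1, 2), (1, 1), (4, 1), (32, 1)]),
    (18, 7, 15, [(1, 64), (1, 16), (3, 16), (3, 8), (1, 2), (1, 1), (2, 1), (8, 1)]),
    (19, 7, 15, [(1, 64), (1, 16), (5, 32), (5, 16), (1, 2), (1, 1), (2, 1), (4, 1), (64, 1)]),
    (20, 8, 15, [(1, 64), (1, 16), (1, 8), (1, 4), (1, 2), (3, 4), (2, 1), (4, 1), (16, 1)]),
    (21, 8, 15, [(1, 64), (1, 16), (1, 8), (1, 4), (3, 8), (3, 4), (1, 1), (2, 1), (8, 1),
     (64, 1)]),
    (22, 8, 15, [(1, 64), (1, 16), (1, 8), (7, 32), (3, 8), (1, 2), (1, 1), (2, 1), (4, 1),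
     (16, 1)]),
    (23, 9, 15, [(1, 64), (1, 16), (1, 8), (3, 16), (5, 16), (1, 2), (3, 4), (3, 2), (2, 1),
     (8, 1), (64, 1)]),
    (24, 9, 15, [(1, 64), (1, 32), (1, 8), (3, 16), (5, 16), (1, 2), (3, 4), (1, 1), (2, 1),
     (4, 1), (16, 1)]),
    (25, 9, 15, [(1, 64), (1, 32), (3, 32), (3, 16), (9, 32), (3, 8), (5, 8), (1, 1), (2, 1),
     (4, 1), (8, 1), (64, 1)]),
    (26, 10, 15, [(1, 64), (1, 32), (3, 32), (3, 16), (1, 4), (3, 8), (1, 2), (3, 4), (3, 2),
     (2, 1), (4, 1), (16, 1)]),
    (27, 10, 15, [(1, 64), (1, 32), (3, 32), (5, 32), (1, 4), (3, 8), (1, 2), (3, 4), (1, 1),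
     (2, 1), (4, 1), (8, 1), (128, 1)]),
    (28, 10, 15, [(1, 128), (1, 32), (3, 32), (5, 32), (1, 4), (5, 16), (7, 16), (5, 8), (1, 1),
     (3, 2), (4, 1), (8, 1), (32, 1)]),
    (29, 11, 15, [(1, 128), (1, 32), (1, 16), (1, 8), (7, 32), (5, 16), (3, 8), (1, 2), (3, 4),
     (3, 2), (2, 1), (4, 1), (16, 1), (128, 1)]),
    (30, 11, 15, [(1, 128), (1, 32), (1, 16), (1, 8), (3, 16), (5, 16), (3, 8), (1, 2), (3, 4),
     (1, 1), (2, 1), (4, 1), (8, 1), (32, 1)]),
    (31, 11, 15, [(1, 128), (1, 32), (1, 16), (1, 8), (3, 16), (9, 32), (3, 8), (1, 2), (3, 4),
     (1, 1), (3, 2), (2, 1), (4, 1), (16, 1), (128, 1)]),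
    (32, 12, 15, [(1, 128), (1, 32), (1, 16), (1, 8), (3, 16), (1, 4), (3, 8), (7, 16), (5, 8),
     (3, 4), (1, 1), (2, 1), (4, 1), (8, 1), (32, 1)]),
    (33, 12, 15, [(1, 128), (1, 32), (1, 16), (1, 8), (3, 16), (1, 4), (5, 16), (7, 16), (1, 2),
     (3, 4), (1, 1), (2, 1), (4, 1), (8, 1), (16, 1), (128, 1)]),
    (34, 12, 15, [(1, 128), (1, 32), (1, 16), (1, 8), (3, 16), (1, 4), (5, 16), (3, 8), (1, 2),
     (3, 4), (1, 1), (3, 2), (2, 1), (4, 1), (8, 1), (32, 1)]),
    (35, 13, 15, [(1, 128), (1, 32), (1, 16), (3, 32), (5, 32), (7, 32), (5, 16), (3, 8),
     (1, 2), (5, 8), (3, 4), (1, 1), (2, 1), (4, 1), (8, 1), (16, 1), (128, 1)]),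
    (36, 13, 15, [(1, 128), (1, 32), (1, 16), (3, 32), (5, 32), (7, 32), (9, 32), (3, 8),
     (1, 2), (5, 8), (3, 4), (1, 1), (3, 2), (2, 1), (4, 1), (8, 1), (32, 1)]),
    (37, 13, 15, [(1, 128), (1, 32), (1, 16), (3, 32), (5, 32), (3, 16), (1, 4), (3, 8),
     (7, 16), (1, 2), (3, 4), (1, 1), (3, 2), (2, 1), (4, 1), (8, 1), (16, 1), (256, 1)]),
    (38, 14, 15, [(1, 128), (1, 32), (1, 16), (3, 32), (1, 8), (3, 16), (1, 4), (5, 16), (3, 8),
     (1, 2), (5, 8), (3, 4), (1, 1), (2, 1), (3, 1), (4, 1), (16, 1), (64, 1)]),
    (39, 14, 15, [(1, 128), (1, 32), (1, 16), (3, 32), (1, 8), (3, 16), (1, 4), (5, 16), (3, 8),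
     (1, 2), (5, 8), (3, 4), (1, 1), (3, 2), (2, 1), (4, 1), (8, 1), (32, 1), (256, 1)]),
    (40, 14, 15, [(1, 128), (1, 64), (1, 16), (3, 32), (1, 8), (3, 16), (1, 4), (5, 16), (3, 8),
     (1, 2), (5, 8), (3, 4), (1, 1), (3, 2), (2, 1), (4, 1), (8, 1), (16, 1), (64, 1)]),
    (41, 15, 15, [(1, 128), (1, 64), (1, 32), (1, 16), (1, 8), (3, 16), (1, 4), (5, 16), (3, 8),
     (7, 16), (1, 2), (3, 4), (7, 8), (1, 1), (2, 1), (3, 1), (4, 1), (8, 1), (32, 1),
     (256, 1)]),
    (42, 15, 15, [(1, 128), (1, 64), (1, 32), (1, 16), (1, 8), (3, 16), (1, 4), (9, 32), (3, 8),
     (7, 16), (1, 2), (5, 8), (3, 4), (1, 1), (3, 2), (2, 1), (4, 1), (8, 1), (16, 1),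
     (64, 1)]),
    (43, 15, 15, [(1, 128), (1, 64), (1, 32), (1, 16), (1, 8), (3, 16), (7, 32), (1, 4),
     (5, 16), (3, 8), (1, 2), (5, 8), (3, 4), (1, 1), (3, 2), (2, 1), (3, 1), (4, 1), (8, 1),
     (32, 1), (256, 1)])]"

text \<open>\<open>code_simp\<close> evaluates within the logic, without trust in generated code.
  The check is split into ever shorter ranges of \<open>d\<close>, as lists and numbers grow with
  \<open>d\<close>.\<close>

lemma certified_1_to_20:
  "list_all certified (filter (\<lambda>(d, _). 1 \<le> d \<and> d \<le> 20) certificate_list)"
  by code_simp

lemma certified_21_to_28:
  "list_all certified (filter (\<lambda>(d, _). 21 \<le> d \<and> d \<le> 28) certificate_list)"
  by code_simp

lemma certified_29_to_34:
  "list_all certified (filter (\<lambda>(d, _). 29 \<le> d \<and> d \<le> 34) certificate_list)"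
  by code_simp

lemma certified_35_to_38:
  "list_all certified (filter (\<lambda>(d, _). 35 \<le> d \<and> d \<le> 38) certificate_list)"
  by code_simp

lemma certified_39_to_41:
  "list_all certified (filter (\<lambda>(d, _). 39 \<le> d \<and> d \<le> 41) certificate_list)"
  by code_simp

lemma certified_42_to_43:
  "list_all certified (filter (\<lambda>(d, _). 42 \<le> d \<and> d \<le> 43) certificate_list)"
  by code_simp

lemma certificate_list_cover:
  "list_all (\<lambda>d. list_all (\<lambda>m. 18 \<le> d \<and> 3 * m - 1 \<le> d \<or>
     list_ex (\<lambda>(d', lo, hi, _). d' = d \<and> 1 \<le> lo \<and> lo \<le> m \<and> m \<le> hi) certificate_list) [2..15]) [1..43]"
  by code_simp

lemma neg_rooted_small_rank:
  fixes m d :: nat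
  assumes "2 \<le> m" "m \<le> 15" "1 \<le> d" "\<not> (18 \<le> d \<and> 3 * m - 1 \<le> d)"
  shows "neg_rooted (diag_poly (\<lambda>i. poly (kl_weight_poly (m - 1) d) (of_nat i)) (fib_poly (d - 1)))"
proof -
  \<comment> \<open>Either \<open>d \<le> 17\<close>, or
    \<open>d < 3 * m - 1 \<le> 44\<close>.\<close>
  have d: "d \<le> 43" using assms by linarith
  have "int d \<in> set [1..43]" "int m \<in> set [2..15]"
    using d assms(1-3) unfolding set_upto atLeastAtMost_iff by linarith+
  moreover have "\<not> (18 \<le> int d \<and> 3 * int m - 1 \<le> int d)" using assms by linarith
  ultimately have "\<exists>(d', lo, hi, _) \<in> set certificate_list. d' = int d \<and> 1 \<le> lo \<and> lo \<le> int m \<and> int m \<le> hi"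
    using certificate_list_cover unfolding list_all_iff list_ex_iff by blast
  then obtain lo hi ps where c: "(int d, lo, hi, ps) \<in> set certificate_list" "1 \<le> lo" "lo \<le> int m" "int m \<le> hi"
    by auto
  have filter: "certified x" if "list_all certified (filter P certificate_list)" "x \<in> set certificate_list" "P x" for P x
    using that by (cases x) (simp add: list_all_iff)
  note certified = filter[OF _ c(1)]
  consider "d \<le> 20" | "21 \<le> d" "d \<le> 28" | "29 \<le> d" "d \<le> 34" | "35 \<le> d" "d \<le> 38" | "39 \<le> d" "d \<le> 41" | "42 \<le> d"
    by linarith
  then have "certified (int d, lo, hi, ps)"
  proof cases
    case 1
    then show ?thesis using certified[OF certified_1_to_20] assms(3) by simp
  next
    case 2
    then show ?thesis using certified[OF certified_21_to_28] by simp
  next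
    case 3
    then show ?thesis using certified[OF certified_29_to_34] by simp
  next
    case 4
    then show ?thesis using certified[OF certified_35_to_38] by simp
  next
    case 5
    then show ?thesis using certified[OF certified_39_to_41] by simp
  next
    case 6
    then show ?thesis using certified[OF certified_42_to_43] d by simp
  qed
  then have "certified (int d, int (nat lo), int (nat hi), ps)" using c by simp
  then show ?thesis by (rule certified_imp_neg_rooted) (use c assms(3) in linarith)+
qed

section \<open>Combination of large and small ranks\<close>

theorem theorem1p5:
  fixes m d :: nat
  assumes "2 \<le> m" and "m \<le> 15" and "d \<ge> 1"
  shows "\<forall>z::complex. poly (map_poly of_int (kl_poly (uniform_matroid m d))) z = 0
           \<longrightarrow> z \<in> \<real> \<and> Re z < 0"
proof -
  obtain M where M: "m = Suc M" using assms(1) by (cases m) auto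
  define G where "G = diag_poly (\<lambda>i. poly (kl_weight_poly M d) (of_nat i)) (fib_poly (d - 1))"
  have G: "neg_rooted G"
  proof (cases "18 \<le> d \<and> 3 * m - 1 \<le> d")
    case True
    then show ?thesis unfolding G_def M by (intro neg_rooted_diag_kl_weight_poly) auto
  next
    case False
    then show ?thesis using neg_rooted_small_rank[OF assms False] by (simp add: G_def M)
  qed
  have "degree G \<le> d - 1"
    using degree_diag_poly_le[of _ "fib_poly (d - 1)"] degree_fib_poly_le[of "d - 1"]
    unfolding G_def by (meson div_le_dividend order_trans)
  then have deg: "degree G \<le> d + m" by simp
  let ?p = "diag_poly (\<lambda>i. 1 / fact (i + m)) (diag_poly (\<lambda>i. 1 / fact (d + m - i)) G)"
  have p: "neg_rooted ?p" by (intro neg_rooted_div_fact_add neg_rooted_div_fact_diff G deg)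
  have "map_poly of_int (uniform_kl m d) = smult (fact (d + m)) ?p"
  proof (rule poly_eqI)
    fix i
    have "complex_of_int (coeff (uniform_kl m d) i) = of_real (real_of_int (coeff (uniform_kl m d) i))" by simp
    also have "\<dots> = of_real (fact (d + m) * (real (d - 1 - i choose i) * kl_weight M (real d - real i) (real i) /
        (fact (d + m - i) * fact (i + m))))"
    proof (cases "2 * i < d")
      case False
      \<comment> \<open>The Fibonacci coefficients stop where the Kazhdan-Lusztig polynomial does:
        \<open>2 * i \<ge> d\<close> means \<open>d - 1 - i < i\<close>.\<close>
      then have "d - 1 - i choose i = 0" using assms(3) by (intro binomial_eq_0) auto
      with False show ?thesis unfolding M coeff_uniform_kl by (simp del: fact_Suc)
    qed (simp add: M coeff_uniform_kl del: fact_Suc)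
    also have "\<dots> = coeff (smult (fact (d + m)) ?p) i"
    proof -
      have "poly (kl_weight_poly M d) (of_nat i) = of_real (kl_weight M (real d - real i) (real i))"
        using kl_weight_of_real[of M "real d - real i" "real i"] by (simp add: poly_kl_weight_poly)
      then show ?thesis by (simp add: G_def coeff_fib_poly mult_ac del: fact_Suc)
    qed
    finally show "coeff (map_poly of_int (uniform_kl m d)) i = coeff (smult (fact (d + m)) ?p) i"
      by (simp add: coeff_map_poly del: fact_Suc)
  qed
  then show ?thesis using p assms by (simp add: neg_rooted_def kl_poly_uniform_matroid)
qed

end
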